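(* Let $\mathbb{Q}^{n+1}_1(c)$ be a connected, timelike geodesically complete $(n+1)$-dimensional spacetime with constant sectional curvature $c$, and let $\mathcal{F}$ be a spacelike foliation by hypersurfaces of $\mathbb{Q}^{n+1}_1(c)$. Let $N$ be the unit timelike vector field normal to the leaves of $\mathcal{F}$. If $N$ is geodesic (that is, $\nabla_N N=0$) and if there exists a totally umbilical leaf of $\mathcal{F}$, then all leaves of $\mathcal{F}$ are totally umbilical.
   Context: A Lorentz manifold is a smooth manifold with a pseudo-Riemannian metric of signature $(+,\dots,+,-)$; a spacetime is a time-oriented Lorentz manifold. It is timelike geodesically complete if every maximal timelike geodesic is defined on the entire real line. $\nabla$ is the Levi-Civita connection. A spacelike foliation by hypersurfaces is a codimension-one foliation such that the metric induced on each leaf is Riemannian; throughout, the unit timelike normal field $N$ is taken to be defined on the whole manifold. A leaf is totally umbilical if at each of its points the second fundamental form (with respect to $N$) is a scalar multiple of the induced metric. *)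

theory Defs
  imports "HOL-Analysis.Analysis"
begin

text \<open>
  Manifolds are topological spaces (the whole type) with a maximal smooth atlas. A tensor field is
  given by its components in every chart of the atlas, as functions on the image of the chart in
  the model space, subject to the usual transformation law on overlaps. The values of a chart
  outside its domain, and of components outside the image of the chart, are irrelevant junk.
\<close>

section \<open>Smooth manifolds\<close>

primrec Ck_on ::
  "nat \<Rightarrow> 'a::real_normed_vector set \<Rightarrow> ('a \<Rightarrow> 'b::real_normed_vector) \<Rightarrow> bool" where
  "Ck_on 0 S f \<longleftrightarrow> continuous_on S f"
| "Ck_on (Suc k) S f \<longleftrightarrow>
     (\<forall>x\<in>S. f differentiable (at x)) \<and>
     (\<forall>v. Ck_on k S (\<lambda>x. frechet_derivative f (at x) v))"

text \<open>Only used for open \<open>S\<close>.\<close>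

definition smooth_on ::
  "'a::real_normed_vector set \<Rightarrow> ('a \<Rightarrow> 'b::real_normed_vector) \<Rightarrow> bool" where
  "smooth_on S f \<longleftrightarrow> (\<forall>k. Ck_on k S f)"

type_synonym ('m, 'e) chart = "'m set \<times> ('m \<Rightarrow> 'e)"

definition cdom :: "('m, 'e) chart \<Rightarrow> 'm set" where
  "cdom c = fst c"

definition cmap :: "('m, 'e) chart \<Rightarrow> 'm \<Rightarrow> 'e" where
  "cmap c = snd c"

definition cimg :: "('m, 'e) chart \<Rightarrow> 'e set" where
  "cimg c = cmap c ` cdom c"

definition is_chart :: "('m::topological_space, 'e::euclidean_space) chart \<Rightarrow> bool" where
  "is_chart c \<longleftrightarrow> open (cdom c) \<and> open (cimg c) \<and>
     homeomorphism (cdom c) (cimg c) (cmap c) (inv_into (cdom c) (cmap c))"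

definition transition :: "('m, 'e) chart \<Rightarrow> ('m, 'e) chart \<Rightarrow> 'e \<Rightarrow> 'e" where
  "transition c d = cmap d \<circ> inv_into (cdom c) (cmap c)"

definition overlap :: "('m, 'e) chart \<Rightarrow> ('m, 'e) chart \<Rightarrow> 'e set" where
  "overlap c d = cmap c ` (cdom c \<inter> cdom d)"

definition smoothly_compatible ::
  "('m, 'e::euclidean_space) chart \<Rightarrow> ('m, 'e) chart \<Rightarrow> bool" where
  "smoothly_compatible c d \<longleftrightarrow>
     smooth_on (overlap c d) (transition c d) \<and> smooth_on (overlap d c) (transition d c)"

definition smooth_structure :: "('m::topological_space, 'e::euclidean_space) chart set \<Rightarrow> bool" where
  "smooth_structure A \<longleftrightarrow>
     (\<forall>c\<in>A. is_chart c) \<and> (\<Union>c\<in>A. cdom c) = UNIV \<and>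
     (\<forall>c\<in>A. \<forall>d\<in>A. smoothly_compatible c d) \<and>
     (\<forall>c. is_chart c \<and> (\<forall>d\<in>A. smoothly_compatible c d) \<longrightarrow> c \<in> A)"

section \<open>Vector fields, Lorentz metrics, spacetimes\<close>

type_synonym ('m, 'e) vfield = "('m, 'e) chart \<Rightarrow> 'e \<Rightarrow> 'e"
type_synonym ('m, 'e) bform = "('m, 'e) chart \<Rightarrow> 'e \<Rightarrow> 'e \<Rightarrow> 'e \<Rightarrow> real"

definition vector_components ::
  "('m, 'e::euclidean_space) chart set \<Rightarrow> ('m, 'e) vfield \<Rightarrow> bool" where
  "vector_components A X \<longleftrightarrow>
     (\<forall>c\<in>A. \<forall>d\<in>A. \<forall>x\<in>overlap c d.
        X d (transition c d x) = frechet_derivative (transition c d) (at x) (X c x))"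

definition smooth_vector_field ::
  "('m, 'e::euclidean_space) chart set \<Rightarrow> ('m, 'e) vfield \<Rightarrow> bool" where
  "smooth_vector_field A X \<longleftrightarrow>
     vector_components A X \<and> (\<forall>c\<in>A. smooth_on (cimg c) (X c))"

definition continuous_vector_field ::
  "('m, 'e::euclidean_space) chart set \<Rightarrow> ('m, 'e) vfield \<Rightarrow> bool" where
  "continuous_vector_field A X \<longleftrightarrow>
     vector_components A X \<and> (\<forall>c\<in>A. continuous_on (cimg c) (X c))"

text \<open>Signature \<open>(+,\<dots>,+,-)\<close>, via an orthonormal basis \<open>B\<close> whose timelike member is \<open>t\<close>.\<close>

definition lorentz_form :: "('e::euclidean_space \<Rightarrow> 'e \<Rightarrow> real) \<Rightarrow> bool" where
  "lorentz_form b \<longleftrightarrow> bilinear b \<and> (\<forall>u v. b u v = b v u) \<and>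
     (\<exists>B t. independent B \<and> span B = UNIV \<and> t \<in> B \<and> b t t = -1 \<and>
        (\<forall>v\<in>B - {t}. b v v = 1) \<and> (\<forall>v\<in>B. \<forall>w\<in>B. v \<noteq> w \<longrightarrow> b v w = 0))"

definition lorentz_metric ::
  "('m, 'e::euclidean_space) chart set \<Rightarrow> ('m, 'e) bform \<Rightarrow> bool" where
  "lorentz_metric A g \<longleftrightarrow>
     (\<forall>c\<in>A. (\<forall>x\<in>cimg c. lorentz_form (g c x)) \<and> (\<forall>u v. smooth_on (cimg c) (\<lambda>x. g c x u v))) \<and>
     (\<forall>c\<in>A. \<forall>d\<in>A. \<forall>x\<in>overlap c d. \<forall>u v.
        g d (transition c d x) (frechet_derivative (transition c d) (at x) u)
                               (frechet_derivative (transition c d) (at x) v) = g c x u v)"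

definition timelike_field ::
  "('m, 'e) chart set \<Rightarrow> ('m, 'e) bform \<Rightarrow> ('m, 'e) vfield \<Rightarrow> bool" where
  "timelike_field A g X \<longleftrightarrow> (\<forall>c\<in>A. \<forall>x\<in>cimg c. g c x (X c x) (X c x) < 0)"

text \<open>The time orientation is given by a continuous timelike vector field \<open>T\<close>.\<close>

definition spacetime ::
  "('m::topological_space, 'e::euclidean_space) chart set \<Rightarrow> ('m, 'e) bform \<Rightarrow> ('m, 'e) vfield \<Rightarrow> bool"
  where
  "spacetime A g T \<longleftrightarrow> smooth_structure A \<and> lorentz_metric A g \<and>
     continuous_vector_field A T \<and> timelike_field A g T"

section \<open>The Levi-Civita connection\<close>

text \<open>
  A connection is given in each chart by its coefficients
  \<open>\<Gamma> c x u v = (\<Sum> i j k. \<Gamma>\<^sup>k\<^sub>i\<^sub>j(x) u\<^sup>i v\<^sup>j e\<^sub>k)\<close>. The operators below act on vector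
  fields over the domain of one chart, written in that chart.
\<close>

type_synonym ('m, 'e) conn = "('m, 'e) chart \<Rightarrow> 'e \<Rightarrow> 'e \<Rightarrow> 'e \<Rightarrow> 'e"

definition cov ::
  "('m, 'e::euclidean_space) conn \<Rightarrow> ('m, 'e) chart \<Rightarrow> ('e \<Rightarrow> 'e) \<Rightarrow> ('e \<Rightarrow> 'e) \<Rightarrow> 'e \<Rightarrow> 'e" where
  "cov \<Gamma> c X Y x = frechet_derivative Y (at x) (X x) + \<Gamma> c x (X x) (Y x)"

definition lie_bracket :: "('e::euclidean_space \<Rightarrow> 'e) \<Rightarrow> ('e \<Rightarrow> 'e) \<Rightarrow> 'e \<Rightarrow> 'e" where
  "lie_bracket X Y x = frechet_derivative Y (at x) (X x) - frechet_derivative X (at x) (Y x)"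

text \<open>
  The transformation law says that the derivative of the field \<open>D\<tau> v\<close> in the direction
  \<open>D\<tau> u\<close>, computed in the chart \<open>d\<close>, is the image under \<open>D\<tau>\<close> of the derivative
  \<open>\<Gamma> c x u v\<close> of the constant field \<open>v\<close> in the direction \<open>u\<close>, computed in the chart \<open>c\<close>.
\<close>

definition connection ::
  "('m, 'e::euclidean_space) chart set \<Rightarrow> ('m, 'e) conn \<Rightarrow> bool" where
  "connection A \<Gamma> \<longleftrightarrow>
     (\<forall>c\<in>A. (\<forall>x\<in>cimg c. bilinear (\<Gamma> c x)) \<and> (\<forall>u v. smooth_on (cimg c) (\<lambda>x. \<Gamma> c x u v))) \<and>
     (\<forall>c\<in>A. \<forall>d\<in>A. \<forall>x\<in>overlap c d. \<forall>u v.
        let \<tau> = transition c d; D\<tau> = (\<lambda>y. frechet_derivative \<tau> (at y)) in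
        frechet_derivative (\<lambda>y. D\<tau> y v) (at x) u + \<Gamma> d (\<tau> x) (D\<tau> x u) (D\<tau> x v)
          = D\<tau> x (\<Gamma> c x u v))"

definition torsion_free ::
  "('m, 'e::euclidean_space) chart set \<Rightarrow> ('m, 'e) conn \<Rightarrow> bool" where
  "torsion_free A \<Gamma> \<longleftrightarrow>
     (\<forall>c\<in>A. \<forall>X Y. smooth_on (cimg c) X \<and> smooth_on (cimg c) Y \<longrightarrow>
        (\<forall>x\<in>cimg c. cov \<Gamma> c X Y x - cov \<Gamma> c Y X x = lie_bracket X Y x))"

definition metric_compatible ::
  "('m, 'e::euclidean_space) chart set \<Rightarrow> ('m, 'e) bform \<Rightarrow> ('m, 'e) conn \<Rightarrow> bool" where
  "metric_compatible A g \<Gamma> \<longleftrightarrow>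
     (\<forall>c\<in>A. \<forall>X Y Z. smooth_on (cimg c) X \<and> smooth_on (cimg c) Y \<and> smooth_on (cimg c) Z \<longrightarrow>
        (\<forall>x\<in>cimg c. frechet_derivative (\<lambda>y. g c y (Y y) (Z y)) (at x) (X x)
           = g c x (cov \<Gamma> c X Y x) (Z x) + g c x (Y x) (cov \<Gamma> c X Z x)))"

definition levi_civita ::
  "('m, 'e::euclidean_space) chart set \<Rightarrow> ('m, 'e) bform \<Rightarrow> ('m, 'e) conn \<Rightarrow> bool" where
  "levi_civita A g \<Gamma> \<longleftrightarrow> connection A \<Gamma> \<and> torsion_free A \<Gamma> \<and> metric_compatible A g \<Gamma>"

section \<open>Sectional curvature\<close>

definition curvature_op ::
  "('m, 'e::euclidean_space) conn \<Rightarrow> ('m, 'e) chart \<Rightarrow>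
    ('e \<Rightarrow> 'e) \<Rightarrow> ('e \<Rightarrow> 'e) \<Rightarrow> ('e \<Rightarrow> 'e) \<Rightarrow> 'e \<Rightarrow> 'e" where
  "curvature_op \<Gamma> c X Y Z x =
     cov \<Gamma> c X (cov \<Gamma> c Y Z) x - cov \<Gamma> c Y (cov \<Gamma> c X Z) x - cov \<Gamma> c (lie_bracket X Y) Z x"

text \<open>On vectors, the tensor is evaluated on their constant extensions in the chart.\<close>

definition curvature ::
  "('m, 'e::euclidean_space) conn \<Rightarrow> ('m, 'e) chart \<Rightarrow> 'e \<Rightarrow> 'e \<Rightarrow> 'e \<Rightarrow> 'e \<Rightarrow> 'e" where
  "curvature \<Gamma> c x u v w = curvature_op \<Gamma> c (\<lambda>_. u) (\<lambda>_. v) (\<lambda>_. w) x"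

definition area_form :: "('e \<Rightarrow> 'e \<Rightarrow> real) \<Rightarrow> 'e \<Rightarrow> 'e \<Rightarrow> real" where
  "area_form b u v = b u u * b v v - (b u v)\<^sup>2"

definition sectional_curvature ::
  "('m, 'e::euclidean_space) bform \<Rightarrow> ('m, 'e) conn \<Rightarrow> ('m, 'e) chart \<Rightarrow> 'e \<Rightarrow> 'e \<Rightarrow> 'e \<Rightarrow> real" where
  "sectional_curvature g \<Gamma> c x u v =
     g c x (curvature \<Gamma> c x u v v) u / area_form (g c x) u v"

text \<open>
  Two vectors span a nondegenerate tangent plane iff \<open>area_form\<close> does not vanish on them.
\<close>

definition constant_sectional_curvature ::
  "('m, 'e::euclidean_space) chart set \<Rightarrow> ('m, 'e) bform \<Rightarrow> ('m, 'e) conn \<Rightarrow> real \<Rightarrow> bool" where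
  "constant_sectional_curvature A g \<Gamma> K \<longleftrightarrow>
     (\<forall>c\<in>A. \<forall>x\<in>cimg c. \<forall>u v. area_form (g c x) u v \<noteq> 0 \<longrightarrow> sectional_curvature g \<Gamma> c x u v = K)"

section \<open>Geodesics and completeness\<close>

definition velocity :: "('m, 'e::euclidean_space) chart \<Rightarrow> (real \<Rightarrow> 'm) \<Rightarrow> real \<Rightarrow> 'e" where
  "velocity c \<gamma> t = vector_derivative (cmap c \<circ> \<gamma>) (at t)"

text \<open>
  Curves are total functions restricted to an open interval \<open>I\<close>. It suffices to ask for two
  derivatives: the geodesic equation has smooth coefficients, so its solutions are smooth.
\<close>

definition geodesic ::
  "('m::topological_space, 'e::euclidean_space) chart set \<Rightarrow> ('m, 'e) conn \<Rightarrow>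
    real set \<Rightarrow> (real \<Rightarrow> 'm) \<Rightarrow> bool" where
  "geodesic A \<Gamma> I \<gamma> \<longleftrightarrow>
     open I \<and> is_interval I \<and> I \<noteq> {} \<and> continuous_on I \<gamma> \<and>
     (\<forall>c\<in>A. \<forall>t\<in>I. \<gamma> t \<in> cdom c \<longrightarrow>
        (cmap c \<circ> \<gamma>) differentiable (at t) \<and> velocity c \<gamma> differentiable (at t) \<and>
        vector_derivative (velocity c \<gamma>) (at t)
          + \<Gamma> c (cmap c (\<gamma> t)) (velocity c \<gamma> t) (velocity c \<gamma> t) = 0)"

definition timelike_geodesic ::
  "('m::topological_space, 'e::euclidean_space) chart set \<Rightarrow> ('m, 'e) bform \<Rightarrow> ('m, 'e) conn \<Rightarrow>
    real set \<Rightarrow> (real \<Rightarrow> 'm) \<Rightarrow> bool" where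
  "timelike_geodesic A g \<Gamma> I \<gamma> \<longleftrightarrow> geodesic A \<Gamma> I \<gamma> \<and>
     (\<forall>c\<in>A. \<forall>t\<in>I. \<gamma> t \<in> cdom c \<longrightarrow>
        g c (cmap c (\<gamma> t)) (velocity c \<gamma> t) (velocity c \<gamma> t) < 0)"

definition maximal_geodesic ::
  "('m::topological_space, 'e::euclidean_space) chart set \<Rightarrow> ('m, 'e) conn \<Rightarrow>
    real set \<Rightarrow> (real \<Rightarrow> 'm) \<Rightarrow> bool" where
  "maximal_geodesic A \<Gamma> I \<gamma> \<longleftrightarrow> geodesic A \<Gamma> I \<gamma> \<and>
     (\<forall>J \<delta>. geodesic A \<Gamma> J \<delta> \<and> I \<subseteq> J \<and> (\<forall>t\<in>I. \<delta> t = \<gamma> t) \<longrightarrow> J = I)"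

definition timelike_geodesically_complete ::
  "('m::topological_space, 'e::euclidean_space) chart set \<Rightarrow> ('m, 'e) bform \<Rightarrow> ('m, 'e) conn \<Rightarrow> bool"
  where
  "timelike_geodesically_complete A g \<Gamma> \<longleftrightarrow>
     (\<forall>I \<gamma>. timelike_geodesic A g \<Gamma> I \<gamma> \<and> maximal_geodesic A \<Gamma> I \<gamma> \<longrightarrow> I = UNIV)"

definition geodesic_field ::
  "('m, 'e::euclidean_space) chart set \<Rightarrow> ('m, 'e) conn \<Rightarrow> ('m, 'e) vfield \<Rightarrow> bool" where
  "geodesic_field A \<Gamma> X \<longleftrightarrow> (\<forall>c\<in>A. \<forall>x\<in>cimg c. cov \<Gamma> c (X c) (X c) x = 0)"

section \<open>Codimension-one foliations\<close>

text \<open>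
  A foliation is a family \<open>F\<close> of charts of the smooth structure that covers the manifold, whose
  images are products of connected sets, and whose transition maps are locally of the form
  \<open>(x, y) \<mapsto> (h\<^sub>1 (x, y), h\<^sub>2 y)\<close>. Connectedness of the factors makes the plaques connected.
\<close>

definition foliation ::
  "('m::topological_space, 'v::euclidean_space \<times> real) chart set \<Rightarrow>
    ('m, 'v \<times> real) chart set \<Rightarrow> bool" where
  "foliation A F \<longleftrightarrow> F \<subseteq> A \<and> (\<Union>c\<in>F. cdom c) = UNIV \<and>
     (\<forall>c\<in>F. \<exists>P Q. connected P \<and> connected Q \<and> cimg c = P \<times> Q) \<and>
     (\<forall>c\<in>F. \<forall>d\<in>F. \<forall>p\<in>cdom c \<inter> cdom d.
        \<exists>W. open W \<and> p \<in> W \<and> W \<subseteq> cdom c \<inter> cdom d \<and>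
          (\<forall>q\<in>W. \<forall>r\<in>W. snd (cmap c q) = snd (cmap c r) \<longrightarrow> snd (cmap d q) = snd (cmap d r)))"

definition same_plaque :: "('m, 'v \<times> real) chart set \<Rightarrow> 'm \<Rightarrow> 'm \<Rightarrow> bool" where
  "same_plaque F p q \<longleftrightarrow>
     (\<exists>c\<in>F. p \<in> cdom c \<and> q \<in> cdom c \<and> snd (cmap c p) = snd (cmap c q))"

definition leaf :: "('m, 'v \<times> real) chart set \<Rightarrow> 'm \<Rightarrow> 'm set" where
  "leaf F p = {q. (same_plaque F)\<^sup>*\<^sup>* p q}"

definition leaves :: "('m, 'v \<times> real) chart set \<Rightarrow> 'm set set" where
  "leaves F = range (leaf F)"

text \<open>In a chart of \<open>F\<close>, the vectors tangent to the leaves are the pairs \<open>(u, 0)\<close>.\<close>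

definition spacelike_foliation ::
  "('m::topological_space, 'v::euclidean_space \<times> real) chart set \<Rightarrow> ('m, 'v \<times> real) bform \<Rightarrow>
    ('m, 'v \<times> real) chart set \<Rightarrow> bool" where
  "spacelike_foliation A g F \<longleftrightarrow> foliation A F \<and>
     (\<forall>c\<in>F. \<forall>x\<in>cimg c. \<forall>u. u \<noteq> 0 \<longrightarrow> g c x (u, 0) (u, 0) > 0)"

definition unit_timelike_normal ::
  "('m, 'v::euclidean_space \<times> real) chart set \<Rightarrow> ('m, 'v \<times> real) bform \<Rightarrow>
    ('m, 'v \<times> real) chart set \<Rightarrow> ('m, 'v \<times> real) vfield \<Rightarrow> bool" where
  "unit_timelike_normal A g F N \<longleftrightarrow> smooth_vector_field A N \<and>
     (\<forall>c\<in>A. \<forall>x\<in>cimg c. g c x (N c x) (N c x) = -1) \<and>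
     (\<forall>c\<in>F. \<forall>x\<in>cimg c. \<forall>u. g c x (N c x) (u, 0) = 0)"

text \<open>
  The second fundamental form with respect to \<open>N\<close> is \<open>h(X, Y) = \<langle>A X, Y\<rangle>\<close> for the shape
  operator \<open>A X = - \<nabla>\<^sub>X N\<close>.
\<close>

definition second_fundamental_form ::
  "('m, 'e::euclidean_space) bform \<Rightarrow> ('m, 'e) conn \<Rightarrow> ('m, 'e) vfield \<Rightarrow> ('m, 'e) bform" where
  "second_fundamental_form g \<Gamma> N c x u v = - g c x (cov \<Gamma> c (\<lambda>_. u) (N c) x) v"

definition totally_umbilical ::
  "('m, 'v::euclidean_space \<times> real) bform \<Rightarrow> ('m, 'v \<times> real) conn \<Rightarrow>
    ('m, 'v \<times> real) chart set \<Rightarrow> ('m, 'v \<times> real) vfield \<Rightarrow> 'm set \<Rightarrow> bool" where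
  "totally_umbilical g \<Gamma> F N L \<longleftrightarrow>
     (\<forall>p\<in>L. \<exists>\<mu>. \<forall>c\<in>F. p \<in> cdom c \<longrightarrow>
        (\<forall>u v. second_fundamental_form g \<Gamma> N c (cmap c p) (u, 0) (v, 0)
          = \<mu> * g c (cmap c p) (u, 0) (v, 0)))"

end

theory Submission
  imports Defs
begin

text \<open>
Write \<open>K = \<nabla>N\<close>, the endomorphism \<open>u \<mapsto> \<nabla>\<^sub>u N\<close>; up to sign it is the shape operator of the leaves, and
a point is umbilical iff \<open>K = \<mu> \<pi>\<close> there, where \<open>\<pi>\<close> projects onto the tangent space of the leaf.

The first ingredient is infinitesimal. Since \<open>N\<close> is geodesic, \<open>K\<close> satisfies the Riccati equation
\<open>\<nabla>\<^sub>N K = - K\<^sup>2 - R(\<cdot>, N)N\<close>, and constant curvature turns the last term into \<open>\<kappa> \<pi>\<close> (\<open>riccati\<close>).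
If \<open>\<mu>' = \<kappa> - \<mu>\<^sup>2\<close>, then \<open>\<mu> \<pi>\<close> solves the same equation, so \<open>K - \<mu> \<pi>\<close> satisfies a linear homogeneous
equation along each integral curve of \<open>N\<close>. If it vanishes at one point of the curve it vanishes nearby, and
as umbilicity is a closed condition, it holds on the whole curve once it holds at a single point
(\<open>umbilic_propagates\<close>, \<open>not_umbilic_open\<close>, \<open>umbilic_flow\<close>).

The second ingredient is global. The integral curves of \<open>N\<close> are timelike geodesics, so timelike
completeness provides a flow of \<open>N\<close> for all times
(\<open>complete_field_of_geodesically_complete\<close>). The flow carries leaves to leaves: in a foliation chart the
one-form \<open>\<langle>N, \<cdot>\<rangle>\<close> is closed and annihilates the leaves, so the transversal component of \<open>N\<close> depends on
the transversal coordinate alone, and there is a function \<open>\<tau>\<close> of that coordinate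
which grows at unit speed along the flow and whose level sets are, locally, the plaques (\<open>unit_speed_function\<close>).
Hence short flows preserve plaques, long flows do so by composition, and connectedness of plaques
transports this to leaves (\<open>preserves_plaques\<close>, \<open>flow_leaf\<close>).

Together: the set of points whose leaf is totally umbilical is a union of leaves and invariant under
the flow. Every point near \<open>p\<close> flows into the plaque of \<open>p\<close> (\<open>nearby_points_flow_into_plaque\<close>), so this
set and its complement are open, and by connectedness it is everything as soon as it contains one leaf.

Umbilicity is propagated leaf by leaf along curves that start far from each other on a possibly
noncompact leaf, with no uniform bound on chart sizes; this is why a flow for all times is needed.
\<close>

section \<open>Calculus in normed spaces\<close>

lemma linear_norm_bound:
  fixes T :: "'a::euclidean_space \<Rightarrow> 'b::real_normed_vector"
  assumes "linear T" shows "norm (T z) \<le> (\<Sum>b\<in>Basis. norm (T b)) * norm z"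
proof -
  have "T z = T (\<Sum>b\<in>Basis. (z \<bullet> b) *\<^sub>R b)" by (simp add: euclidean_representation)
  also have "\<dots> = (\<Sum>b\<in>Basis. (z \<bullet> b) *\<^sub>R T b)" by (simp add: linear_sum[OF assms] linear_scale[OF assms])
  also have "norm \<dots> \<le> (\<Sum>b\<in>Basis. norm (T b) * norm z)"
    by (rule sum_norm_le) (metis Basis_le_norm mult.commute mult_right_mono norm_ge_zero norm_scaleR real_norm_def)
  finally show ?thesis by (simp add: sum_distrib_right)
qed

lemma onorm_scaleR_le: "norm w \<le> B \<Longrightarrow> onorm (\<lambda>h. h *\<^sub>R w) \<le> B"
  by (rule onorm_le) (metis mult.commute abs_ge_zero mult_left_mono norm_scaleR real_norm_def)

text \<open>
A substitute for Gronwall's inequality on short intervals: at the point where \<open>norm y\<close> is largest the mean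
value inequality bounds \<open>y\<close> by \<open>norm (y s)\<close> plus half of that maximum. It serves uniqueness of integral
curves, their Lipschitz dependence on the initial point, and the vanishing of linear systems.
\<close>

lemma short_time_bound:
  fixes y :: "real \<Rightarrow> 'a::real_normed_vector"
  assumes der: "\<And>t. t \<in> {a..b} \<Longrightarrow> (y has_vector_derivative y' t) (at t within {a..b})"
    and bound: "\<And>t. t \<in> {a..b} \<Longrightarrow> norm (y' t) \<le> L * norm (y t)"
    and L: "0 \<le> L" "L * (b - a) \<le> 1/2"
    and s: "s \<in> {a..b}" and t: "t \<in> {a..b}"
  shows "norm (y t) \<le> 2 * norm (y s)"
proof -
  have "continuous_on {a..b} y"
    using der by (meson continuous_on_eq_continuous_within has_vector_derivative_continuous)
  then obtain m where m: "m \<in> {a..b}" "\<And>t. t \<in> {a..b} \<Longrightarrow> norm (y t) \<le> norm (y m)"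
    using continuous_attains_sup[of "{a..b}" "\<lambda>t. norm (y t)"] s
    by (metis compact_Icc continuous_on_norm empty_iff)
  have "norm (y m - y s) \<le> (L * norm (y m)) * norm (m - s)"
  proof (rule differentiable_bound[of "{a..b}" y "\<lambda>t h. h *\<^sub>R y' t"])
    fix t assume t: "t \<in> {a..b}"
    show "(y has_derivative (\<lambda>h. h *\<^sub>R y' t)) (at t within {a..b})"
      using der[OF t] by (simp add: has_vector_derivative_def)
    have "norm (y' t) \<le> L * norm (y m)"
      using bound[OF t] m(2)[OF t] L(1) by (meson mult_left_mono order_trans)
    then show "onorm (\<lambda>h. h *\<^sub>R y' t) \<le> L * norm (y m)"
      by (rule onorm_scaleR_le)
  qed (use m s in auto)
  also have "\<dots> \<le> (L * norm (y m)) * (b - a)"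
    using m(1) s L(1) by (intro mult_left_mono) auto
  also have "\<dots> = (L * (b - a)) * norm (y m)" by simp
  also have "\<dots> \<le> (1/2) * norm (y m)"
    by (rule mult_right_mono[OF L(2)]) simp
  finally have "norm (y m) \<le> 2 * norm (y s)"
    using norm_triangle_sub[of "y m" "y s"] by simp
  with m(2)[OF t] show ?thesis by simp
qed

text \<open>
The sum of the squared norms satisfies a scalar inequality to which \<open>short_time_bound\<close> applies.
\<close>

lemma linear_system_vanishes:
  fixes d :: "'i \<Rightarrow> real \<Rightarrow> 'a::real_inner"
  assumes "finite I" "\<epsilon> > 0" "C \<ge> 0"
    and der: "\<And>i t. i \<in> I \<Longrightarrow> \<bar>t - s\<bar> < \<epsilon> \<Longrightarrow> (d i has_vector_derivative d' i t) (at t)"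
    and bound: "\<And>i t. i \<in> I \<Longrightarrow> \<bar>t - s\<bar> < \<epsilon> \<Longrightarrow> norm (d' i t) \<le> C * (\<Sum>j\<in>I. norm (d j t))"
    and zero: "\<And>i. i \<in> I \<Longrightarrow> d i s = 0"
  shows "\<exists>\<delta>>0. \<forall>t. \<bar>t - s\<bar> < \<delta> \<longrightarrow> (\<forall>i\<in>I. d i t = 0)"
proof -
  define f where "f t = (\<Sum>i\<in>I. d i t \<bullet> d i t)" for t
  define f' where "f' t = (\<Sum>i\<in>I. 2 * (d i t \<bullet> d' i t))" for t
  define L where "L = 2 * C * real (card I)"
  have L: "L \<ge> 0" using assms by (simp add: L_def)
  have f_nonneg: "f t \<ge> 0" for t unfolding f_def by (intro sum_nonneg) simp
  have derf: "(f has_vector_derivative f' t) (at t)" if "\<bar>t - s\<bar> < \<epsilon>" for t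
  proof -
    have *: "((\<lambda>t. d i t \<bullet> d i t) has_vector_derivative 2 * (d i t \<bullet> d' i t)) (at t)" if "i \<in> I" for i
      using has_derivative_inner[OF der[OF that \<open>\<bar>t - s\<bar> < \<epsilon>\<close>, unfolded has_vector_derivative_def]
          der[OF that \<open>\<bar>t - s\<bar> < \<epsilon>\<close>, unfolded has_vector_derivative_def]]
      unfolding has_vector_derivative_def
      by (rule has_derivative_eq_rhs) (auto simp: fun_eq_iff inner_commute)
    show ?thesis unfolding f_def f'_def
      by (rule has_vector_derivative_sum) (rule *)
  qed
  have boundf: "norm (f' t) \<le> L * norm (f t)" if "\<bar>t - s\<bar> < \<epsilon>" for t
  proof -
    let ?S = "\<Sum>j\<in>I. norm (d j t)"
    have "norm (f' t) \<le> (\<Sum>i\<in>I. 2 * (norm (d i t) * (C * ?S)))"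
      unfolding f'_def
    proof (rule sum_norm_le)
      fix i assume i: "i \<in> I"
      have "norm (2 * (d i t \<bullet> d' i t)) \<le> 2 * (norm (d i t) * norm (d' i t))"
        using Cauchy_Schwarz_ineq2[of "d i t" "d' i t"] by simp
      also have "\<dots> \<le> 2 * (norm (d i t) * (C * ?S))"
        using bound[OF i that] by (simp add: mult_left_mono)
      finally show "norm (2 * (d i t \<bullet> d' i t)) \<le> 2 * (norm (d i t) * (C * ?S))" .
    qed
    also have "\<dots> = 2 * C * ?S\<^sup>2"
      by (simp add: sum_distrib_left[symmetric] sum_distrib_right[symmetric] power2_eq_square)
    also have "2 * C * ?S\<^sup>2 \<le> 2 * C * ((\<Sum>j\<in>I. (norm (d j t))\<^sup>2) * card I)"
      using \<open>C \<ge> 0\<close> by (intro mult_left_mono sum_squared_le_sum_of_squares) auto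
    also have "\<dots> = L * f t"
      by (simp add: L_def f_def power2_norm_eq_inner)
    finally show ?thesis using f_nonneg by simp
  qed
  \<comment> \<open>chosen so that the interval of length \<open>2 * \<delta>\<close> is short compared with \<open>1 / L\<close>\<close>
  define \<delta> where "\<delta> = min (\<epsilon>/2) (1 / (4 * (L + 1)))"
  have "\<delta> > 0" "\<delta> < \<epsilon>" using L \<open>\<epsilon> > 0\<close> by (auto simp: \<delta>_def)
  have "L * (2 * \<delta>) \<le> L * (2 * (1 / (4 * (L + 1))))"
    using L by (intro mult_left_mono) (auto simp: \<delta>_def)
  also have "\<dots> \<le> 1/2" using L by (simp add: field_simps)
  finally have L\<delta>: "L * ((s + \<delta>) - (s - \<delta>)) \<le> 1/2" by simp
  have "\<forall>i\<in>I. d i t = 0" if t: "\<bar>t - s\<bar> < \<delta>" for t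
  proof -
    have "norm (f t) \<le> 2 * norm (f s)"
    proof (rule short_time_bound[where y = f and s = s and t = t and a = "s - \<delta>" and b = "s + \<delta>" and L = L and y' = f'])
      fix r assume "r \<in> {s - \<delta>..s + \<delta>}"
      then have r: "\<bar>r - s\<bar> < \<epsilon>" using \<open>\<delta> < \<epsilon>\<close> by auto
      show "(f has_vector_derivative f' r) (at r within {s - \<delta>..s + \<delta>})"
        by (rule has_vector_derivative_at_within[OF derf[OF r]])
      show "norm (f' r) \<le> L * norm (f r)" by (rule boundf[OF r])
    qed (use L L\<delta> t \<open>\<delta> > 0\<close> in auto)
    moreover have "f s = 0" unfolding f_def using zero by simp
    ultimately have "f t = 0" by simp
    then show ?thesis unfolding f_def using \<open>finite I\<close> by (simp add: sum_nonneg_eq_0_iff)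
  qed
  with \<open>\<delta> > 0\<close> show ?thesis by blast
qed

text \<open>
The product rule for a family of linear maps applied to a moving vector. Differentiability of
the family is only asked for on fixed vectors, which is the form in which metrics, connection
coefficients and derivatives of transition maps are given; expanding in a basis reduces to scalar products.
\<close>

lemma has_derivative_apply_linear:
  fixes B :: "'a::real_normed_vector \<Rightarrow> 'b::euclidean_space \<Rightarrow> 'c::real_normed_vector"
  assumes "open S" "x \<in> S"
    and lin: "\<And>y. y \<in> S \<Longrightarrow> linear (B y)"
    and diff: "\<And>b. (\<lambda>y. B y b) differentiable (at x)"
    and Y: "(Y has_derivative Y') (at x)"
  shows "((\<lambda>y. B y (Y y)) has_derivative
          (\<lambda>h. frechet_derivative (\<lambda>y. B y (Y x)) (at x) h + B x (Y' h))) (at x)"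
proof -
  define D where "D b = frechet_derivative (\<lambda>y. B y b) (at x)" for b
  have D: "((\<lambda>y. B y b) has_derivative D b) (at x)" for b
    using diff frechet_derivative_works unfolding D_def by blast
  have exp: "B y w = (\<Sum>b\<in>Basis. (w \<bullet> b) *\<^sub>R B y b)" if "y \<in> S" for y w
  proof -
    have "B y w = B y (\<Sum>b\<in>Basis. (w \<bullet> b) *\<^sub>R b)" by (simp add: euclidean_representation)
    also have "\<dots> = (\<Sum>b\<in>Basis. (w \<bullet> b) *\<^sub>R B y b)"
      using lin[OF that] by (simp add: linear_sum linear_scale)
    finally show ?thesis .
  qed
  have 1: "((\<lambda>y. \<Sum>b\<in>Basis. (Y y \<bullet> b) *\<^sub>R B y b) has_derivative
      (\<lambda>h. \<Sum>b\<in>Basis. (Y x \<bullet> b) *\<^sub>R D b h + (Y' h \<bullet> b) *\<^sub>R B x b)) (at x)"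
    by (intro has_derivative_sum has_derivative_scaleR has_derivative_inner_left Y D)
  have 2: "((\<lambda>y. \<Sum>b\<in>Basis. (Y x \<bullet> b) *\<^sub>R B y b) has_derivative
      (\<lambda>h. \<Sum>b\<in>Basis. (Y x \<bullet> b) *\<^sub>R D b h)) (at x)"
    by (intro has_derivative_sum has_derivative_scaleR_right D)
  have 3: "D (Y x) h = (\<Sum>b\<in>Basis. (Y x \<bullet> b) *\<^sub>R D b h)" for h
  proof -
    have "((\<lambda>y. B y (Y x)) has_derivative (\<lambda>h. \<Sum>b\<in>Basis. (Y x \<bullet> b) *\<^sub>R D b h)) (at x)"
      by (rule has_derivative_transform_within_open[OF 2 assms(1,2)]) (rule exp[symmetric])
    then show ?thesis unfolding D_def by (metis frechet_derivative_at)
  qed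
  have "((\<lambda>y. B y (Y y)) has_derivative
      (\<lambda>h. \<Sum>b\<in>Basis. (Y x \<bullet> b) *\<^sub>R D b h + (Y' h \<bullet> b) *\<^sub>R B x b)) (at x)"
    by (rule has_derivative_transform_within_open[OF 1 assms(1,2)]) (rule exp[symmetric])
  then show ?thesis
    by (rule has_derivative_eq_rhs)
      (simp add: fun_eq_iff D_def[symmetric] 3 sum.distrib exp[OF \<open>x \<in> S\<close>, of "Y' _"])
qed

lemma frechet_derivative_linear_parameter:
  assumes "open S" "x \<in> S" and lin: "\<And>y. y \<in> S \<Longrightarrow> linear (B y)"
    and diff: "\<And>b. (\<lambda>y. B y b) differentiable (at x)"
  shows "linear (\<lambda>u. frechet_derivative (\<lambda>y. B y u) (at x) h)"
proof (rule linearI)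
  have D: "((\<lambda>y. B y b) has_derivative frechet_derivative (\<lambda>y. B y b) (at x)) (at x)" for b
    using diff frechet_derivative_works by blast
  fix u v c
  have "((\<lambda>y. B y (u + v)) has_derivative
      (\<lambda>h. frechet_derivative (\<lambda>y. B y u) (at x) h + frechet_derivative (\<lambda>y. B y v) (at x) h)) (at x)"
    by (rule has_derivative_transform_within_open[OF has_derivative_add[OF D D] assms(1,2)])
      (simp add: lin linear_add)
  then show "frechet_derivative (\<lambda>y. B y (u + v)) (at x) h
     = frechet_derivative (\<lambda>y. B y u) (at x) h + frechet_derivative (\<lambda>y. B y v) (at x) h"
    by (metis frechet_derivative_at)
  have "((\<lambda>y. B y (c *\<^sub>R u)) has_derivative (\<lambda>h. c *\<^sub>R frechet_derivative (\<lambda>y. B y u) (at x) h)) (at x)"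
    by (rule has_derivative_transform_within_open[OF has_derivative_scaleR_right[OF D] assms(1,2)])
      (simp add: lin linear_scale)
  then show "frechet_derivative (\<lambda>y. B y (c *\<^sub>R u)) (at x) h = c *\<^sub>R frechet_derivative (\<lambda>y. B y u) (at x) h"
    by (metis frechet_derivative_at)
qed

lemma has_derivative_locally_const:
  assumes "(f has_derivative f') (at x)" "open S" "x \<in> S" "\<And>y. y \<in> S \<Longrightarrow> f y = c"
  shows "f' h = 0"
proof -
  have "((\<lambda>_. c) has_derivative f') (at x)"
    by (rule has_derivative_transform_within_open[OF assms(1-3)]) (simp add: assms(4))
  with has_derivative_unique[OF this has_derivative_const] show ?thesis by simp
qed

lemma frechet_derivative_const_zero [simp]: "frechet_derivative (\<lambda>_. c) (at x) h = 0"
  by (metis frechet_derivative_at has_derivative_const)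

subsection \<open>Smooth functions\<close>

lemma smooth_on_differentiable: "smooth_on S f \<Longrightarrow> x \<in> S \<Longrightarrow> f differentiable (at x)"
  unfolding smooth_on_def using Ck_on.simps(2)[of 0 S f] by blast

lemma smooth_on_continuous: "smooth_on S f \<Longrightarrow> continuous_on S f"
  unfolding smooth_on_def using Ck_on.simps(1)[of S f] by blast

lemma smooth_on_frechet_derivative:
  "smooth_on S f \<Longrightarrow> smooth_on S (\<lambda>x. frechet_derivative f (at x) v)"
  unfolding smooth_on_def by (metis Ck_on.simps(2))

lemma smooth_on_has_derivative:
  "smooth_on S f \<Longrightarrow> x \<in> S \<Longrightarrow> (f has_derivative frechet_derivative f (at x)) (at x)"
  using smooth_on_differentiable frechet_derivative_works by blast

lemma smooth_on_const [simp]: "smooth_on S (\<lambda>x. a)"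
proof -
  have "Ck_on k S (\<lambda>x. a)" for k and a :: 'b
    by (induction k arbitrary: a) auto
  then show ?thesis by (simp add: smooth_on_def)
qed

text \<open>
The mean value theorem, used once in each direction, evaluates the second difference of a component
of \<open>f\<close>. The left hand side is symmetric in \<open>u\<close> and \<open>v\<close>, whence the symmetry of second derivatives.
\<close>

lemma second_difference_mean_value:
  fixes f :: "'a::real_normed_vector \<Rightarrow> 'b::euclidean_space"
  assumes f: "smooth_on S f" and "t > 0"
    and S: "\<And>r s. r \<in> {0..t} \<Longrightarrow> s \<in> {0..t} \<Longrightarrow> x + r *\<^sub>R u + s *\<^sub>R v \<in> S"
  shows "\<exists>r\<in>{0..t}. \<exists>s\<in>{0..t}.
     (f (x + t *\<^sub>R u + t *\<^sub>R v) - f (x + t *\<^sub>R u) - f (x + t *\<^sub>R v) + f x) \<bullet> b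
      = t\<^sup>2 * (frechet_derivative (\<lambda>y. frechet_derivative f (at y) u) (at (x + r *\<^sub>R u + s *\<^sub>R v)) v \<bullet> b)"
proof -
  let ?D = "\<lambda>y. frechet_derivative f (at y)"
  let ?D2 = "\<lambda>y. frechet_derivative (\<lambda>y. ?D y u) (at y)"
  have der: "((\<lambda>r. f (x + r *\<^sub>R u + w) \<bullet> b) has_derivative (\<lambda>h. h * (?D (x + r *\<^sub>R u + w) u \<bullet> b))) (at r)"
    if "x + r *\<^sub>R u + w \<in> S" for r w
  proof -
    have D: "(f has_derivative ?D (x + r *\<^sub>R u + w)) (at (x + r *\<^sub>R u + w))"
      by (rule smooth_on_has_derivative[OF f that])
    have "((\<lambda>r. x + r *\<^sub>R u + w) has_derivative (\<lambda>h. h *\<^sub>R u)) (at r)"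
      by (auto intro!: derivative_eq_intros)
    from has_derivative_compose[OF this D]
    have "((\<lambda>r. f (x + r *\<^sub>R u + w)) has_derivative (\<lambda>h. ?D (x + r *\<^sub>R u + w) (h *\<^sub>R u))) (at r)" .
    from has_derivative_inner_left[OF this, of b] show ?thesis
      by (rule has_derivative_eq_rhs)
        (auto simp: fun_eq_iff linear_scale[OF has_derivative_linear[OF D]])
  qed
  define \<phi> where "\<phi> r = f (x + r *\<^sub>R u + t *\<^sub>R v) \<bullet> b - f (x + r *\<^sub>R u) \<bullet> b" for r
  define \<phi>' where "\<phi>' r = ?D (x + r *\<^sub>R u + t *\<^sub>R v) u \<bullet> b - ?D (x + r *\<^sub>R u) u \<bullet> b" for r
  have "(\<phi> has_derivative (\<lambda>h. h * \<phi>' r)) (at r)" if "0 \<le> r" "r \<le> t" for r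
  proof -
    have "x + r *\<^sub>R u + t *\<^sub>R v \<in> S" "x + r *\<^sub>R u + 0 \<in> S"
      using S[of r t] S[of r 0] that \<open>t > 0\<close> by auto
    from has_derivative_diff[OF der[OF this(1)] der[OF this(2)]] show ?thesis
      unfolding \<phi>_def \<phi>'_def by (simp add: algebra_simps)
  qed
  from mvt_simple[OF \<open>t > 0\<close> has_derivative_at_withinI[OF this]]
  obtain r where r: "r \<in> {0<..<t}" "\<phi> t - \<phi> 0 = t * \<phi>' r" by auto
  have der2: "((\<lambda>s. ?D (x + r *\<^sub>R u + s *\<^sub>R v) u \<bullet> b) has_derivative
      (\<lambda>h. h * (?D2 (x + r *\<^sub>R u + s *\<^sub>R v) v \<bullet> b))) (at s)" if "0 \<le> s" "s \<le> t" for s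
  proof -
    have inS: "x + r *\<^sub>R u + s *\<^sub>R v \<in> S" using S[of r s] r that by auto
    have D: "((\<lambda>y. ?D y u) has_derivative ?D2 (x + r *\<^sub>R u + s *\<^sub>R v)) (at (x + r *\<^sub>R u + s *\<^sub>R v))"
      by (rule smooth_on_has_derivative[OF smooth_on_frechet_derivative[OF f] inS])
    have "((\<lambda>s. x + r *\<^sub>R u + s *\<^sub>R v) has_derivative (\<lambda>h. h *\<^sub>R v)) (at s)"
      by (auto intro!: derivative_eq_intros)
    from has_derivative_compose[OF this D]
    have "((\<lambda>s. ?D (x + r *\<^sub>R u + s *\<^sub>R v) u) has_derivative
       (\<lambda>h. ?D2 (x + r *\<^sub>R u + s *\<^sub>R v) (h *\<^sub>R v))) (at s)" .
    from has_derivative_inner_left[OF this, of b] show ?thesis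
      by (rule has_derivative_eq_rhs)
        (auto simp: fun_eq_iff linear_scale[OF has_derivative_linear[OF D]])
  qed
  from mvt_simple[OF \<open>t > 0\<close> has_derivative_at_withinI[OF this]]
  obtain s where s: "s \<in> {0<..<t}"
     "?D (x + r *\<^sub>R u + t *\<^sub>R v) u \<bullet> b - ?D (x + r *\<^sub>R u + 0 *\<^sub>R v) u \<bullet> b
        = t * (?D2 (x + r *\<^sub>R u + s *\<^sub>R v) v \<bullet> b)" by auto
  have "(f (x + t *\<^sub>R u + t *\<^sub>R v) - f (x + t *\<^sub>R u) - f (x + t *\<^sub>R v) + f x) \<bullet> b = \<phi> t - \<phi> 0"
    by (simp add: \<phi>_def inner_diff_left inner_add_left)
  also have "\<dots> = t\<^sup>2 * (?D2 (x + r *\<^sub>R u + s *\<^sub>R v) v \<bullet> b)"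
    using r s by (simp add: \<phi>'_def power2_eq_square)
  finally show ?thesis using r s by (meson atLeastAtMost_iff greaterThanLessThan_iff less_imp_le)
qed

lemma second_derivative_symmetric:
  fixes f :: "'a::real_normed_vector \<Rightarrow> 'b::euclidean_space"
  assumes f: "smooth_on S f" and "open S" "x \<in> S"
  shows "frechet_derivative (\<lambda>y. frechet_derivative f (at y) u) (at x) v
       = frechet_derivative (\<lambda>y. frechet_derivative f (at y) v) (at x) u"
proof (rule euclidean_eqI)
  fix b :: 'b assume "b \<in> Basis"
  define D2 where "D2 u v y = frechet_derivative (\<lambda>y. frechet_derivative f (at y) u) (at y) v \<bullet> b" for u v y
  have cont: "isCont (D2 u v) x" for u v
    unfolding D2_def
    using smooth_on_continuous[OF smooth_on_frechet_derivative[OF smooth_on_frechet_derivative[OF f]]]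
      assms(2,3) by (intro continuous_intros) (simp add: continuous_on_eq_continuous_at)
  have "dist (D2 u v x) (D2 v u x) \<le> e" if "e > 0" for e
  proof -
    have ev: "eventually (\<lambda>y. dist (D2 u v y) (D2 u v x) < e/2 \<and> dist (D2 v u y) (D2 v u x) < e/2 \<and> y \<in> S) (nhds x)"
      using cont[of u v] cont[of v u] \<open>e > 0\<close> assms(2,3)
      by (intro eventually_conj tendstoD eventually_nhds_in_open half_gt_zero)
        (auto simp: isCont_def tendsto_at_iff_tendsto_nhds)
    then obtain \<rho> where \<rho>: "\<rho> > 0"
      "\<And>y. dist y x < \<rho> \<Longrightarrow> dist (D2 u v y) (D2 u v x) < e/2 \<and> dist (D2 v u y) (D2 v u x) < e/2 \<and> y \<in> S"
      unfolding eventually_nhds_metric by blast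
    define t where "t = \<rho> / (2 * (norm u + norm v + 1))"
    have pos: "norm u + norm v + 1 > 0" by (smt (verit) norm_ge_zero)
    have "t > 0" using \<rho> pos by (simp add: t_def)
    have near: "dist (x + r *\<^sub>R u + s *\<^sub>R v) x < \<rho>" "dist (x + r *\<^sub>R v + s *\<^sub>R u) x < \<rho>"
      if "r \<in> {0..t}" "s \<in> {0..t}" for r s
    proof -
      have *: "\<bar>r'\<bar> * norm w \<le> t * norm w" if "r' \<in> {0..t}" for r' and w :: 'a
        using that by (intro mult_right_mono) auto
      have "norm (r *\<^sub>R u + s *\<^sub>R v) \<le> t * norm u + t * norm v"
        using *[OF that(1), of u] *[OF that(2), of v] norm_triangle_ineq[of "r *\<^sub>R u" "s *\<^sub>R v"] by simp
      moreover have "norm (r *\<^sub>R v + s *\<^sub>R u) \<le> t * norm u + t * norm v"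
        using *[OF that(1), of v] *[OF that(2), of u] norm_triangle_ineq[of "r *\<^sub>R v" "s *\<^sub>R u"] by simp
      \<comment> \<open>this is what the denominator in the definition of \<open>t\<close> is for\<close>
      moreover have "t * norm u + t * norm v < \<rho>"
      proof -
        have "t * norm u + t * norm v \<le> t * (norm u + norm v + 1)"
          using \<open>t > 0\<close> by (simp add: algebra_simps)
        also have "\<dots> = \<rho>/2"
          unfolding t_def using pos by (metis less_irrefl mult.commute nonzero_mult_div_cancel_left times_divide_eq_left
            mult_divide_mult_cancel_left_if)
        finally show ?thesis using \<rho>(1) by simp
      qed
      ultimately show "dist (x + r *\<^sub>R u + s *\<^sub>R v) x < \<rho>" "dist (x + r *\<^sub>R v + s *\<^sub>R u) x < \<rho>"
        by (auto simp: dist_norm add.assoc)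
    qed
    obtain r s where 1: "r \<in> {0..t}" "s \<in> {0..t}"
      "(f (x + t *\<^sub>R u + t *\<^sub>R v) - f (x + t *\<^sub>R u) - f (x + t *\<^sub>R v) + f x) \<bullet> b
          = t\<^sup>2 * D2 u v (x + r *\<^sub>R u + s *\<^sub>R v)"
      using second_difference_mean_value[OF f \<open>t > 0\<close>, of x u v b] near \<rho>(2) unfolding D2_def by meson
    obtain r' s' where 2: "r' \<in> {0..t}" "s' \<in> {0..t}"
      "(f (x + t *\<^sub>R v + t *\<^sub>R u) - f (x + t *\<^sub>R v) - f (x + t *\<^sub>R u) + f x) \<bullet> b
          = t\<^sup>2 * D2 v u (x + r' *\<^sub>R v + s' *\<^sub>R u)"
      using second_difference_mean_value[OF f \<open>t > 0\<close>, of x v u b] near \<rho>(2) unfolding D2_def by meson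
    have "t\<^sup>2 * D2 u v (x + r *\<^sub>R u + s *\<^sub>R v) = t\<^sup>2 * D2 v u (x + r' *\<^sub>R v + s' *\<^sub>R u)"
      unfolding 1(3)[symmetric] 2(3)[symmetric] by (simp add: algebra_simps)
    then have "D2 u v (x + r *\<^sub>R u + s *\<^sub>R v) = D2 v u (x + r' *\<^sub>R v + s' *\<^sub>R u)"
      using \<open>t > 0\<close> by simp
    moreover have "dist (D2 u v (x + r *\<^sub>R u + s *\<^sub>R v)) (D2 u v x) < e/2"
      "dist (D2 v u (x + r' *\<^sub>R v + s' *\<^sub>R u)) (D2 v u x) < e/2"
      using \<rho>(2)[OF near(1)[OF 1(1,2)]] \<rho>(2)[OF near(2)[OF 2(1,2)]] by auto
    ultimately show ?thesis unfolding dist_real_def by linarith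
  qed
  then have "D2 u v x = D2 v u x" by (meson dist_le_zero_iff dense_ge)
  then show "frechet_derivative (\<lambda>y. frechet_derivative f (at y) u) (at x) v \<bullet> b
       = frechet_derivative (\<lambda>y. frechet_derivative f (at y) v) (at x) u \<bullet> b"
    by (simp add: D2_def)
qed

lemma smooth_on_lipschitz_cball:
  fixes f :: "'a::euclidean_space \<Rightarrow> 'b::euclidean_space"
  assumes f: "smooth_on S f" and "cball x r \<subseteq> S"
  shows "\<exists>L\<ge>0. \<forall>y\<in>cball x r. \<forall>z\<in>cball x r. norm (f y - f z) \<le> L * norm (y - z)"
proof -
  let ?D = "\<lambda>y. frechet_derivative f (at y)"
  have "continuous_on (cball x r) (\<lambda>y. \<Sum>b\<in>Basis. norm (?D y b))"
    using smooth_on_continuous[OF smooth_on_frechet_derivative[OF f]] assms(2)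
    by (intro continuous_intros) (meson continuous_on_subset)
  then have "bounded ((\<lambda>y. \<Sum>b\<in>Basis. norm (?D y b)) ` cball x r)"
    by (intro compact_imp_bounded compact_continuous_image) auto
  then obtain L where L: "\<And>y. y \<in> cball x r \<Longrightarrow> norm (\<Sum>b\<in>Basis. norm (?D y b)) \<le> L" "L > 0"
    unfolding bounded_pos by blast
  have "norm (f y - f z) \<le> L * norm (y - z)" if "y \<in> cball x r" "z \<in> cball x r" for y z
  proof (rule differentiable_bound[of "cball x r" f ?D])
    fix w assume w: "w \<in> cball x r"
    then have D: "(f has_derivative ?D w) (at w)"
      using smooth_on_has_derivative[OF f] assms(2) by blast
    then show "(f has_derivative ?D w) (at w within cball x r)"
      by (rule has_derivative_at_withinI)
    show "onorm (?D w) \<le> L"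
    proof (rule onorm_le)
      fix h
      have "norm (?D w h) \<le> (\<Sum>b\<in>Basis. norm (?D w b)) * norm h"
        by (rule linear_norm_bound[OF has_derivative_linear[OF D]])
      also have "\<dots> \<le> L * norm h"
        using L(1)[OF w] by (intro mult_right_mono) auto
      finally show "norm (?D w h) \<le> L * norm h" .
    qed
  qed (use that in auto)
  with L(2) show ?thesis by (meson less_imp_le)
qed

subsection \<open>Local solutions of autonomous equations\<close>

text \<open>
Picard's theorem for a globally Lipschitz right hand side. The integral operator acts on bounded
continuous functions on the whole line by clamping time to \<open>{-\<epsilon>..\<epsilon>}\<close>, so that the contraction principle
applies to a complete type.
\<close>

lemma integral_equation_solution:
  fixes F :: "'e::euclidean_space \<Rightarrow> 'e"
  assumes lip: "\<And>y z. norm (F y - F z) \<le> L * norm (y - z)"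
    and "0 \<le> L" "\<epsilon> > 0" "\<epsilon> * L \<le> 1/2"
  shows "\<exists>u. u 0 = q \<and> (\<forall>t\<in>{-\<epsilon>..\<epsilon>}. (u has_vector_derivative F (u t)) (at t within {-\<epsilon>..\<epsilon>}))"
proof -
  define c where "c t = max (-\<epsilon>) (min \<epsilon> t)" for t :: real
  have c: "c t \<in> {-\<epsilon>..\<epsilon>}" for t using \<open>\<epsilon> > 0\<close> by (auto simp: c_def)
  have c_id: "c t = t" if "t \<in> {-\<epsilon>..\<epsilon>}" for t using that by (auto simp: c_def)
  have contF: "continuous_on X F" for X
    using lip by (intro lipschitz_on_continuous_on[of L] lipschitz_onI) (auto simp: dist_norm \<open>0 \<le> L\<close>)
  define I where "I u t = q + integral {-\<epsilon>..t} (\<lambda>s. F (apply_bcontfun u s))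
      - integral {-\<epsilon>..0} (\<lambda>s. F (apply_bcontfun u s))" for u :: "real \<Rightarrow>\<^sub>C 'e" and t
  have I': "(I u has_vector_derivative F (u t)) (at t within {-\<epsilon>..\<epsilon>})" if "t \<in> {-\<epsilon>..\<epsilon>}" for u t
  proof -
    have "continuous_on {-\<epsilon>..\<epsilon>} (\<lambda>s. F (u s))"
      by (rule continuous_on_compose2[OF contF[of UNIV]]) auto
    from integral_has_vector_derivative[OF this that] show ?thesis
      unfolding I_def by (auto intro!: derivative_eq_intros)
  qed
  have contI: "continuous_on {-\<epsilon>..\<epsilon>} (I u)" for u
    using I' by (meson continuous_on_eq_continuous_within has_vector_derivative_continuous)
  have Pb: "(\<lambda>t. I u (c t)) \<in> bcontfun" for u
  proof -
    have "continuous_on UNIV (\<lambda>t. I u (c t))"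
      by (rule continuous_on_compose2[OF contI]) (use c in \<open>auto simp: c_def intro!: continuous_intros\<close>)
    moreover have "bounded (range (\<lambda>t. I u (c t)))"
      by (rule bounded_subset[OF compact_imp_bounded[OF compact_continuous_image[OF contI]]]) (use c in auto)
    ultimately show ?thesis by (simp add: bcontfun_def)
  qed
  define P where "P u = Bcontfun (\<lambda>t. I u (c t))" for u
  have P: "apply_bcontfun (P u) t = I u (c t)" for u t
    unfolding P_def using Bcontfun_inverse[OF Pb] by simp
  have I0: "I u 0 = q" for u by (simp add: I_def)
  have "dist (P u) (P v) \<le> 1/2 * dist u v" for u v
  proof (rule dist_bound)
    fix t
    define w where "w t = I u t - I v t" for t
    have "norm (w (c t) - w 0) \<le> (L * dist u v) * norm (c t - 0)"
    proof (rule differentiable_bound[of "{-\<epsilon>..\<epsilon>}" w "\<lambda>s h. h *\<^sub>R (F (u s) - F (v s))"])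
      fix s assume s: "s \<in> {-\<epsilon>..\<epsilon>}"
      show "(w has_derivative (\<lambda>h. h *\<^sub>R (F (u s) - F (v s)))) (at s within {-\<epsilon>..\<epsilon>})"
        using has_vector_derivative_diff[OF I'[OF s, of u] I'[OF s, of v]]
        unfolding w_def has_vector_derivative_def .
      have "norm (F (u s) - F (v s)) \<le> L * norm (u s - v s)" by (rule lip)
      also have "\<dots> \<le> L * dist u v"
        using dist_bounded[of u s v] \<open>0 \<le> L\<close> by (simp add: dist_norm mult_left_mono)
      finally have "norm (F (u s) - F (v s)) \<le> L * dist u v" .
      then show "onorm (\<lambda>h. h *\<^sub>R (F (u s) - F (v s))) \<le> L * dist u v"
        by (rule onorm_scaleR_le)
    qed (use c \<open>\<epsilon> > 0\<close> in auto)
    also have "\<dots> \<le> (L * dist u v) * \<epsilon>"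
      using c[of t] \<open>0 \<le> L\<close> by (intro mult_left_mono) auto
    also have "\<dots> = (\<epsilon> * L) * dist u v" by simp
    also have "\<dots> \<le> 1/2 * dist u v" using assms(4) by (intro mult_right_mono) auto
    finally show "dist (apply_bcontfun (P u) t) (apply_bcontfun (P v) t) \<le> 1/2 * dist u v"
      by (simp add: P w_def dist_norm I0)
  qed
  then obtain u where u: "P u = u"
    using banach_fix_type[of "1/2" P] by auto
  have eq: "apply_bcontfun u t = I u t" if "t \<in> {-\<epsilon>..\<epsilon>}" for t
    using P[of u t] u c_id[OF that] by simp
  show ?thesis
  proof (intro exI[of _ "apply_bcontfun u"] conjI ballI)
    show "apply_bcontfun u 0 = q" using eq[of 0] I0 \<open>\<epsilon> > 0\<close> by simp
    fix t assume t: "t \<in> {-\<epsilon>..\<epsilon>}"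
    show "(apply_bcontfun u has_vector_derivative F (apply_bcontfun u t)) (at t within {-\<epsilon>..\<epsilon>})"
      by (rule has_vector_derivative_transform[OF t _ I'[OF t]]) (use eq in auto)
  qed
qed

text \<open>
Composing with the nearest point projection onto the ball, which is 1-Lipschitz, makes the right hand side
globally Lipschitz; the speed bound then keeps the solution inside the ball, where nothing was changed.
All initial points in the half ball share one \<open>\<epsilon>\<close>.
\<close>

lemma picard_local:
  fixes f :: "'e::euclidean_space \<Rightarrow> 'e"
  assumes lip: "\<And>y z. y \<in> cball x r \<Longrightarrow> z \<in> cball x r \<Longrightarrow> norm (f y - f z) \<le> L * norm (y - z)"
    and bound: "\<And>y. y \<in> cball x r \<Longrightarrow> norm (f y) \<le> M"
    and "0 \<le> L" "0 < \<epsilon>" "\<epsilon> * L \<le> 1/2" "\<epsilon> * M \<le> r/2" "0 < r" "q \<in> cball x (r/2)"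
  shows "\<exists>u. u 0 = q \<and> (\<forall>t\<in>{-\<epsilon>..\<epsilon>}. u t \<in> cball x r \<and>
               (u has_vector_derivative f (u t)) (at t within {-\<epsilon>..\<epsilon>}))"
proof -
  define P where "P = closest_point (cball x r)"
  have P: "P y \<in> cball x r" for y
    unfolding P_def using \<open>0 < r\<close> by (intro closest_point_in_set) auto
  have "norm (f (P y) - f (P z)) \<le> L * norm (y - z)" for y z
  proof -
    have "norm (P y - P z) \<le> norm (y - z)"
      using closest_point_lipschitz[of "cball x r" y z] \<open>0 < r\<close> by (simp add: P_def dist_norm)
    then show ?thesis using lip[OF P P] \<open>0 \<le> L\<close> by (meson mult_left_mono order_trans)
  qed
  from integral_equation_solution[of "\<lambda>y. f (P y)", OF this \<open>0 \<le> L\<close> \<open>0 < \<epsilon>\<close> assms(5)]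
  obtain u where u0: "u 0 = q"
    and u: "\<And>t. t \<in> {-\<epsilon>..\<epsilon>} \<Longrightarrow> (u has_vector_derivative f (P (u t))) (at t within {-\<epsilon>..\<epsilon>})" by blast
  have in_ball: "u t \<in> cball x r" if t: "t \<in> {-\<epsilon>..\<epsilon>}" for t
  proof -
    have "norm (u t - u 0) \<le> M * norm (t - 0)"
    proof (rule differentiable_bound[of "{-\<epsilon>..\<epsilon>}" u "\<lambda>s h. h *\<^sub>R f (P (u s))"])
      fix s assume s: "s \<in> {-\<epsilon>..\<epsilon>}"
      show "(u has_derivative (\<lambda>h. h *\<^sub>R f (P (u s)))) (at s within {-\<epsilon>..\<epsilon>})"
        using u[OF s] by (simp add: has_vector_derivative_def)
      show "onorm (\<lambda>h. h *\<^sub>R f (P (u s))) \<le> M"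
        by (intro onorm_scaleR_le bound P)
    qed (use t \<open>0 < \<epsilon>\<close> in auto)
    also have "\<dots> \<le> M * \<epsilon>"
      using t order_trans[OF norm_ge_zero bound[OF P]] by (intro mult_left_mono) auto
    finally have "dist (u t) q \<le> r/2" using assms(6) u0 by (simp add: dist_norm mult.commute)
    moreover have "dist q x \<le> r/2" using assms(8) by (simp add: dist_commute)
    ultimately show ?thesis using dist_triangle[of "u t" x q] by (simp add: dist_commute)
  qed
  then have "P (u t) = u t" if "t \<in> {-\<epsilon>..\<epsilon>}" for t
    unfolding P_def using that by (intro closest_point_self) auto
  with u u0 in_ball show ?thesis by (intro exI[of _ u]) (metis (no_types, lifting))
qed

text \<open>
The factor \<open>\<mu>\<close> in \<open>K = \<mu> \<pi>\<close> evolves by this equation along \<open>N\<close>. Its solutions may blow up in finite time,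
so only a local solution is available, together with an explicit bound.
\<close>

lemma scalar_riccati_solution:
  fixes \<kappa> \<mu> :: real
  obtains u \<epsilon> where "\<epsilon> > 0" "u s = \<mu>"
    "\<And>t. \<bar>t - s\<bar> < \<epsilon> \<Longrightarrow> (u has_vector_derivative \<kappa> - (u t)\<^sup>2) (at t)"
    "\<And>t. \<bar>t - s\<bar> < \<epsilon> \<Longrightarrow> \<bar>u t\<bar> \<le> \<bar>\<mu>\<bar> + 1"
proof -
  define L where "L = 2 * (\<bar>\<mu>\<bar> + 1)"
  define M where "M = \<bar>\<kappa>\<bar> + (\<bar>\<mu>\<bar> + 1)\<^sup>2"
  define \<epsilon> where "\<epsilon> = min (1 / (2 * L)) (1 / (2 * M))"
  have "L > 0" by (simp add: L_def)
  have "(\<bar>\<mu>\<bar> + 1)\<^sup>2 > 0" by (rule zero_less_power) simp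
  then have "M > 0" by (simp add: M_def add_nonneg_pos)
  have \<epsilon>: "\<epsilon> > 0" "\<epsilon> \<le> 1 / (2 * L)" "\<epsilon> \<le> 1 / (2 * M)" using \<open>L > 0\<close> \<open>M > 0\<close> by (simp_all add: \<epsilon>_def)
  have ball: "\<bar>y\<bar> \<le> \<bar>\<mu>\<bar> + 1" if "y \<in> cball \<mu> 1" for y :: real
    using that by (auto simp: dist_real_def)
  have "\<exists>u. u 0 = \<mu> \<and> (\<forall>t\<in>{-\<epsilon>..\<epsilon>}. u t \<in> cball \<mu> 1 \<and>
               (u has_vector_derivative \<kappa> - (u t)\<^sup>2) (at t within {-\<epsilon>..\<epsilon>}))"
  proof (rule picard_local[where f = "\<lambda>y. \<kappa> - y\<^sup>2" and x = \<mu> and r = 1 and L = L and M = M])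
    fix y z assume yz: "y \<in> cball \<mu> 1" "z \<in> cball \<mu> 1"
    have "\<bar>y + z\<bar> \<le> L" using ball[OF yz(1)] ball[OF yz(2)] by (simp add: L_def)
    then have "\<bar>y + z\<bar> * \<bar>y - z\<bar> \<le> L * \<bar>y - z\<bar>" by (rule mult_right_mono) simp
    moreover have "(\<kappa> - y\<^sup>2) - (\<kappa> - z\<^sup>2) = - ((y + z) * (y - z))" by (simp add: power2_eq_square algebra_simps)
    ultimately show "norm ((\<kappa> - y\<^sup>2) - (\<kappa> - z\<^sup>2)) \<le> L * norm (y - z)"
      by (simp only: real_norm_def abs_minus_cancel abs_mult)
  next
    fix y assume "y \<in> cball \<mu> 1"
    from ball[OF this] have "\<bar>y\<bar>\<^sup>2 \<le> (\<bar>\<mu>\<bar> + 1)\<^sup>2" by (intro power_mono) auto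
    then show "norm (\<kappa> - y\<^sup>2) \<le> M" unfolding M_def real_norm_def
      using abs_triangle_ineq4[of \<kappa> "y\<^sup>2"] by simp
  next
    show "\<epsilon> * L \<le> 1 / 2" using \<epsilon>(2) \<open>L > 0\<close> by (simp add: field_simps)
    show "\<epsilon> * M \<le> 1/2" using \<epsilon>(3) \<open>M > 0\<close> by (simp add: field_simps)
  qed (use \<epsilon> \<open>L > 0\<close> in auto)
  then obtain u where u: "u 0 = \<mu>" "\<And>t. t \<in> {-\<epsilon>..\<epsilon>} \<Longrightarrow> u t \<in> cball \<mu> 1"
     "\<And>t. t \<in> {-\<epsilon>..\<epsilon>} \<Longrightarrow> (u has_vector_derivative \<kappa> - (u t)\<^sup>2) (at t within {-\<epsilon>..\<epsilon>})" by blast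
  show ?thesis
  proof (rule that[of \<epsilon> "\<lambda>t. u (t - s)"])
    show "\<epsilon> > 0" by (fact \<epsilon>)
    show "u (s - s) = \<mu>" using u(1) by simp
    fix t assume t: "\<bar>t - s\<bar> < \<epsilon>"
    then have t': "t - s \<in> {-\<epsilon><..<\<epsilon>}" "t - s \<in> {-\<epsilon>..\<epsilon>}" by auto
    show "\<bar>u (t - s)\<bar> \<le> \<bar>\<mu>\<bar> + 1" by (rule ball[OF u(2)[OF t'(2)]])
    have "(u has_vector_derivative \<kappa> - (u (t - s))\<^sup>2) (at (t - s) within {-\<epsilon><..<\<epsilon>})"
      by (rule has_vector_derivative_within_subset[OF u(3)[OF t'(2)]]) auto
    then have "(u has_vector_derivative \<kappa> - (u (t - s))\<^sup>2) (at (t - s))"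
      unfolding at_within_open[OF t'(1) open_greaterThanLessThan] .
    moreover have "((\<lambda>t. t - s) has_vector_derivative 1) (at t)" by (auto intro!: derivative_eq_intros)
    ultimately have "(u \<circ> (\<lambda>t. t - s) has_vector_derivative 1 *\<^sub>R (\<kappa> - (u (t - s))\<^sup>2)) (at t)"
      by (intro vector_diff_chain_at)
    then show "((\<lambda>t. u (t - s)) has_vector_derivative \<kappa> - (u (t - s))\<^sup>2) (at t)" by (simp add: o_def)
  qed
qed

section \<open>The shape operator in a foliation chart\<close>

text \<open>
The covariant differential \<open>u \<mapsto> \<nabla>\<^sub>u N\<close> at a point, that is, minus the shape operator on the leaves.
\<close>

definition nabla :: "('e::euclidean_space \<Rightarrow> 'e) \<Rightarrow> ('e \<Rightarrow> 'e \<Rightarrow> 'e \<Rightarrow> 'e) \<Rightarrow> 'e \<Rightarrow> 'e \<Rightarrow> 'e" where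
  "nabla N \<Gamma> x u = frechet_derivative N (at x) u + \<Gamma> x u (N x)"

text \<open>
The orthogonal projection onto the complement of \<open>N x\<close>; the sign is due to \<open>g x (N x) (N x) = -1\<close>.
\<close>

definition normal_projection :: "('e::euclidean_space \<Rightarrow> 'e \<Rightarrow> 'e \<Rightarrow> real) \<Rightarrow> ('e \<Rightarrow> 'e) \<Rightarrow> 'e \<Rightarrow> 'e \<Rightarrow> 'e" where
  "normal_projection g N x u = u + g x u (N x) *\<^sub>R N x"

text \<open>
The curvature tensor, written out on constant fields.
\<close>

definition riemann :: "('e::euclidean_space \<Rightarrow> 'e \<Rightarrow> 'e \<Rightarrow> 'e) \<Rightarrow> 'e \<Rightarrow> 'e \<Rightarrow> 'e \<Rightarrow> 'e \<Rightarrow> 'e" where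
  "riemann \<Gamma> x u v w =
     frechet_derivative (\<lambda>y. \<Gamma> y v w) (at x) u + \<Gamma> x u (\<Gamma> x v w)
     - (frechet_derivative (\<lambda>y. \<Gamma> y u w) (at x) v + \<Gamma> x v (\<Gamma> x u w))"

text \<open>
The local situation in one chart of the foliation: all data live on an open subset \<open>S\<close> of the model space,
and the vectors \<open>(u, 0)\<close> are those tangent to the leaves.
\<close>

locale foliated_chart =
  fixes S :: "('v::euclidean_space \<times> real) set"
    and g :: "'v \<times> real \<Rightarrow> 'v \<times> real \<Rightarrow> 'v \<times> real \<Rightarrow> real"
    and N :: "'v \<times> real \<Rightarrow> 'v \<times> real"
    and \<Gamma> :: "'v \<times> real \<Rightarrow> 'v \<times> real \<Rightarrow> 'v \<times> real \<Rightarrow> 'v \<times> real"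
    and \<kappa> :: real
  assumes open_S: "open S"
    and smooth_N: "smooth_on S N"
    and smooth_\<Gamma>: "\<And>u v. smooth_on S (\<lambda>x. \<Gamma> x u v)"
    and bilinear_\<Gamma>: "\<And>x. x \<in> S \<Longrightarrow> bilinear (\<Gamma> x)"
    and \<Gamma>_sym: "\<And>x u v. x \<in> S \<Longrightarrow> \<Gamma> x u v = \<Gamma> x v u"
    and smooth_g: "\<And>u v. smooth_on S (\<lambda>x. g x u v)"
    and bilinear_g: "\<And>x. x \<in> S \<Longrightarrow> bilinear (g x)"
    and g_sym: "\<And>x u v. x \<in> S \<Longrightarrow> g x u v = g x v u"
    and metric_derivative: "\<And>x u v w. x \<in> S \<Longrightarrow>
       frechet_derivative (\<lambda>y. g y u v) (at x) w = g x (\<Gamma> x w u) v + g x u (\<Gamma> x w v)"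
    and N_unit: "\<And>x. x \<in> S \<Longrightarrow> g x (N x) (N x) = -1"
    and N_normal: "\<And>x u. x \<in> S \<Longrightarrow> g x (N x) (u, 0) = 0"
    and spacelike: "\<And>x u. x \<in> S \<Longrightarrow> u \<noteq> 0 \<Longrightarrow> g x (u, 0) (u, 0) > 0"
    and N_geodesic: "\<And>x. x \<in> S \<Longrightarrow> nabla N \<Gamma> x (N x) = 0"
    and sectional: "\<And>x u v. x \<in> S \<Longrightarrow> area_form (g x) u v \<noteq> 0 \<Longrightarrow>
       g x (riemann \<Gamma> x u v v) u = \<kappa> * area_form (g x) u v"
begin

abbreviation "K \<equiv> nabla N \<Gamma>"
abbreviation "\<pi> \<equiv> normal_projection g N"
abbreviation "D x \<equiv> frechet_derivative N (at x)"
abbreviation "D\<Gamma> x u v \<equiv> frechet_derivative (\<lambda>y. \<Gamma> y u v) (at x)"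

lemma N_has_derivative: "x \<in> S \<Longrightarrow> (N has_derivative D x) (at x)"
  by (rule smooth_on_has_derivative[OF smooth_N])

lemma linear_D: "x \<in> S \<Longrightarrow> linear (D x)"
  by (rule has_derivative_linear[OF N_has_derivative])

lemma linear_\<Gamma>: assumes "x \<in> S" shows "linear (\<Gamma> x u)" "linear (\<lambda>w. \<Gamma> x w u)"
  using bilinear_\<Gamma>[OF assms] unfolding bilinear_def by blast+

lemma linear_g: assumes "x \<in> S" shows "linear (g x u)" "linear (\<lambda>w. g x w u)"
  using bilinear_g[OF assms] unfolding bilinear_def by blast+

lemma linear_K: "x \<in> S \<Longrightarrow> linear (K x)"
  unfolding nabla_def by (intro linear_compose_add linear_D linear_\<Gamma>)

lemma linear_\<pi>: "x \<in> S \<Longrightarrow> linear (\<pi> x)"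
  unfolding normal_projection_def
  by (rule linearI) (auto simp: linear_add[OF linear_g(2)] linear_scale[OF linear_g(2)] algebra_simps)

lemmas \<Gamma>_simps =
  linear_add[OF linear_\<Gamma>(1)] linear_add[OF linear_\<Gamma>(2)]
  linear_diff[OF linear_\<Gamma>(1)] linear_diff[OF linear_\<Gamma>(2)]
  linear_neg[OF linear_\<Gamma>(1)] linear_neg[OF linear_\<Gamma>(2)]
  linear_scale[OF linear_\<Gamma>(1)] linear_scale[OF linear_\<Gamma>(2)]
  linear_0[OF linear_\<Gamma>(1)] linear_0[OF linear_\<Gamma>(2)]

lemmas g_simps =
  linear_add[OF linear_g(1)] linear_add[OF linear_g(2)]
  linear_diff[OF linear_g(1)] linear_diff[OF linear_g(2)]
  linear_neg[OF linear_g(1)] linear_neg[OF linear_g(2)]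
  linear_scale[OF linear_g(1)] linear_scale[OF linear_g(2)]
  linear_0[OF linear_g(1)] linear_0[OF linear_g(2)]

lemmas K_simps = linear_add[OF linear_K] linear_diff[OF linear_K] linear_neg[OF linear_K]
  linear_scale[OF linear_K] linear_0[OF linear_K]

subsection \<open>Decomposition of the tangent space\<close>

lemma snd_N_nonzero: assumes "x \<in> S" shows "snd (N x) \<noteq> 0"
proof
  assume "snd (N x) = 0"
  then have "N x = (fst (N x), 0)" by (simp add: prod_eq_iff)
  with N_normal[OF assms, of "fst (N x)"] N_unit[OF assms] show False by simp
qed

lemma tangent_decomposition:
  assumes "x \<in> S" obtains a s where "w = (a, 0) + s *\<^sub>R N x"
proof
  show "w = (fst w - (snd w / snd (N x)) *\<^sub>R fst (N x), 0) + (snd w / snd (N x)) *\<^sub>R N x"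
    using snd_N_nonzero[OF assms] by (simp add: prod_eq_iff)
qed

text \<open>
Nondegeneracy follows from the signs of \<open>g\<close> on the leaf direction and on \<open>N\<close>.
\<close>

lemma g_nondegenerate:
  assumes x: "x \<in> S" and tan: "\<And>a. g x w (a, 0) = 0" and nor: "g x w (N x) = 0"
  shows "w = 0"
proof -
  obtain a s where w: "w = (a, 0) + s *\<^sub>R N x" by (rule tangent_decomposition[OF x])
  have "g x w (N x) = - s" by (simp add: w g_simps x N_unit g_sym[OF x, of "(a, 0)"] N_normal)
  with nor have "s = 0" by simp
  then have "g x (a, 0) (a, 0) = 0" using tan[of a] by (simp add: w)
  then have "a = 0" using spacelike[OF x, of a] by fastforce
  with \<open>s = 0\<close> w show ?thesis by (simp add: zero_prod_def)
qed

lemma \<pi>_tangent: "x \<in> S \<Longrightarrow> \<pi> x (a, 0) = (a, 0)"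
  by (simp add: normal_projection_def N_normal g_sym[of x "(a, 0)"])

lemma \<pi>_N: "x \<in> S \<Longrightarrow> \<pi> x (N x) = 0"
  by (simp add: normal_projection_def N_unit)

lemma \<pi>_idem: "x \<in> S \<Longrightarrow> \<pi> x (\<pi> x u) = \<pi> x u"
  by (simp add: normal_projection_def N_unit g_simps)

subsection \<open>First derivatives\<close>

lemma metric_field_derivative:
  assumes x: "x \<in> S" and Y: "(Y has_derivative Y') (at x)"
  shows "((\<lambda>y. g y (Y y) v) has_derivative
     (\<lambda>h. g x (\<Gamma> x h (Y x) + Y' h) v + g x (Y x) (\<Gamma> x h v))) (at x)"
  by (rule has_derivative_eq_rhs[OF has_derivative_apply_linear[OF open_S x, of "\<lambda>y w. g y w v", OF linear_g(2) _ Y]])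
    (auto simp: fun_eq_iff metric_derivative[OF x] g_simps x smooth_on_differentiable[OF smooth_g x])

lemma metric_N_derivative:
  assumes x: "x \<in> S"
  shows "((\<lambda>y. g y (N y) v) has_derivative (\<lambda>h. g x (K x h) v + g x (N x) (\<Gamma> x h v))) (at x)"
  using metric_field_derivative[OF x N_has_derivative[OF x]] by (simp add: nabla_def add.commute)

text \<open>
Differentiate \<open>g (N, N) = -1\<close>.
\<close>

lemma K_normal: assumes x: "x \<in> S" shows "g x (K x h) (N x) = 0"
proof -
  have sw: "((\<lambda>y. g y v (N y)) has_derivative (\<lambda>h. g x (K x h) v + g x (N x) (\<Gamma> x h v))) (at x)" for v
    by (rule has_derivative_transform_within_open[OF metric_N_derivative[OF x] open_S x]) (rule g_sym)
  have "((\<lambda>y. g y (N y) (N y)) has_derivative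
      (\<lambda>h. frechet_derivative (\<lambda>y. g y (N x) (N y)) (at x) h + g x (D x h) (N x))) (at x)"
    by (rule has_derivative_apply_linear[OF open_S x, of "\<lambda>y w. g y w (N y)", OF linear_g(2) _ N_has_derivative[OF x]])
      (use sw differentiable_def in blast)+
  from has_derivative_locally_const[OF this open_S x N_unit]
  have "g x (K x h) (N x) + g x (N x) (\<Gamma> x h (N x)) + g x (D x h) (N x) = 0"
    unfolding frechet_derivative_at[OF sw, symmetric] .
  then show ?thesis by (simp add: nabla_def g_simps x g_sym[OF x, of "N x"])
qed

text \<open>
Differentiate \<open>g (N, (a, 0)) = 0\<close>.
\<close>

lemma tangent_zero: assumes x: "x \<in> S"
  shows "g x (K x h) (a, 0) + g x (N x) (\<Gamma> x h (a, 0)) = 0"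
  by (rule has_derivative_locally_const[OF metric_N_derivative[OF x] open_S x N_normal])

text \<open>
This says that \<open>\<langle>N, \<cdot>\<rangle>\<close> is closed. On the leaf directions it is the symmetry of the second fundamental form,
and the remaining components vanish because \<open>N\<close> is geodesic and of constant length.
\<close>

lemma K_self_adjoint: assumes x: "x \<in> S" shows "g x (K x u) v = g x (K x v) u"
proof -
  have tan: "g x (K x (a, 0)) (b, 0) = g x (K x (b, 0)) (a, 0)" for a b
    using tangent_zero[OF x, of "(a, 0)" b] tangent_zero[OF x, of "(b, 0)" a] \<Gamma>_sym[OF x, of "(a, 0)"] by simp
  obtain a s where u: "u = (a, 0) + s *\<^sub>R N x" by (rule tangent_decomposition[OF x])
  obtain b t where v: "v = (b, 0) + t *\<^sub>R N x" by (rule tangent_decomposition[OF x])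
  show ?thesis using tan[of a b] by (simp add: u v g_simps K_simps x N_geodesic K_normal)
qed

text \<open>
In the chart \<open>\<langle>N, \<cdot>\<rangle> = f dy\<close>, where \<open>f = g (N, (0, 1))\<close>. Closedness means that \<open>f\<close> has no derivative along
the leaf, and \<open>g (N, N) = -1\<close> says that \<open>f\<close> times the transversal component of \<open>N\<close> is \<open>-1\<close>.
\<close>

lemma snd_N_constant_along_slice:
  assumes seg: "closed_segment p q \<subseteq> S" and snd: "snd p = snd q"
  shows "snd (N p) = snd (N q)"
proof -
  define f where "f x = g x (N x) (0, 1)" for x
  have f: "f x * snd (N x) = -1" if "x \<in> S" for x
  proof -
    have "N x = (fst (N x), 0) + snd (N x) *\<^sub>R (0, 1)" by (simp add: prod_eq_iff)
    then have "g x (N x) (N x) = g x (N x) ((fst (N x), 0) + snd (N x) *\<^sub>R (0, 1))" by metis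
    also have "\<dots> = snd (N x) * f x" by (simp add: g_simps that N_normal f_def del: scaleR_Pair add_Pair)
    finally show ?thesis using N_unit[OF that] by (simp add: mult.commute)
  qed
  define \<gamma> where "\<gamma> t = p + t *\<^sub>R (q - p)" for t :: real
  have \<gamma>S: "\<gamma> t \<in> S" if "t \<in> {0..1}" for t
  proof -
    have "\<gamma> t = (1 - t) *\<^sub>R p + t *\<^sub>R q" by (simp add: \<gamma>_def algebra_simps)
    then have "\<gamma> t \<in> closed_segment p q" using that by (auto simp: closed_segment_def)
    then show ?thesis using seg by blast
  qed
  have "((f \<circ> \<gamma>) has_derivative (\<lambda>h. 0)) (at t within {0..1})" if t: "t \<in> {0..1}" for t
  proof -
    define x where "x = \<gamma> t"
    have x: "x \<in> S" using \<gamma>S[OF t] by (simp add: x_def)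
    have F: "(f has_derivative (\<lambda>h. g x (K x h) (0, 1) + g x (N x) (\<Gamma> x h (0, 1)))) (at x)"
      unfolding f_def by (rule metric_N_derivative[OF x])
    have slice: "g x (K x (a, 0)) (0, 1) + g x (N x) (\<Gamma> x (a, 0) (0, 1)) = 0" for a
      using tangent_zero[OF x, of "(0, 1)" a] K_self_adjoint[OF x, of "(a, 0)" "(0, 1)"] \<Gamma>_sym[OF x, of "(a, 0)"]
      by simp
    have qp: "q - p = (fst (q - p), 0)" using snd by (simp add: prod_eq_iff)
    have "(\<gamma> has_derivative (\<lambda>h. h *\<^sub>R (q - p))) (at t within {0..1})"
      unfolding \<gamma>_def by (auto intro!: derivative_eq_intros)
    from diff_chain_within[OF this has_derivative_at_withinI[OF F[unfolded x_def]], unfolded x_def[symmetric]]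
    show ?thesis
      by (rule has_derivative_eq_rhs)
        (use slice[of "fst (q - p)", folded qp] in \<open>simp add: fun_eq_iff K_simps(4) linear_scale[OF linear_g(1)]
          linear_scale[OF linear_g(2)] linear_scale[OF linear_\<Gamma>(2)] x distrib_left[symmetric]\<close>)
  qed
  then have "(f \<circ> \<gamma>) 0 = (f \<circ> \<gamma>) 1"
    using has_derivative_zero_unique[of "{0..1::real}" "f \<circ> \<gamma>" 0 1] by auto
  then have "f p = f q" by (simp add: \<gamma>_def)
  moreover have "p \<in> S" "q \<in> S" using seg by auto
  ultimately show ?thesis using f[of p] f[of q]
    by (metis mult_cancel_left mult_zero_left zero_neq_neg_one)
qed

subsection \<open>The Riccati equation\<close>

definition K_deriv :: "'v \<times> real \<Rightarrow> 'v \<times> real \<Rightarrow> 'v \<times> real \<Rightarrow> 'v \<times> real" where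
  "K_deriv x u h = frechet_derivative (\<lambda>y. D y u) (at x) h + (D\<Gamma> x u (N x) h + \<Gamma> x u (D x h))"

lemma K_has_derivative:
  assumes x: "x \<in> S" shows "((\<lambda>y. K y u) has_derivative K_deriv x u) (at x)"
  unfolding nabla_def K_deriv_def
  by (intro has_derivative_add smooth_on_has_derivative[OF smooth_on_frechet_derivative[OF smooth_N] x]
      has_derivative_apply_linear[OF open_S x linear_\<Gamma>(1) _ N_has_derivative[OF x]] smooth_on_differentiable[OF smooth_\<Gamma> x])

text \<open>
The derivative of the equation \<open>\<nabla>\<^sub>N N = 0\<close> in the direction \<open>u\<close>; the symmetry of second derivatives
turns it into information on the derivative of \<open>D y u\<close> along \<open>N\<close>.
\<close>

lemma geodesic_derivative:
  assumes x: "x \<in> S"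
  shows "frechet_derivative (\<lambda>y. D y u) (at x) (N x) + D x (D x u)
     + D\<Gamma> x (N x) (N x) u + \<Gamma> x (N x) (D x u) + \<Gamma> x (D x u) (N x) = 0"
proof -
  have 1: "((\<lambda>y. D y (N y)) has_derivative
      (\<lambda>h. frechet_derivative (\<lambda>y. D y (N x)) (at x) h + D x (D x h))) (at x)"
    by (rule has_derivative_apply_linear[OF open_S x linear_D _ N_has_derivative[OF x]])
      (assumption, rule smooth_on_differentiable[OF smooth_on_frechet_derivative[OF smooth_N] x])
  have 2: "((\<lambda>y. \<Gamma> y w (N y)) has_derivative (\<lambda>h. D\<Gamma> x w (N x) h + \<Gamma> x w (D x h))) (at x)" for w
    by (rule has_derivative_apply_linear[OF open_S x linear_\<Gamma>(1) _ N_has_derivative[OF x]])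
      (assumption, rule smooth_on_differentiable[OF smooth_\<Gamma> x])
  have 3: "((\<lambda>y. \<Gamma> y (N y) (N y)) has_derivative
      (\<lambda>h. frechet_derivative (\<lambda>y. \<Gamma> y (N x) (N y)) (at x) h + \<Gamma> x (D x h) (N x))) (at x)"
    by (rule has_derivative_apply_linear[OF open_S x, of "\<lambda>y w. \<Gamma> y w (N y)", OF linear_\<Gamma>(2) _ N_has_derivative[OF x]])
      (use 2 differentiable_def in blast)+
  have "frechet_derivative (\<lambda>y. D y (N x)) (at x) u + D x (D x u)
      + (frechet_derivative (\<lambda>y. \<Gamma> y (N x) (N y)) (at x) u + \<Gamma> x (D x u) (N x)) = 0"
    by (rule has_derivative_locally_const[OF has_derivative_add[OF 1 3] open_S x])
      (use N_geodesic in \<open>auto simp: nabla_def\<close>)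
  then show ?thesis
    unfolding frechet_derivative_at[OF 2, symmetric]
      second_derivative_symmetric[OF smooth_N open_S x, of "N x" u]
    by (simp add: algebra_simps)
qed

text \<open>
The Riccati equation \<open>\<nabla>\<^sub>N K = - K\<^sup>2 - R(\<cdot>, N)N\<close>. The two terms with \<open>\<Gamma>\<close> appear because the left
hand side is the coordinate derivative of \<open>K\<close> and not its covariant derivative.
\<close>

lemma riccati_curvature:
  assumes x: "x \<in> S"
  shows "K_deriv x u (N x) = - riemann \<Gamma> x u (N x) (N x) - K x (K x u)
           + K x (\<Gamma> x (N x) u) - \<Gamma> x (N x) (K x u)"
proof -
  have DN: "D x (N x) = - \<Gamma> x (N x) (N x)"
    using N_geodesic[OF x] by (simp add: nabla_def add_eq_0_iff)
  have sw: "\<Gamma> x (N x) u = \<Gamma> x u (N x)" by (rule \<Gamma>_sym[OF x])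
  have KK: "K x (K x u) = D x (D x u) + D x (\<Gamma> x u (N x)) + (\<Gamma> x (D x u) (N x) + \<Gamma> x (\<Gamma> x u (N x)) (N x))"
    unfolding nabla_def linear_add[OF linear_D[OF x]] linear_add[OF linear_\<Gamma>(2)[OF x]] ..
  have K\<Gamma>: "K x (\<Gamma> x (N x) u) = D x (\<Gamma> x u (N x)) + \<Gamma> x (\<Gamma> x u (N x)) (N x)"
    unfolding nabla_def sw ..
  have \<Gamma>K: "\<Gamma> x (N x) (K x u) = \<Gamma> x (N x) (D x u) + \<Gamma> x (N x) (\<Gamma> x u (N x))"
    unfolding nabla_def linear_add[OF linear_\<Gamma>(1)[OF x]] ..
  have X: "frechet_derivative (\<lambda>y. D y u) (at x) (N x) = - (D x (D x u)
     + D\<Gamma> x (N x) (N x) u + \<Gamma> x (N x) (D x u) + \<Gamma> x (D x u) (N x))"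
    using geodesic_derivative[OF x, of u] unfolding add.assoc by (rule eq_neg_iff_add_eq_0[THEN iffD2])
  show ?thesis
    unfolding K_deriv_def riemann_def X KK K\<Gamma> \<Gamma>K DN linear_neg[OF linear_\<Gamma>(1)[OF x]]
    by (simp only: minus_add_distrib diff_conv_add_uminus minus_minus add_ac) simp
qed

lemma linear_K_deriv: assumes x: "x \<in> S" shows "linear (\<lambda>u. K_deriv x u h)"
proof -
  have "(\<lambda>y. K y b) differentiable at x" for b
    using K_has_derivative[OF x] differentiable_def by blast
  then have "linear (\<lambda>u. frechet_derivative (\<lambda>y. K y u) (at x) h)"
    using frechet_derivative_linear_parameter[of S x K h] open_S x linear_K by blast
  then show ?thesis unfolding frechet_derivative_at[OF K_has_derivative[OF x], symmetric] .
qed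

text \<open>
Rather than deriving the pair symmetry of the curvature tensor from the Bianchi identity,
one differentiates the symmetry of \<open>K\<close> along \<open>N\<close>: all terms of the Riccati equation except the curvature
are visibly symmetric, so the curvature term is symmetric too.
\<close>

lemma normal_curvature_self_adjoint:
  assumes x: "x \<in> S"
  shows "g x (riemann \<Gamma> x u (N x) (N x)) v = g x (riemann \<Gamma> x v (N x) (N x)) u"
proof -
  have "((\<lambda>y. g y (K y u) v - g y (K y v) u) has_derivative
     (\<lambda>h. (g x (\<Gamma> x h (K x u) + K_deriv x u h) v + g x (K x u) (\<Gamma> x h v)) -
          (g x (\<Gamma> x h (K x v) + K_deriv x v h) u + g x (K x v) (\<Gamma> x h u)))) (at x)"
    by (rule has_derivative_diff[OF metric_field_derivative[OF x K_has_derivative[OF x]]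
          metric_field_derivative[OF x K_has_derivative[OF x]]])
  from has_derivative_locally_const[OF this open_S x, of 0 "N x", OF right_minus_eq[THEN iffD2, OF K_self_adjoint]]
  have "g x (\<Gamma> x (N x) (K x u) + K_deriv x u (N x)) v + g x (K x u) (\<Gamma> x (N x) v) =
     g x (\<Gamma> x (N x) (K x v) + K_deriv x v (N x)) u + g x (K x v) (\<Gamma> x (N x) u)"
    by simp
  then have sum: "g x (\<Gamma> x (N x) (K x u)) v + g x (K_deriv x u (N x)) v + g x (K x u) (\<Gamma> x (N x) v) =
     g x (\<Gamma> x (N x) (K x v)) u + g x (K_deriv x v (N x)) u + g x (K x v) (\<Gamma> x (N x) u)"
    by (simp only: linear_add[OF linear_g(2)[OF x]])
  have expand: "g x (K_deriv x u (N x)) v = - g x (riemann \<Gamma> x u (N x) (N x)) v - g x (K x (K x u)) v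
           + g x (K x v) (\<Gamma> x (N x) u) - g x (\<Gamma> x (N x) (K x u)) v" for u v
    unfolding riccati_curvature[OF x] K_self_adjoint[OF x, of "\<Gamma> x (N x) u" v, symmetric]
    by (simp only: linear_add[OF linear_g(2)[OF x]] linear_diff[OF linear_g(2)[OF x]] linear_neg[OF linear_g(2)[OF x]])
  have square: "g x (K x (K x u)) v = g x (K x (K x v)) u"
    by (rule trans[OF K_self_adjoint[OF x, of "K x u" v]
        trans[OF g_sym[OF x, of "K x v" "K x u"] K_self_adjoint[OF x, of "K x v" u, symmetric]]])
  \<comment> \<open>here \<open>r\<close> and \<open>r'\<close> stand for the curvature terms, the other letters for the terms that cancel\<close>
  have cancel: "r = r'" if "p + q + b = p' + q' + b'" "q = - r - k + b' - p" "q' = - r' - k' + b - p'" "k = k'"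
    for p q b p' q' b' r r' k k' :: real
    using that by simp
  show ?thesis
    by (rule cancel[OF sum expand expand square])
qed

text \<open>
Sectional curvatures of planes containing \<open>N\<close> give the quadratic form of \<open>u \<mapsto> R(u, N)N\<close>
on the leaf directions; self-adjointness permits polarization.
\<close>

lemma normal_curvature:
  assumes x: "x \<in> S"
  shows "riemann \<Gamma> x u (N x) (N x) = - (\<kappa> *\<^sub>R \<pi> x u)"
proof -
  define R where "R u = riemann \<Gamma> x u (N x) (N x)" for u
  have "R = (\<lambda>u. - K_deriv x u (N x) - K x (K x u) + K x (\<Gamma> x (N x) u) - \<Gamma> x (N x) (K x u))"
    by (auto simp: fun_eq_iff R_def riccati_curvature[OF x])
  moreover have "linear \<dots>"
    by (rule linearI) (simp_all add: linear_add[OF linear_K_deriv[OF x]] linear_scale[OF linear_K_deriv[OF x]]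
        K_simps \<Gamma>_simps x algebra_simps)
  ultimately have linR: "linear R" by simp
  note R_simps = linear_add[OF linR] linear_scale[OF linR]
  have sym: "g x (R u) v = g x (R v) u" for u v
    unfolding R_def by (rule normal_curvature_self_adjoint[OF x])
  have RN: "R (N x) = 0" by (simp add: R_def riemann_def)
  have diag: "g x (R (a, 0)) (a, 0) = - \<kappa> * g x (a, 0) (a, 0)" for a
  proof (cases "a = 0")
    case True
    then have "(a, 0) = (0 :: 'v \<times> real)" by (simp add: zero_prod_def)
    then show ?thesis by (simp add: g_simps x)
  next
    case False
    have "area_form (g x) (a, 0) (N x) = - g x (a, 0) (a, 0)"
      by (simp add: area_form_def N_unit x g_sym[OF x, of "(a, 0)" "N x"] N_normal)
    then show ?thesis using sectional[OF x, of "(a, 0)" "N x"] spacelike[OF x False] by (simp add: R_def)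
  qed
  have pol: "g x (R (a, 0)) (b, 0) = - \<kappa> * g x (a, 0) (b, 0)" for a b
  proof -
    have "(a + b, 0) = (a, 0) + (b, 0 :: real)" by simp
    then have "g x (R ((a, 0) + (b, 0))) ((a, 0) + (b, 0)) = - \<kappa> * g x ((a, 0) + (b, 0)) ((a, 0) + (b, 0))"
      using diag[of "a + b"] by metis
    then show ?thesis
      using diag[of a] diag[of b] sym[of "(a, 0)" "(b, 0)"] g_sym[OF x, of "(a, 0)" "(b, 0)"]
      by (simp add: R_simps g_simps x algebra_simps del: add_Pair)
  qed
  have tan: "R (a, 0) = - (\<kappa> *\<^sub>R (a, 0))" for a
  proof -
    have "R (a, 0) + \<kappa> *\<^sub>R (a, 0) = 0"
    proof (rule g_nondegenerate[OF x])
      show "g x (R (a, 0) + \<kappa> *\<^sub>R (a, 0)) (b, 0) = 0" for b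
        using pol[of a b] by (simp add: g_simps x del: scaleR_Pair)
      show "g x (R (a, 0) + \<kappa> *\<^sub>R (a, 0)) (N x) = 0"
        using sym[of "(a, 0)" "N x"] by (simp add: g_simps x RN N_normal g_sym[OF x, of "(a, 0)" "N x"] del: scaleR_Pair)
    qed
    then show ?thesis by (simp add: add_eq_0_iff2)
  qed
  obtain a s where u: "u = (a, 0) + s *\<^sub>R N x" by (rule tangent_decomposition[OF x])
  have "R u = - (\<kappa> *\<^sub>R \<pi> x u)"
    unfolding u R_simps tan RN linear_add[OF linear_\<pi>[OF x]] linear_scale[OF linear_\<pi>[OF x]]
    by (simp add: \<pi>_tangent \<pi>_N x)
  then show ?thesis by (simp add: R_def)
qed

lemma riccati:
  "x \<in> S \<Longrightarrow> K_deriv x u (N x) = \<kappa> *\<^sub>R \<pi> x u - K x (K x u) + K x (\<Gamma> x (N x) u) - \<Gamma> x (N x) (K x u)"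
  by (simp only: riccati_curvature normal_curvature minus_minus)

text \<open>
The projection is parallel along \<open>N\<close>; the commutator with \<open>\<Gamma>\<close> again converts the covariant derivative
into a coordinate derivative.
\<close>

lemma \<pi>_has_derivative:
  assumes x: "x \<in> S"
  shows "\<exists>P. ((\<lambda>y. \<pi> y u) has_derivative P) (at x) \<and> P (N x) = \<pi> x (\<Gamma> x (N x) u) - \<Gamma> x (N x) (\<pi> x u)"
proof -
  have sw: "((\<lambda>y. g y u (N y)) has_derivative (\<lambda>h. g x (K x h) u + g x (N x) (\<Gamma> x h u))) (at x)"
    by (rule has_derivative_transform_within_open[OF metric_N_derivative[OF x] open_S x]) (rule g_sym)
  have DN: "D x (N x) = - \<Gamma> x (N x) (N x)"
    using N_geodesic[OF x] by (simp add: nabla_def add_eq_0_iff)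
  let ?P = "\<lambda>h. 0 + (g x u (N x) *\<^sub>R D x h + (g x (K x h) u + g x (N x) (\<Gamma> x h u)) *\<^sub>R N x)"
  have "((\<lambda>y. \<pi> y u) has_derivative
      (\<lambda>h. 0 + (g x u (N x) *\<^sub>R D x h + (g x (K x h) u + g x (N x) (\<Gamma> x h u)) *\<^sub>R N x))) (at x)"
    unfolding normal_projection_def
    by (rule has_derivative_add[OF has_derivative_const has_derivative_scaleR[OF sw N_has_derivative[OF x]]])
  moreover have "?P (N x) = \<pi> x (\<Gamma> x (N x) u) - \<Gamma> x (N x) (\<pi> x u)"
    by (simp add: normal_projection_def DN N_geodesic x g_simps \<Gamma>_simps g_sym[OF x, of "N x" "\<Gamma> x (N x) u"])
  ultimately show ?thesis by blast
qed

text \<open>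
Umbilicity is a condition on the leaf directions only, but the equivalent operator identity on the whole
tangent space does not refer to the foliation. This makes it comparable between charts and
differentiable along \<open>N\<close>.
\<close>

lemma umbilic_iff_tangent:
  assumes x: "x \<in> S"
  shows "(\<forall>w. K x w = \<mu> *\<^sub>R \<pi> x w) \<longleftrightarrow> (\<forall>a b. g x (K x (a, 0)) (b, 0) = \<mu> * g x (a, 0) (b, 0))"
proof (intro iffI allI)
  fix a b assume "\<forall>w. K x w = \<mu> *\<^sub>R \<pi> x w"
  then show "g x (K x (a, 0)) (b, 0) = \<mu> * g x (a, 0) (b, 0)"
    by (simp add: \<pi>_tangent x g_simps del: scaleR_Pair)
next
  fix w assume *: "\<forall>a b. g x (K x (a, 0)) (b, 0) = \<mu> * g x (a, 0) (b, 0)"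
  have tan: "K x (a, 0) = \<mu> *\<^sub>R (a, 0)" for a
  proof -
    have "K x (a, 0) - \<mu> *\<^sub>R (a, 0) = 0"
      by (rule g_nondegenerate[OF x])
        (use * in \<open>simp_all add: g_simps x K_normal N_normal g_sym[OF x, of "(a, 0)" "N x"] del: scaleR_Pair\<close>)
    then show ?thesis by simp
  qed
  obtain a s where w: "w = (a, 0) + s *\<^sub>R N x" by (rule tangent_decomposition[OF x])
  have "K x w = \<mu> *\<^sub>R (a, 0)"
    by (simp only: w K_simps(1,4)[OF x] tan N_geodesic[OF x] scaleR_zero_right add_0_right)
  moreover have "\<pi> x w = (a, 0)"
    by (simp only: w linear_add[OF linear_\<pi>[OF x]] linear_scale[OF linear_\<pi>[OF x]]
        \<pi>_tangent[OF x] \<pi>_N[OF x] scaleR_zero_right add_0_right)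
  ultimately show "K x w = \<mu> *\<^sub>R \<pi> x w" by simp
qed

subsection \<open>Propagation of umbilicity\<close>

definition umbilic_at :: "'v \<times> real \<Rightarrow> bool" where
  "umbilic_at x \<longleftrightarrow> (\<exists>\<mu>. \<forall>w. K x w = \<mu> *\<^sub>R \<pi> x w)"

lemma K_continuous: "continuous_on S (\<lambda>x. K x w)"
  using K_has_derivative has_derivative_continuous continuous_at_imp_continuous_on by blast

lemma \<pi>_continuous: "continuous_on S (\<lambda>x. \<pi> x w)"
  using \<pi>_has_derivative has_derivative_continuous continuous_at_imp_continuous_on by blast

lemma g_K_continuous: "continuous_on S (\<lambda>x. g x (K x w) v)"
  by (intro continuous_at_imp_continuous_on ballI)
    (rule has_derivative_continuous[OF metric_field_derivative[OF _ K_has_derivative]])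

text \<open>
If \<open>x\<close> is umbilical, its factor is the continuous function \<open>m\<close>, the Rayleigh quotient of one fixed
leaf direction. Thus umbilicity is the vanishing of the continuous functions \<open>K x w - m x *\<^sub>R \<pi> x w\<close>.
\<close>

lemma not_umbilic_open: "open {x \<in> S. \<not> umbilic_at x}"
proof -
  \<comment> \<open>any nonzero leaf direction will do\<close>
  obtain a :: 'v where "a \<in> Basis" using nonempty_Basis by blast
  then have "a \<noteq> 0" by auto
  define m where "m x = g x (K x (a, 0)) (a, 0) / g x (a, 0) (a, 0)" for x
  have pos: "g x (a, 0) (a, 0) \<noteq> 0" if "x \<in> S" for x using spacelike[OF that \<open>a \<noteq> 0\<close>] by simp
  have contm: "continuous_on S m"
    unfolding m_def by (intro continuous_on_divide g_K_continuous smooth_on_continuous[OF smooth_g]) (use pos in simp)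
  have iff: "umbilic_at x \<longleftrightarrow> (\<forall>w. K x w - m x *\<^sub>R \<pi> x w = 0)" if x: "x \<in> S" for x
  proof
    assume "umbilic_at x"
    then obtain \<mu> where \<mu>: "\<forall>w. K x w = \<mu> *\<^sub>R \<pi> x w" unfolding umbilic_at_def by blast
    then have "g x (K x (a, 0)) (a, 0) = \<mu> * g x (a, 0) (a, 0)"
      using umbilic_iff_tangent[OF x] by blast
    then have "m x = \<mu>" using pos[OF x] by (simp add: m_def)
    with \<mu> show "\<forall>w. K x w - m x *\<^sub>R \<pi> x w = 0" by simp
  qed (auto simp: umbilic_at_def)
  have "{x \<in> S. \<not> umbilic_at x} = (\<Union>w. S \<inter> (\<lambda>x. K x w - m x *\<^sub>R \<pi> x w) -` (- {0}))"
    unfolding vimage_def using iff by blast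
  also have "open \<dots>"
    by (intro open_UN ballI continuous_open_preimage[OF _ open_S] continuous_intros K_continuous \<pi>_continuous contm)
  finally show ?thesis .
qed

text \<open>
With \<open>u' = \<kappa> - u\<^sup>2\<close>, the difference \<open>E = K - u \<pi>\<close> of two solutions of the Riccati equation satisfies
\<open>E' = - K E - u E \<pi> + [E, \<Gamma>\<^sub>N]\<close>, which is linear in \<open>E\<close>. Hence \<open>E = 0\<close> at one time forces \<open>E = 0\<close> nearby.
\<close>

lemma umbilic_propagates:
  assumes "\<epsilon> > 0"
    and xS: "\<And>t. \<bar>t - s\<bar> < \<epsilon> \<Longrightarrow> x t \<in> S"
    and x': "\<And>t. \<bar>t - s\<bar> < \<epsilon> \<Longrightarrow> (x has_vector_derivative N (x t)) (at t)"
    and umb: "umbilic_at (x s)"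
  shows "\<exists>\<delta>>0. \<forall>t. \<bar>t - s\<bar> < \<delta> \<longrightarrow> umbilic_at (x t)"
proof -
  obtain \<mu> where \<mu>: "\<And>w. K (x s) w = \<mu> *\<^sub>R \<pi> (x s) w" using umb unfolding umbilic_at_def by blast
  obtain u \<epsilon>1 where u: "\<epsilon>1 > 0" "u s = \<mu>"
    "\<And>t. \<bar>t - s\<bar> < \<epsilon>1 \<Longrightarrow> (u has_vector_derivative \<kappa> - (u t)\<^sup>2) (at t)"
    "\<And>t. \<bar>t - s\<bar> < \<epsilon>1 \<Longrightarrow> \<bar>u t\<bar> \<le> \<bar>\<mu>\<bar> + 1"
    by (rule scalar_riccati_solution[where s = s and \<mu> = \<mu> and \<kappa> = \<kappa>]) (blast intro: that)
  have along: "((\<lambda>t. f (x t)) has_vector_derivative f' (N (x t))) (at t)"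
    if "\<bar>t - s\<bar> < \<epsilon>" "(f has_derivative f') (at (x t))" for f f' t
  proof -
    have "((\<lambda>t. f (x t)) has_derivative (\<lambda>h. f' (h *\<^sub>R N (x t)))) (at t)"
      by (rule has_derivative_compose[OF x'[OF that(1), unfolded has_vector_derivative_def] that(2)])
    then show ?thesis unfolding has_vector_derivative_def
      by (simp add: linear_scale[OF has_derivative_linear[OF that(2)]])
  qed
  define G where "G t w = \<Gamma> (x t) (N (x t)) w" for t w
  \<comment> \<open>the deviation from umbilicity and its claimed derivative\<close>
  define E where "E w t = K (x t) w - u t *\<^sub>R \<pi> (x t) w" for w t
  define E' where "E' w t = - K (x t) (E w t) - u t *\<^sub>R E (\<pi> (x t) w) t + E (G t w) t - G t (E w t)" for w t
  have linE: "linear (\<lambda>w. E w t)" if "\<bar>t - s\<bar> < \<epsilon>" for t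
    unfolding E_def using xS[OF that]
    by (intro linear_compose_sub linear_K linear_compose_scale_right linear_\<pi>)
  have E': "(E w has_vector_derivative E' w t) (at t)" if t: "\<bar>t - s\<bar> < \<epsilon>" "\<bar>t - s\<bar> < \<epsilon>1" for w t
  proof -
    note xt = xS[OF t(1)]
    obtain P where P: "((\<lambda>y. \<pi> y w) has_derivative P) (at (x t))"
      "P (N (x t)) = \<pi> (x t) (G t w) - G t (\<pi> (x t) w)"
      using \<pi>_has_derivative[OF xt, of w] unfolding G_def by blast
    have 1: "((\<lambda>t. K (x t) w) has_vector_derivative
        \<kappa> *\<^sub>R \<pi> (x t) w - K (x t) (K (x t) w) + K (x t) (G t w) - G t (K (x t) w)) (at t)"
      using along[OF t(1) K_has_derivative[OF xt]] unfolding riccati[OF xt] G_def .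
    have 2: "((\<lambda>t. \<pi> (x t) w) has_vector_derivative \<pi> (x t) (G t w) - G t (\<pi> (x t) w)) (at t)"
      using along[OF t(1) P(1)] unfolding P(2) .
    have 3: "((\<lambda>t. u t *\<^sub>R \<pi> (x t) w) has_vector_derivative
        u t *\<^sub>R (\<pi> (x t) (G t w) - G t (\<pi> (x t) w)) + (\<kappa> - (u t)\<^sup>2) *\<^sub>R \<pi> (x t) w) (at t)"
      using has_vector_derivative_scaleR[OF u(3)[OF t(2), folded has_real_derivative_iff_has_vector_derivative] 2] .
    have KE: "K (x t) (E w t) = K (x t) (K (x t) w) - u t *\<^sub>R K (x t) (\<pi> (x t) w)"
      unfolding E_def by (simp only: linear_diff[OF linear_K[OF xt]] linear_scale[OF linear_K[OF xt]])
    have GE: "G t (E w t) = G t (K (x t) w) - u t *\<^sub>R G t (\<pi> (x t) w)"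
      unfolding E_def G_def by (simp only: linear_diff[OF linear_\<Gamma>(1)[OF xt]] linear_scale[OF linear_\<Gamma>(1)[OF xt]])
    have E\<pi>: "E (\<pi> (x t) w) t = K (x t) (\<pi> (x t) w) - u t *\<^sub>R \<pi> (x t) w"
      unfolding E_def \<pi>_idem[OF xt] ..
    have "E' w t = (\<kappa> *\<^sub>R \<pi> (x t) w - K (x t) (K (x t) w) + K (x t) (G t w) - G t (K (x t) w))
       - (u t *\<^sub>R (\<pi> (x t) (G t w) - G t (\<pi> (x t) w)) + (\<kappa> - (u t)\<^sup>2) *\<^sub>R \<pi> (x t) w)"
      unfolding E'_def KE GE E\<pi> unfolding E_def
      by (simp add: algebra_simps power2_eq_square)
    with has_vector_derivative_diff[OF 1 3] show ?thesis unfolding E_def by simp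
  qed
  define B where "B t = (\<Sum>b\<in>Basis. norm (K (x t) b)) + (\<Sum>b\<in>Basis. norm (\<pi> (x t) b)) + (\<Sum>b\<in>Basis. norm (G t b))" for t
  have "isCont B s"
  proof -
    have xs: "x s \<in> S" "\<bar>s - s\<bar> < \<epsilon>" using xS \<open>\<epsilon> > 0\<close> by auto
    have contx: "isCont x s" using x'[OF xs(2)] by (rule has_vector_derivative_continuous)
    have at: "isCont f (x s) \<Longrightarrow> isCont (\<lambda>t. f (x t)) s" for f :: "'v \<times> real \<Rightarrow> 'v \<times> real"
      using isCont_o2[OF contx] by blast
    have "isCont (\<lambda>y. \<Gamma> y (N y) b) (x s)" for b
      using has_derivative_continuous[OF has_derivative_apply_linear[OF open_S xs(1), of "\<lambda>y w. \<Gamma> y w b", OF linear_\<Gamma>(2) _ N_has_derivative[OF xs(1)]]]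
        smooth_on_differentiable[OF smooth_\<Gamma> xs(1)] by blast
    moreover have "isCont (\<lambda>y. K y b) (x s)" "isCont (\<lambda>y. \<pi> y b) (x s)" for b
      using K_continuous \<pi>_continuous open_S xs(1) by (auto simp: continuous_on_eq_continuous_at)
    ultimately show ?thesis unfolding B_def G_def
      by (intro continuous_add continuous_sum continuous_norm at)
  qed
  then have "\<forall>\<^sub>F t in nhds s. dist (B t) (B s) < 1"
    by (intro tendstoD) (auto simp: isCont_def tendsto_at_iff_tendsto_nhds)
  then obtain \<epsilon>2 where \<epsilon>2: "\<epsilon>2 > 0" "\<And>t. \<bar>t - s\<bar> < \<epsilon>2 \<Longrightarrow> B t \<le> B s + 1"
    unfolding eventually_nhds_metric dist_real_def by force
  define C where "C = (B s + 1) * (\<bar>\<mu>\<bar> + 4)"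
  have B_nonneg: "B t \<ge> 0" for t unfolding B_def by (intro add_nonneg_nonneg sum_nonneg) auto
  have "\<exists>\<delta>>0. \<forall>t. \<bar>t - s\<bar> < \<delta> \<longrightarrow> (\<forall>b\<in>Basis. E b t = 0)"
  proof (rule linear_system_vanishes[where C = C and \<epsilon> = "min \<epsilon> (min \<epsilon>1 \<epsilon>2)" and d' = E'])
    show "C \<ge> 0" unfolding C_def using B_nonneg[of s] by simp
    show "min \<epsilon> (min \<epsilon>1 \<epsilon>2) > 0" using \<open>\<epsilon> > 0\<close> u(1) \<epsilon>2(1) by simp
    show "E b s = 0" for b using \<mu> u(2) by (simp add: E_def)
    fix b :: "'v \<times> real" and t assume b: "b \<in> Basis" and "\<bar>t - s\<bar> < min \<epsilon> (min \<epsilon>1 \<epsilon>2)"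
    then have t: "\<bar>t - s\<bar> < \<epsilon>" "\<bar>t - s\<bar> < \<epsilon>1" "\<bar>t - s\<bar> < \<epsilon>2" by simp_all
    show "(E b has_vector_derivative E' b t) (at t)" by (rule E'[OF t(1,2)])
    note xt = xS[OF t(1)]
    let ?S = "\<Sum>j\<in>Basis. norm (E j t)"
    have S0: "?S \<ge> 0" by (intro sum_nonneg) auto
    have Bt: "B t \<le> B s + 1" by (rule \<epsilon>2(2)[OF t(3)])
    have Eb: "norm (E b t) \<le> ?S" by (rule member_le_sum[OF b]) auto
    have Ew: "norm (E w t) \<le> ?S * norm w" for w by (rule linear_norm_bound[OF linE[OF t(1)]])
    have sums: "(\<Sum>b\<in>Basis. norm (K (x t) b)) \<ge> 0" "(\<Sum>b\<in>Basis. norm (\<pi> (x t) b)) \<ge> 0" "(\<Sum>b\<in>Basis. norm (G t b)) \<ge> 0"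
      by (intro sum_nonneg norm_ge_zero)+
    have KB: "(\<Sum>b\<in>Basis. norm (K (x t) b)) \<le> B s + 1" and GB: "(\<Sum>b\<in>Basis. norm (G t b)) \<le> B s + 1"
      and \<pi>B: "(\<Sum>b\<in>Basis. norm (\<pi> (x t) b)) \<le> B s + 1"
      using sums Bt unfolding B_def[of t] by linarith+
    have n1: "norm (K (x t) (E b t)) \<le> (B s + 1) * ?S"
      using linear_norm_bound[OF linear_K[OF xt], of "E b t"] mult_mono[OF KB Eb] B_nonneg[of s] by simp
    have linG: "linear (G t)" unfolding G_def by (rule linear_\<Gamma>(1)[OF xt])
    have n2: "norm (G t (E b t)) \<le> (B s + 1) * ?S"
      using linear_norm_bound[OF linG, of "E b t"] mult_mono[OF GB Eb] B_nonneg[of s] by simp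
    have "norm (G t b) \<le> B s + 1"
      using member_le_sum[OF b, of "\<lambda>b. norm (G t b)"] GB by simp
    then have "?S * norm (G t b) \<le> (B s + 1) * ?S"
      unfolding mult.commute[of ?S] by (rule mult_right_mono[OF _ S0])
    then have n3: "norm (E (G t b) t) \<le> (B s + 1) * ?S" by (rule order_trans[OF Ew])
    have "norm (\<pi> (x t) b) \<le> B s + 1"
      using member_le_sum[OF b, of "\<lambda>b. norm (\<pi> (x t) b)"] \<pi>B by simp
    then have "?S * norm (\<pi> (x t) b) \<le> (B s + 1) * ?S"
      unfolding mult.commute[of ?S] by (rule mult_right_mono[OF _ S0])
    then have "norm (E (\<pi> (x t) b) t) \<le> (B s + 1) * ?S" by (rule order_trans[OF Ew])
    then have n4: "norm (u t *\<^sub>R E (\<pi> (x t) b) t) \<le> (\<bar>\<mu>\<bar> + 1) * ((B s + 1) * ?S)"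
      unfolding norm_scaleR by (rule mult_mono[OF u(4)[OF t(2)]]) auto
    have tri: "norm (- p - q + r - v) \<le> norm p + norm q + norm r + norm v" for p q r v :: "'v \<times> real"
      using norm_triangle_ineq4[of "- p - q + r" v] norm_triangle_ineq[of "- p - q" r] norm_triangle_ineq4[of "- p" q]
      by simp
    have "norm (E' b t) \<le> (B s + 1) * ?S + (\<bar>\<mu>\<bar> + 1) * ((B s + 1) * ?S) + (B s + 1) * ?S + (B s + 1) * ?S"
      unfolding E'_def by (rule order_trans[OF tri]) (intro add_mono n1 n2 n3 n4)
    also have "\<dots> = C * ?S" by (simp add: C_def algebra_simps)
    finally show "norm (E' b t) \<le> C * ?S" .
  qed auto
  then obtain \<delta> where \<delta>: "\<delta> > 0" "\<And>t b. \<bar>t - s\<bar> < \<delta> \<Longrightarrow> b \<in> Basis \<Longrightarrow> E b t = 0" by blast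
  have "umbilic_at (x t)" if t: "\<bar>t - s\<bar> < min \<epsilon> \<delta>" for t
  proof -
    have "norm (E w t) \<le> 0" for w
      using linear_norm_bound[OF linE[of t], of w] \<delta>(2)[of t] t by simp
    then show ?thesis unfolding umbilic_at_def E_def by (intro exI[of _ "u t"]) simp
  qed
  then show ?thesis using \<delta>(1) \<open>\<epsilon> > 0\<close> by (intro exI[of _ "min \<epsilon> \<delta>"]) simp
qed

end

section \<open>Charts and transition maps\<close>

abbreviation cinv :: "('m, 'e) chart \<Rightarrow> 'e \<Rightarrow> 'm" where
  "cinv c \<equiv> inv_into (cdom c) (cmap c)"

lemma chart_facts:
  assumes "is_chart c"
  shows chart_open_dom: "open (cdom c)" and chart_open_img: "open (cimg c)"
    and chart_inv_left: "\<And>p. p \<in> cdom c \<Longrightarrow> cinv c (cmap c p) = p"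
    and chart_inv_right: "\<And>x. x \<in> cimg c \<Longrightarrow> cmap c (cinv c x) = x"
    and chart_inv_dom: "\<And>x. x \<in> cimg c \<Longrightarrow> cinv c x \<in> cdom c"
    and chart_img: "\<And>p. p \<in> cdom c \<Longrightarrow> cmap c p \<in> cimg c"
    and chart_continuous: "continuous_on (cdom c) (cmap c)"
    and chart_inv_continuous: "continuous_on (cimg c) (cinv c)"
    and chart_open_image: "\<And>U. open U \<Longrightarrow> U \<subseteq> cdom c \<Longrightarrow> open (cmap c ` U)"
proof -
  have h: "homeomorphism (cdom c) (cimg c) (cmap c) (cinv c)" and o: "open (cdom c)" "open (cimg c)"
    using assms by (auto simp: is_chart_def)
  show "open (cdom c)" "open (cimg c)" by (fact o)+
  show "\<And>p. p \<in> cdom c \<Longrightarrow> cinv c (cmap c p) = p" "\<And>x. x \<in> cimg c \<Longrightarrow> cmap c (cinv c x) = x"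
    "continuous_on (cdom c) (cmap c)" "continuous_on (cimg c) (cinv c)"
    using h by (auto simp: homeomorphism_def)
  show "\<And>x. x \<in> cimg c \<Longrightarrow> cinv c x \<in> cdom c" "\<And>p. p \<in> cdom c \<Longrightarrow> cmap c p \<in> cimg c"
    by (auto simp: cimg_def inv_into_into)
  show "open (cmap c ` U)" if "open U" "U \<subseteq> cdom c" for U
  proof -
    have "openin (top_of_set (cdom c)) U" using that o by (simp add: openin_open_eq)
    then have "openin (top_of_set (cimg c)) (cmap c ` U)"
      by (rule homeomorphism_imp_open_map[OF h])
    then show ?thesis using o(2) openin_open_trans by blast
  qed
qed

lemma chart_cmap_preimage:
  assumes "is_chart c" "open U" shows "open {p \<in> cdom c. cmap c p \<in> U}"
  using continuous_open_preimage[OF chart_continuous[OF assms(1)] chart_open_dom[OF assms(1)] assms(2)]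
  by (simp add: Int_def vimage_def)

locale smooth_manifold =
  fixes A :: "('m::t2_space, 'e::euclidean_space) chart set"
  assumes smooth_structure: "smooth_structure A"
begin

lemma chart: "c \<in> A \<Longrightarrow> is_chart c"
  using smooth_structure by (auto simp: smooth_structure_def)

lemma chart_at: obtains c where "c \<in> A" "p \<in> cdom c"
  using smooth_structure unfolding smooth_structure_def by blast

lemma overlap_open: "c \<in> A \<Longrightarrow> d \<in> A \<Longrightarrow> open (overlap c d)"
  unfolding overlap_def by (intro chart_open_image chart open_Int chart_open_dom) auto

lemma transition_smooth: "c \<in> A \<Longrightarrow> d \<in> A \<Longrightarrow> smooth_on (overlap c d) (transition c d)"
  using smooth_structure by (auto simp: smooth_structure_def smoothly_compatible_def)

lemma overlapI: "p \<in> cdom c \<Longrightarrow> p \<in> cdom d \<Longrightarrow> cmap c p \<in> overlap c d"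
  by (simp add: overlap_def)

lemma transition_cmap: "c \<in> A \<Longrightarrow> p \<in> cdom c \<Longrightarrow> transition c d (cmap c p) = cmap d p"
  by (simp add: transition_def chart_inv_left chart)

lemma transition_derivative:
  "c \<in> A \<Longrightarrow> d \<in> A \<Longrightarrow> x \<in> overlap c d \<Longrightarrow>
    (transition c d has_derivative frechet_derivative (transition c d) (at x)) (at x)"
  by (rule smooth_on_has_derivative[OF transition_smooth])

lemma transition_derivative_inverse:
  assumes "c \<in> A" "d \<in> A" "p \<in> cdom c" "p \<in> cdom d"
  shows "frechet_derivative (transition c d) (at (cmap c p))
     (frechet_derivative (transition d c) (at (cmap d p)) w) = w"
proof -
  have o: "cmap d p \<in> overlap d c" "cmap c p \<in> overlap c d" using assms by (auto intro: overlapI)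
  have "((\<lambda>x. transition c d (transition d c x)) has_derivative
      (\<lambda>w. frechet_derivative (transition c d) (at (transition d c (cmap d p)))
     (frechet_derivative (transition d c) (at (cmap d p)) w))) (at (cmap d p))"
    by (rule has_derivative_compose[OF transition_derivative[OF assms(2,1) o(1)]])
      (use transition_derivative[OF assms(1,2) o(2)] transition_cmap[OF assms(2,4)] in simp)
  moreover have "((\<lambda>x. transition c d (transition d c x)) has_derivative (\<lambda>w. w)) (at (cmap d p))"
  proof (rule has_derivative_transform_within_open[OF has_derivative_ident overlap_open[OF assms(2,1)] o(1)])
    fix x assume "x \<in> overlap d c"
    then obtain q where q: "q \<in> cdom d" "q \<in> cdom c" "x = cmap d q" by (auto simp: overlap_def)
    then show "x = transition c d (transition d c x)"
      using assms(1,2) by (simp add: transition_cmap)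
  qed
  ultimately show ?thesis
    using has_derivative_unique transition_cmap[OF assms(2,4)] by metis
qed

end

subsection \<open>Integral curves of a vector field\<close>

locale manifold_with_field = smooth_manifold A for A :: "('m::t2_space, 'e::euclidean_space) chart set" +
  fixes N :: "('m, 'e) vfield"
  assumes smooth_field: "smooth_vector_field A N"
begin

lemma N_transition:
  "c \<in> A \<Longrightarrow> d \<in> A \<Longrightarrow> x \<in> overlap c d \<Longrightarrow>
    N d (transition c d x) = frechet_derivative (transition c d) (at x) (N c x)"
  using smooth_field by (simp add: smooth_vector_field_def vector_components_def)

lemma N_smooth: "c \<in> A \<Longrightarrow> smooth_on (cimg c) (N c)"
  using smooth_field by (simp add: smooth_vector_field_def)

text \<open>
Continuity is part of the definition since a chart yields no information about points where the curve
leaves its domain.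
\<close>

definition integral_curve :: "real set \<Rightarrow> (real \<Rightarrow> 'm) \<Rightarrow> bool" where
  "integral_curve I \<gamma> \<longleftrightarrow> open I \<and> is_interval I \<and> continuous_on I \<gamma> \<and>
     (\<forall>t\<in>I. \<forall>c\<in>A. \<gamma> t \<in> cdom c \<longrightarrow> (cmap c \<circ> \<gamma> has_vector_derivative N c (cmap c (\<gamma> t))) (at t))"

lemma eventually_in_open:
  assumes "open I" "continuous_on I \<gamma>" "t \<in> I" "open U" "\<gamma> t \<in> U"
  shows "\<exists>T. open T \<and> t \<in> T \<and> T \<subseteq> I \<and> (\<forall>s\<in>T. \<gamma> s \<in> U)"
proof -
  have "open (I \<inter> \<gamma> -` U)" by (rule continuous_open_preimage[OF assms(2,1,4)])
  then show ?thesis using assms by (intro exI[of _ "I \<inter> \<gamma> -` U"]) auto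
qed

lemma velocity_in_other_chart:
  assumes I: "open I" "continuous_on I \<gamma>" "t \<in> I" and c: "c \<in> A" "\<gamma> t \<in> cdom c" and d: "d \<in> A" "\<gamma> t \<in> cdom d"
    and der: "(cmap c \<circ> \<gamma> has_vector_derivative N c (cmap c (\<gamma> t))) (at t)"
  shows "(cmap d \<circ> \<gamma> has_vector_derivative N d (cmap d (\<gamma> t))) (at t)"
proof -
  obtain T where T: "open T" "t \<in> T" "\<And>s. s \<in> T \<Longrightarrow> \<gamma> s \<in> cdom c"
    using eventually_in_open[OF I chart_open_dom[OF chart[OF c(1)]] c(2)] by blast
  have o: "cmap c (\<gamma> t) \<in> overlap c d" using c d by (auto intro: overlapI)
  have lin: "linear (frechet_derivative (transition c d) (at (cmap c (\<gamma> t))))"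
    by (rule has_derivative_linear[OF transition_derivative[OF c(1) d(1) o]])
  have "((\<lambda>s. transition c d ((cmap c \<circ> \<gamma>) s)) has_derivative
     (\<lambda>h. frechet_derivative (transition c d) (at (cmap c (\<gamma> t))) (h *\<^sub>R N c (cmap c (\<gamma> t))))) (at t)"
    by (rule has_derivative_compose[OF der[unfolded has_vector_derivative_def]])
      (use transition_derivative[OF c(1) d(1) o] in simp)
  then have "((\<lambda>s. transition c d ((cmap c \<circ> \<gamma>) s)) has_derivative
     (\<lambda>h. h *\<^sub>R N d (cmap d (\<gamma> t)))) (at t)"
    using N_transition[OF c(1) d(1) o] by (simp add: linear_scale[OF lin] transition_cmap c)
  then have "((cmap d \<circ> \<gamma>) has_derivative (\<lambda>h. h *\<^sub>R N d (cmap d (\<gamma> t)))) (at t)"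
    by (rule has_derivative_transform_within_open[OF _ T(1,2)]) (simp add: transition_cmap c T)
  then show ?thesis by (simp add: has_vector_derivative_def)
qed

lemma integral_curve_shift:
  assumes "integral_curve I \<gamma>" shows "integral_curve ((\<lambda>s. s - a) -` I) (\<lambda>s. \<gamma> (s - a))"
  unfolding integral_curve_def
proof (intro conjI ballI impI)
  have o: "open I" and i: "is_interval I" and c: "continuous_on I \<gamma>" using assms by (auto simp: integral_curve_def)
  have eq: "(\<lambda>s. s - a) -` I = (\<lambda>s. s + a) ` I" by (force simp: image_iff)
  show "open ((\<lambda>s. s - a) -` I)" using o by (intro open_vimage continuous_intros)
  show "is_interval ((\<lambda>s. s - a) -` I)" using i unfolding is_interval_1 by fastforce
  show "continuous_on ((\<lambda>s. s - a) -` I) (\<lambda>s. \<gamma> (s - a))"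
    by (rule continuous_on_compose2[OF c]) (auto intro: continuous_intros)
  fix t d assume t: "t \<in> (\<lambda>s. s - a) -` I" and d: "d \<in> A" "\<gamma> (t - a) \<in> cdom d"
  then have "(cmap d \<circ> \<gamma> has_vector_derivative N d (cmap d (\<gamma> (t - a)))) (at (t - a))"
    using assms by (auto simp: integral_curve_def)
  moreover have "((\<lambda>s. s - a) has_vector_derivative 1) (at t)"
    by (auto intro!: derivative_eq_intros)
  ultimately have "(cmap d \<circ> \<gamma> \<circ> (\<lambda>s. s - a) has_vector_derivative 1 *\<^sub>R N d (cmap d (\<gamma> (t - a)))) (at t)"
    by (intro vector_diff_chain_at) auto
  then show "(cmap d \<circ> (\<lambda>s. \<gamma> (s - a)) has_vector_derivative N d (cmap d (\<gamma> (t - a)))) (at t)"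
    by (simp add: o_def)
qed

lemma integral_curves_agree_near:
  assumes \<gamma>: "integral_curve I \<gamma>" and \<delta>: "integral_curve J \<delta>" and s: "s \<in> I" "s \<in> J" "\<gamma> s = \<delta> s"
  shows "\<exists>e>0. \<forall>t. \<bar>t - s\<bar> < e \<longrightarrow> \<gamma> t = \<delta> t"
proof -
  obtain c where c: "c \<in> A" "\<gamma> s \<in> cdom c" by (rule chart_at)
  note ch = chart[OF c(1)]
  obtain r where r: "r > 0" "cball (cmap c (\<gamma> s)) r \<subseteq> cimg c"
    using chart_open_img[OF ch] chart_img[OF ch c(2)] open_contains_cball by blast
  obtain L where L: "L \<ge> 0" "\<And>y z. y \<in> cball (cmap c (\<gamma> s)) r \<Longrightarrow> z \<in> cball (cmap c (\<gamma> s)) r \<Longrightarrow>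
      norm (N c y - N c z) \<le> L * norm (y - z)"
    using smooth_on_lipschitz_cball[OF N_smooth[OF c(1)] r(2)] by blast
  let ?U = "{p \<in> cdom c. cmap c p \<in> ball (cmap c (\<gamma> s)) r}"
  have U: "open ?U" "\<gamma> s \<in> ?U"
    by (rule chart_cmap_preimage[OF ch open_ball]) (use c(2) r(1) in simp)
  obtain T1 where T1: "open T1" "s \<in> T1" "T1 \<subseteq> I" "\<And>t. t \<in> T1 \<Longrightarrow> \<gamma> t \<in> ?U"
    using eventually_in_open[of I \<gamma> s ?U] \<gamma> s U unfolding integral_curve_def by blast
  obtain T2 where T2: "open T2" "s \<in> T2" "T2 \<subseteq> J" "\<And>t. t \<in> T2 \<Longrightarrow> \<delta> t \<in> ?U"
    using eventually_in_open[of J \<delta> s ?U] \<delta> s U unfolding integral_curve_def by metis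
  obtain e where e: "e > 0" "ball s e \<subseteq> T1 \<inter> T2"
    using T1(1,2) T2(1,2) open_contains_ball[of "T1 \<inter> T2"] by blast
  then have in12: "t \<in> T1" "t \<in> T2" if "\<bar>t - s\<bar> < e" for t
    using that by (auto simp: subset_eq dist_real_def abs_minus_commute)
  have "\<exists>\<delta>'>0. \<forall>t. \<bar>t - s\<bar> < \<delta>' \<longrightarrow> (\<forall>i\<in>{()}. cmap c (\<gamma> t) - cmap c (\<delta> t) = 0)"
  proof (rule linear_system_vanishes[where C = L and \<epsilon> = e and
      d' = "\<lambda>_ t. N c (cmap c (\<gamma> t)) - N c (cmap c (\<delta> t))"])
    fix t assume t: "\<bar>t - s\<bar> < e"
    have "(cmap c \<circ> \<gamma> has_vector_derivative N c (cmap c (\<gamma> t))) (at t)"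
      "(cmap c \<circ> \<delta> has_vector_derivative N c (cmap c (\<delta> t))) (at t)"
      using \<gamma> \<delta> T1(3,4) T2(3,4) in12[OF t] c(1) unfolding integral_curve_def by blast+
    from has_vector_derivative_diff[OF this]
    show "((\<lambda>t. cmap c (\<gamma> t) - cmap c (\<delta> t)) has_vector_derivative N c (cmap c (\<gamma> t)) - N c (cmap c (\<delta> t))) (at t)"
      by (simp add: o_def)
    show "norm (N c (cmap c (\<gamma> t)) - N c (cmap c (\<delta> t))) \<le> L * (\<Sum>j\<in>{()}. norm (cmap c (\<gamma> t) - cmap c (\<delta> t)))"
      using L(2)[of "cmap c (\<gamma> t)" "cmap c (\<delta> t)"] T1(4)[OF in12(1)[OF t]] T2(4)[OF in12(2)[OF t]]
      by (auto simp: less_imp_le)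
  qed (use e L s in auto)
  then obtain e' where e': "e' > 0" "\<forall>t. \<bar>t - s\<bar> < e' \<longrightarrow> (\<forall>i\<in>{()}. cmap c (\<gamma> t) - cmap c (\<delta> t) = 0)"
    by blast
  have "\<gamma> t = \<delta> t" if "\<bar>t - s\<bar> < min e e'" for t
  proof -
    have t: "\<bar>t - s\<bar> < e" "\<bar>t - s\<bar> < e'" using that by simp_all
    have "\<gamma> t = cinv c (cmap c (\<gamma> t))"
      using T1(4)[OF in12(1)[OF t(1)]] by (simp add: chart_inv_left[OF ch])
    also have "cmap c (\<gamma> t) = cmap c (\<delta> t)" using e'(2) t(2) by simp
    also have "cinv c \<dots> = \<delta> t"
      using T2(4)[OF in12(2)[OF t(1)]] by (simp add: chart_inv_left[OF ch])
    finally show ?thesis .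
  qed
  with e e' show ?thesis by (intro exI[of _ "min e e'"]) auto
qed

text \<open>
The set of times at which the curves agree is open by local uniqueness, and closed because the manifold
is Hausdorff.
\<close>

lemma integral_curve_unique:
  assumes \<gamma>: "integral_curve I \<gamma>" and \<delta>: "integral_curve J \<delta>" and s: "s \<in> I" "s \<in> J" "\<gamma> s = \<delta> s"
    and t: "t \<in> I" "t \<in> J"
  shows "\<gamma> t = \<delta> t"
proof -
  have o: "open (I \<inter> J)" and "is_interval (I \<inter> J)"
    and cont: "continuous_on (I \<inter> J) \<gamma>" "continuous_on (I \<inter> J) \<delta>"
    using \<gamma> \<delta> by (auto simp: integral_curve_def is_interval_Int intro: continuous_on_subset)
  then have conn: "connected (I \<inter> J)" by (simp add: is_interval_connected)
  show ?thesis
  proof (rule connected_induction_simple[OF conn, of s t "\<lambda>t. \<gamma> t = \<delta> t"])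
    fix a assume a: "a \<in> I \<inter> J"
    show "\<exists>T. openin (top_of_set (I \<inter> J)) T \<and> a \<in> T \<and> (\<forall>x\<in>T. \<forall>y\<in>T. \<gamma> x = \<delta> x \<longrightarrow> \<gamma> y = \<delta> y)"
    proof (cases "\<gamma> a = \<delta> a")
      case True
      then obtain e where e: "e > 0" "\<And>t. \<bar>t - a\<bar> < e \<Longrightarrow> \<gamma> t = \<delta> t"
        using integral_curves_agree_near[OF \<gamma> \<delta>, of a] a by blast
      have eq: "\<gamma> t = \<delta> t" if "t \<in> ball a e" for t
        by (rule e(2)) (use that in \<open>simp add: dist_real_def abs_minus_commute\<close>)
      have T: "openin (top_of_set (I \<inter> J)) (I \<inter> J \<inter> ball a e)" "a \<in> I \<inter> J \<inter> ball a e"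
        using a e(1) by (auto intro: openin_open_Int)
      have "\<forall>x\<in>I \<inter> J \<inter> ball a e. \<forall>y\<in>I \<inter> J \<inter> ball a e. \<gamma> x = \<delta> x \<longrightarrow> \<gamma> y = \<delta> y"
        by (intro ballI impI eq) (rule IntD2)
      with T show ?thesis by (intro exI[of _ "I \<inter> J \<inter> ball a e"] conjI)
    next
      case False
      obtain U V where UV: "open U" "open V" "\<gamma> a \<in> U" "\<delta> a \<in> V" "U \<inter> V = {}"
        using hausdorff[OF False] by (elim exE conjE)
      obtain T1 where T1: "open T1" "a \<in> T1" "T1 \<subseteq> I \<inter> J" "\<And>t. t \<in> T1 \<Longrightarrow> \<gamma> t \<in> U"
        using eventually_in_open[OF o cont(1) a UV(1,3)] by (elim exE conjE) blast
      obtain T2 where T2: "open T2" "a \<in> T2" "T2 \<subseteq> I \<inter> J" "\<And>t. t \<in> T2 \<Longrightarrow> \<delta> t \<in> V"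
        using eventually_in_open[OF o cont(2) a UV(2,4)] by (elim exE conjE) blast
      have T: "openin (top_of_set (I \<inter> J)) (T1 \<inter> T2)" "a \<in> T1 \<inter> T2"
        using T1(1-3) T2(1,2) o by (auto simp: openin_open_eq)
      have "\<forall>x\<in>T1 \<inter> T2. \<forall>y\<in>T1 \<inter> T2. \<gamma> x = \<delta> x \<longrightarrow> \<gamma> y = \<delta> y"
        using T1(4) T2(4) UV(5) by (metis IntD1 IntD2 disjoint_iff)
      with T show ?thesis by (intro exI[of _ "T1 \<inter> T2"] conjI)
    qed
  qed (use s t in auto)
qed

lemma integral_curve_from_chart:
  assumes c: "c \<in> A" and I: "open I" "is_interval I"
    and u: "\<And>t. t \<in> I \<Longrightarrow> u t \<in> cimg c" "\<And>t. t \<in> I \<Longrightarrow> (u has_vector_derivative N c (u t)) (at t)"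
  shows "integral_curve I (cinv c \<circ> u)"
  unfolding integral_curve_def
proof (intro conjI ballI impI)
  note ch = chart[OF c]
  have "continuous_on I u"
    using u(2) by (meson continuous_at_imp_continuous_on has_vector_derivative_continuous)
  then show cont: "continuous_on I (cinv c \<circ> u)"
    by (rule continuous_on_compose) (use u(1) chart_inv_continuous[OF ch] in \<open>auto intro: continuous_on_subset\<close>)
  fix t d assume t: "t \<in> I" and d: "d \<in> A" "(cinv c \<circ> u) t \<in> cdom d"
  show "(cmap d \<circ> (cinv c \<circ> u) has_vector_derivative N d (cmap d ((cinv c \<circ> u) t))) (at t)"
  proof (rule velocity_in_other_chart[OF I(1) cont t c _ d])
    show "(cinv c \<circ> u) t \<in> cdom c" using u(1)[OF t] by (simp add: chart_inv_dom[OF ch])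
    have "(cmap c \<circ> (cinv c \<circ> u) has_vector_derivative N c (u t)) (at t)"
      by (rule has_vector_derivative_transform_within_open[OF u(2)[OF t] I(1) t])
        (use u(1) chart_inv_right[OF ch] in simp)
    then show "(cmap c \<circ> (cinv c \<circ> u) has_vector_derivative N c (cmap c ((cinv c \<circ> u) t))) (at t)"
      using u(1)[OF t] chart_inv_right[OF ch] by simp
  qed
qed (use I in auto)

text \<open>
The lifetime \<open>\<epsilon>\<close> depends only on a Lipschitz constant and a speed bound for \<open>N\<close> on a ball, hence is common to all
initial points in the ball of half the radius; \<open>short_time_bound\<close> controls the dependence on the initial point.
\<close>

lemma flow_box:
  assumes c: "c \<in> A" and p: "p \<in> cdom c" and U: "open U" "cmap c p \<in> U"
  shows "\<exists>W \<epsilon> \<Phi>. open W \<and> p \<in> W \<and> W \<subseteq> cdom c \<and> \<epsilon> > 0 \<and>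
     (\<forall>q\<in>W. integral_curve {-\<epsilon><..<\<epsilon>} (\<Phi> q) \<and> \<Phi> q 0 = q \<and>
        (\<forall>s\<in>{-\<epsilon><..<\<epsilon>}. \<Phi> q s \<in> cdom c \<and> cmap c (\<Phi> q s) \<in> U)) \<and>
     (\<forall>s\<in>{-\<epsilon><..<\<epsilon>}. continuous_on W (\<lambda>q. \<Phi> q s))"
proof -
  note ch = chart[OF c]
  define x where "x = cmap c p"
  have "open (U \<inter> cimg c)" "x \<in> U \<inter> cimg c"
    using U chart_open_img[OF ch] chart_img[OF ch p] by (auto simp: x_def)
  then obtain r where r: "r > 0" "cball x r \<subseteq> U \<inter> cimg c" using open_contains_cball by blast
  obtain L where L: "L \<ge> 0" "\<And>y z. y \<in> cball x r \<Longrightarrow> z \<in> cball x r \<Longrightarrow>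
      norm (N c y - N c z) \<le> L * norm (y - z)"
    using smooth_on_lipschitz_cball[OF N_smooth[OF c], of x r] r(2) by auto
  define M where "M = norm (N c x) + L * r"
  have M: "norm (N c y) \<le> M" if "y \<in> cball x r" for y
  proof -
    have "norm (N c y - N c x) \<le> L * norm (y - x)" using L(2)[OF that] r(1) by simp
    also have "\<dots> \<le> L * r" using that L(1) by (intro mult_left_mono) (auto simp: dist_norm norm_minus_commute)
    finally show ?thesis unfolding M_def using norm_triangle_sub[of "N c y" "N c x"] by simp
  qed
  have "M \<ge> 0" unfolding M_def using L(1) r(1) by simp
  \<comment> \<open>the first bound makes the Picard operator contract and the dependence on \<open>q\<close> Lipschitz, the second keeps curves in the ball\<close>
  define \<epsilon> where "\<epsilon> = min (1 / (4 * (L + 1))) (r / (2 * (M + 1)))"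
  have \<epsilon>: "\<epsilon> > 0" using L(1) \<open>M \<ge> 0\<close> r(1) by (simp add: \<epsilon>_def)
  have "\<epsilon> * L \<le> (1 / (4 * (L + 1))) * (L + 1)" using L(1) \<epsilon> by (intro mult_mono) (auto simp: \<epsilon>_def)
  also have "\<dots> = 1/4" using L(1) by (simp add: field_simps)
  finally have \<epsilon>L: "\<epsilon> * L \<le> 1/4" .
  have "\<epsilon> * M \<le> (r / (2 * (M + 1))) * (M + 1)" using \<open>M \<ge> 0\<close> \<epsilon> r(1) by (intro mult_mono) (auto simp: \<epsilon>_def)
  also have "\<dots> = r/2" using \<open>M \<ge> 0\<close> by (simp add: field_simps)
  finally have \<epsilon>M: "\<epsilon> * M \<le> r/2" .
  define W where "W = {q \<in> cdom c. cmap c q \<in> ball x (r/2)}"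
  have W: "open W" "p \<in> W" "W \<subseteq> cdom c"
    unfolding W_def by (rule chart_cmap_preimage[OF ch open_ball]) (use p r(1) in \<open>auto simp: x_def\<close>)
  have "\<forall>q\<in>W. \<exists>u. u 0 = cmap c q \<and> (\<forall>t\<in>{-\<epsilon>..\<epsilon>}. u t \<in> cball x r \<and>
               (u has_vector_derivative N c (u t)) (at t within {-\<epsilon>..\<epsilon>}))"
    using \<epsilon>L by (intro ballI picard_local[OF L(2) M L(1) \<epsilon> _ \<epsilon>M r(1)]) (auto simp: W_def)
  then obtain u where u: "\<And>q. q \<in> W \<Longrightarrow> u q 0 = cmap c q"
     "\<And>q t. q \<in> W \<Longrightarrow> t \<in> {-\<epsilon>..\<epsilon>} \<Longrightarrow> u q t \<in> cball x r"
     "\<And>q t. q \<in> W \<Longrightarrow> t \<in> {-\<epsilon>..\<epsilon>} \<Longrightarrow> (u q has_vector_derivative N c (u q t)) (at t within {-\<epsilon>..\<epsilon>})"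
    by metis
  define \<Phi> where "\<Phi> q = cinv c \<circ> u q" for q
  have u_in: "u q s \<in> cimg c" "u q s \<in> U" if "q \<in> W" "s \<in> {-\<epsilon><..<\<epsilon>}" for q s
    using u(2)[of q s] that r(2) by auto
  have "integral_curve {-\<epsilon><..<\<epsilon>} (\<Phi> q)" if "q \<in> W" for q
    unfolding \<Phi>_def
  proof (rule integral_curve_from_chart[OF c])
    fix t assume t: "t \<in> {-\<epsilon><..<\<epsilon>}"
    show "u q t \<in> cimg c" by (rule u_in[OF that t])
    have "(u q has_vector_derivative N c (u q t)) (at t within {-\<epsilon><..<\<epsilon>})"
      by (rule has_vector_derivative_within_subset[OF u(3)[OF that]]) (use t in auto)
    then show "(u q has_vector_derivative N c (u q t)) (at t)"
      unfolding at_within_open[OF t open_greaterThanLessThan] .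
  qed (simp_all add: is_interval_oo)
  moreover have "\<Phi> q 0 = q" if "q \<in> W" for q
  proof -
    have "q \<in> cdom c" using that W(3) by blast
    then show ?thesis by (simp add: \<Phi>_def u(1)[OF that] chart_inv_left[OF ch])
  qed
  moreover have "\<Phi> q s \<in> cdom c \<and> cmap c (\<Phi> q s) \<in> U" if "q \<in> W" "s \<in> {-\<epsilon><..<\<epsilon>}" for q s
    using u_in[OF that] chart_inv_dom[OF ch] chart_inv_right[OF ch] by (simp add: \<Phi>_def)
  moreover have "continuous_on W (\<lambda>q. \<Phi> q s)" if s: "s \<in> {-\<epsilon><..<\<epsilon>}" for s
  proof -
    have lip: "norm (u q s - u q' s) \<le> 2 * norm (cmap c q - cmap c q')" if q: "q \<in> W" "q' \<in> W" for q q'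
    proof -
      have "norm (u q s - u q' s) \<le> 2 * norm (u q 0 - u q' 0)"
      proof (rule short_time_bound[of "-\<epsilon>" \<epsilon> "\<lambda>t. u q t - u q' t" "\<lambda>t. N c (u q t) - N c (u q' t)" L 0 s])
        fix t assume t: "t \<in> {-\<epsilon>..\<epsilon>}"
        show "((\<lambda>t. u q t - u q' t) has_vector_derivative N c (u q t) - N c (u q' t)) (at t within {-\<epsilon>..\<epsilon>})"
          by (intro has_vector_derivative_diff u(3) q t)
        show "norm (N c (u q t) - N c (u q' t)) \<le> L * norm (u q t - u q' t)"
          by (intro L(2) u(2) q t)
      next
        show "L * (\<epsilon> - - \<epsilon>) \<le> 1/2" using \<epsilon>L by (simp add: algebra_simps)
      qed (use L(1) \<epsilon> s in auto)
      then show ?thesis using u(1) q by simp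
    qed
    have "continuous_on W (\<lambda>q. u q s)"
      unfolding continuous_on_def
    proof
      fix q assume q: "q \<in> W"
      have "continuous_on W (cmap c)" using continuous_on_subset[OF chart_continuous[OF ch] W(3)] .
      then have "((\<lambda>q'. cmap c q' - cmap c q) \<longlongrightarrow> 0) (at q within W)"
        using q by (simp add: continuous_on_def LIM_zero)
      then have "((\<lambda>q'. 2 * norm (cmap c q' - cmap c q)) \<longlongrightarrow> 0) (at q within W)"
        by (intro tendsto_mult_right_zero tendsto_norm_zero)
      then have "((\<lambda>q'. u q' s - u q s) \<longlongrightarrow> 0) (at q within W)"
        by (rule Lim_null_comparison[rotated])
          (use lip[OF _ q] in \<open>auto simp: eventually_at_topological\<close>)
      then show "((\<lambda>q'. u q' s) \<longlongrightarrow> u q s) (at q within W)" by (simp add: LIM_zero_iff)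
    qed
    then show ?thesis unfolding \<Phi>_def o_def
      by (rule continuous_on_compose2[OF chart_inv_continuous[OF ch]]) (use u_in s in auto)
  qed
  ultimately show ?thesis using W \<epsilon> by (intro exI[of _ W] exI[of _ \<epsilon>] exI[of _ \<Phi>]) auto
qed

subsection \<open>Maximal integral curves\<close>

lemma integral_curve_local:
  assumes "is_interval I"
    and loc: "\<And>t. t \<in> I \<Longrightarrow> \<exists>J \<gamma>'. integral_curve J \<gamma>' \<and> t \<in> J \<and> J \<subseteq> I \<and> (\<forall>s\<in>J. \<gamma> s = \<gamma>' s)"
  shows "integral_curve I \<gamma>"
proof -
  have main: "(\<exists>J. open J \<and> t \<in> J \<and> J \<subseteq> I) \<and> isCont \<gamma> t \<and>
     (\<forall>c\<in>A. \<gamma> t \<in> cdom c \<longrightarrow> (cmap c \<circ> \<gamma> has_vector_derivative N c (cmap c (\<gamma> t))) (at t))" if "t \<in> I" for t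
  proof -
    obtain J \<gamma>' where J: "integral_curve J \<gamma>'" "t \<in> J" "J \<subseteq> I" "\<And>s. s \<in> J \<Longrightarrow> \<gamma> s = \<gamma>' s"
      using loc[OF \<open>t \<in> I\<close>] by blast
    have o: "open J" "continuous_on J \<gamma>'" using J(1) by (auto simp: integral_curve_def)
    have "continuous_on J \<gamma>" by (rule continuous_on_eq[OF o(2)]) (simp add: J(4))
    then have "isCont \<gamma> t" using o(1) J(2) by (simp add: continuous_on_eq_continuous_at)
    moreover have "(cmap c \<circ> \<gamma> has_vector_derivative N c (cmap c (\<gamma> t))) (at t)" if "c \<in> A" "\<gamma> t \<in> cdom c" for c
    proof -
      have "(cmap c \<circ> \<gamma>' has_vector_derivative N c (cmap c (\<gamma>' t))) (at t)"
        using J(1,2) J(4)[OF J(2)] that by (auto simp: integral_curve_def)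
      then have "(cmap c \<circ> \<gamma> has_vector_derivative N c (cmap c (\<gamma>' t))) (at t)"
        by (rule has_vector_derivative_transform_within_open[OF _ o(1) J(2)]) (simp add: J(4))
      then show ?thesis using J(4)[OF J(2)] by simp
    qed
    ultimately show ?thesis using o(1) J(2,3) by blast
  qed
  have "open I" using main by (subst open_subopen) blast
  moreover have "continuous_on I \<gamma>" using main by (intro continuous_at_imp_continuous_on) simp
  ultimately show ?thesis using assms(1) main by (simp add: integral_curve_def)
qed

definition lifetime :: "'m \<Rightarrow> real set" where
  "lifetime p = \<Union> {I. \<exists>\<gamma>. integral_curve I \<gamma> \<and> 0 \<in> I \<and> \<gamma> 0 = p}"

text \<open>
Meaningful only for \<open>t\<close> in \<open>lifetime p\<close>. By uniqueness all integral curves from \<open>p\<close> agree, so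
no maximal curve has to be chosen.
\<close>

definition flow :: "real \<Rightarrow> 'm \<Rightarrow> 'm" where
  "flow t p = (THE q. \<exists>I \<gamma>. integral_curve I \<gamma> \<and> 0 \<in> I \<and> \<gamma> 0 = p \<and> t \<in> I \<and> q = \<gamma> t)"

lemma flow_eq:
  assumes "integral_curve I \<gamma>" "0 \<in> I" "\<gamma> 0 = p" "t \<in> I"
  shows "flow t p = \<gamma> t"
  unfolding flow_def
proof (rule the_equality)
  show "\<exists>I \<gamma>'. integral_curve I \<gamma>' \<and> 0 \<in> I \<and> \<gamma>' 0 = p \<and> t \<in> I \<and> \<gamma> t = \<gamma>' t"
    using assms by blast
next
  fix q assume "\<exists>I \<gamma>. integral_curve I \<gamma> \<and> 0 \<in> I \<and> \<gamma> 0 = p \<and> t \<in> I \<and> q = \<gamma> t"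
  then obtain J \<delta> where \<delta>: "integral_curve J \<delta>" "0 \<in> J" "\<delta> 0 = p" "t \<in> J" "q = \<delta> t" by blast
  show "q = \<gamma> t"
    unfolding \<delta>(5) by (rule integral_curve_unique[OF \<delta>(1) assms(1) \<delta>(2) assms(2) _ \<delta>(4) assms(4)])
      (simp add: \<delta>(3) assms(3))
qed

lemma lifetime_superset: "integral_curve I \<gamma> \<Longrightarrow> 0 \<in> I \<Longrightarrow> \<gamma> 0 = p \<Longrightarrow> I \<subseteq> lifetime p"
  unfolding lifetime_def by blast

lemma zero_in_lifetime: "0 \<in> lifetime p" and flow_zero: "flow 0 p = p"
proof -
  obtain c where c: "c \<in> A" "p \<in> cdom c" by (rule chart_at)
  obtain \<epsilon> \<Phi> where "(\<epsilon>::real) > 0" "integral_curve {-\<epsilon><..<\<epsilon>} (\<Phi> p)" "\<Phi> p 0 = p"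
    using flow_box[OF c open_UNIV UNIV_I] by metis
  then show "0 \<in> lifetime p" "flow 0 p = p"
    using lifetime_superset[of "{-\<epsilon><..<\<epsilon>}" "\<Phi> p" p] flow_eq[of "{-\<epsilon><..<\<epsilon>}" "\<Phi> p" p 0] by auto
qed

lemma flow_integral_curve: "integral_curve (lifetime p) (\<lambda>t. flow t p)"
proof (rule integral_curve_local)
  have "connected (lifetime p)"
    unfolding lifetime_def
    by (rule connected_Union) (auto simp: integral_curve_def is_interval_connected)
  then show "is_interval (lifetime p)" by (simp add: is_interval_connected_1)
  fix t assume "t \<in> lifetime p"
  then obtain I \<gamma> where I: "integral_curve I \<gamma>" "0 \<in> I" "\<gamma> 0 = p" "t \<in> I" unfolding lifetime_def by blast
  have "\<forall>s\<in>I. flow s p = \<gamma> s" using flow_eq[OF I(1-3)] by simp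
  with I(1,4) lifetime_superset[OF I(1-3)] show "\<exists>J \<gamma>'. integral_curve J \<gamma>' \<and> t \<in> J \<and> J \<subseteq> lifetime p \<and> (\<forall>s\<in>J. flow s p = \<gamma>' s)"
    by (intro exI[of _ I] exI[of _ \<gamma>] conjI)
qed

lemma integral_curve_glue:
  assumes \<gamma>: "integral_curve I \<gamma>" and \<delta>: "integral_curve J \<delta>" and s: "s \<in> I" "s \<in> J" "\<gamma> s = \<delta> s"
  shows "integral_curve (I \<union> J) (\<lambda>t. if t \<in> I then \<gamma> t else \<delta> t)"
proof (rule integral_curve_local)
  have "connected (I \<union> J)" using \<gamma> \<delta> s by (intro connected_Un) (auto simp: integral_curve_def is_interval_connected)
  then show "is_interval (I \<union> J)" by (simp add: is_interval_connected_1)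
  fix t assume "t \<in> I \<union> J"
  then consider "t \<in> I" | "t \<in> J" by blast
  then show "\<exists>K \<gamma>'. integral_curve K \<gamma>' \<and> t \<in> K \<and> K \<subseteq> I \<union> J \<and> (\<forall>s\<in>K. (if s \<in> I then \<gamma> s else \<delta> s) = \<gamma>' s)"
  proof cases
    case 1
    then show ?thesis using \<gamma> by (intro exI[of _ I] exI[of _ \<gamma>]) auto
  next
    case 2
    have "\<gamma> r = \<delta> r" if "r \<in> I" "r \<in> J" for r by (rule integral_curve_unique[OF \<gamma> \<delta> s that])
    then show ?thesis using \<delta> 2 by (intro exI[of _ J] exI[of _ \<delta>]) simp
  qed
qed

text \<open>
If the trajectory had a limit at an end of its lifetime, then the flow box at the limit point would
continue it from a time shortly before, because lifetimes are bounded below near that point. Only continuity of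
the extension matters, so this applies to extensions as geodesics.
\<close>

lemma lifetime_maximal:
  assumes J: "open J" "is_interval J" "continuous_on J \<delta>" "lifetime p \<subseteq> J"
    and \<delta>: "\<And>t. t \<in> lifetime p \<Longrightarrow> \<delta> t = flow t p"
  shows "J = lifetime p"
proof (rule ccontr)
  assume "J \<noteq> lifetime p"
  note fl = flow_integral_curve[of p]
  have oI: "open (lifetime p)" using fl by (simp add: integral_curve_def)
  \<comment> \<open>otherwise the lifetime would be open and closed in the interval \<open>J\<close>\<close>
  have "\<exists>b\<in>J. b \<in> closure (lifetime p) \<and> b \<notin> lifetime p"
  proof (rule ccontr)
    assume "\<not> ?thesis"
    then have eq: "lifetime p = J \<inter> closure (lifetime p)" using J(4) closure_subset by blast
    have "openin (top_of_set J) (lifetime p)" using oI J(1,4) by (simp add: openin_open_eq)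
    moreover have "closedin (top_of_set J) (lifetime p)" by (subst eq) (simp add: closedin_closed_Int)
    ultimately have "lifetime p = {} \<or> lifetime p = J"
      using is_interval_connected[OF J(2)] by (auto simp: connected_clopen)
    then show False using zero_in_lifetime[of p] \<open>J \<noteq> lifetime p\<close> by blast
  qed
  then obtain b where b: "b \<in> J" "b \<in> closure (lifetime p)" "b \<notin> lifetime p" by blast
  obtain c where c: "c \<in> A" "\<delta> b \<in> cdom c" by (rule chart_at)
  obtain W \<epsilon> \<Phi> where W: "open W" "\<delta> b \<in> W" "(\<epsilon>::real) > 0"
    "\<And>q. q \<in> W \<Longrightarrow> integral_curve {-\<epsilon><..<\<epsilon>} (\<Phi> q)" "\<And>q. q \<in> W \<Longrightarrow> \<Phi> q 0 = q"
    using flow_box[OF c open_UNIV UNIV_I] by metis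
  obtain T where T: "open T" "b \<in> T" "T \<subseteq> J" "\<And>s. s \<in> T \<Longrightarrow> \<delta> s \<in> W"
    using eventually_in_open[OF J(1,3) b(1) W(1,2)] by blast
  have "open (T \<inter> ball b \<epsilon>)" "b \<in> T \<inter> ball b \<epsilon>" using T W(3) by auto
  then have "(T \<inter> ball b \<epsilon>) \<inter> lifetime p \<noteq> {}"
    using b(2) open_Int_closure_eq_empty by blast
  then obtain t where t: "t \<in> T" "dist b t < \<epsilon>" "t \<in> lifetime p" by auto
  have "flow t p \<in> W" using T(4)[OF t(1)] \<delta>[OF t(3)] by simp
  then have "integral_curve ((\<lambda>s. s - t) -` {-\<epsilon><..<\<epsilon>}) (\<lambda>s. \<Phi> (flow t p) (s - t))"
    "\<Phi> (flow t p) (t - t) = flow t p"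
    using integral_curve_shift W(4,5) by auto
  from integral_curve_glue[OF fl this(1) t(3) _ this(2)[symmetric]]
  have glued: "integral_curve (lifetime p \<union> (\<lambda>s. s - t) -` {-\<epsilon><..<\<epsilon>})
      (\<lambda>s. if s \<in> lifetime p then flow s p else \<Phi> (flow t p) (s - t))" using W(3) by simp
  have "b \<in> (\<lambda>s. s - t) -` {-\<epsilon><..<\<epsilon>}" using t(2) by (auto simp: dist_real_def)
  then have "b \<in> lifetime p"
    using lifetime_superset[OF glued, of p] zero_in_lifetime[of p] flow_zero[of p] by auto
  then show False using b(3) by simp
qed

end

subsection \<open>Complete fields\<close>

locale complete_field = manifold_with_field A N for A :: "('m::t2_space, 'e::euclidean_space) chart set" and N +
  assumes lifetime_UNIV: "lifetime p = UNIV"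
begin

lemma flow_curve: "integral_curve UNIV (\<lambda>t. flow t p)"
  using flow_integral_curve[of p] by (simp add: lifetime_UNIV)

lemma flow_add: "flow (s + t) p = flow t (flow s p)"
proof -
  have "integral_curve UNIV (\<lambda>r. flow (r + s) p)"
    using integral_curve_shift[OF flow_curve[of p], of "- s"] by simp
  from flow_eq[OF this UNIV_I _ UNIV_I, of "flow s p" t] show ?thesis by (simp add: add.commute)
qed

lemma flow_inverse: "flow (- t) (flow t p) = p" "flow t (flow (- t) p) = p"
  using flow_add[of t "-t" p] flow_add[of "-t" t p] by (simp_all add: flow_zero)

lemma flow_continuous_time: "continuous_on X (\<lambda>t. flow t p)"
  using flow_curve[of p] continuous_on_subset by (auto simp: integral_curve_def)

lemma flow_velocity: "c \<in> A \<Longrightarrow> flow t p \<in> cdom c \<Longrightarrow>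
    ((\<lambda>t. cmap c (flow t p)) has_vector_derivative N c (cmap c (flow t p))) (at t)"
  using flow_curve[of p] by (auto simp: integral_curve_def o_def)

lemma flow_box_complete:
  assumes "c \<in> A" "p \<in> cdom c" "open U" "cmap c p \<in> U"
  obtains W \<epsilon> where "open W" "p \<in> W" "W \<subseteq> cdom c" "\<epsilon> > 0"
     "\<And>q s. q \<in> W \<Longrightarrow> \<bar>s\<bar> < \<epsilon> \<Longrightarrow> flow s q \<in> cdom c \<and> cmap c (flow s q) \<in> U"
     "\<And>s. \<bar>s\<bar> < \<epsilon> \<Longrightarrow> continuous_on W (flow s)"
proof -
  obtain W \<epsilon> \<Phi> where box: "open W \<and> p \<in> W \<and> W \<subseteq> cdom c \<and> \<epsilon> > 0 \<and>
     (\<forall>q\<in>W. integral_curve {-\<epsilon><..<\<epsilon>} (\<Phi> q) \<and> \<Phi> q 0 = q \<and>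
        (\<forall>s\<in>{-\<epsilon><..<\<epsilon>}. \<Phi> q s \<in> cdom c \<and> cmap c (\<Phi> q s) \<in> U)) \<and>
     (\<forall>s\<in>{-\<epsilon><..<\<epsilon>}. continuous_on W (\<lambda>q. \<Phi> q s))"
    using flow_box[OF assms] by (elim exE)
  then have W: "open W" "p \<in> W" "W \<subseteq> cdom c" "\<epsilon> > 0"
     "\<And>q. q \<in> W \<Longrightarrow> integral_curve {-\<epsilon><..<\<epsilon>} (\<Phi> q)" "\<And>q. q \<in> W \<Longrightarrow> \<Phi> q 0 = q"
     "\<And>q s. q \<in> W \<Longrightarrow> s \<in> {-\<epsilon><..<\<epsilon>} \<Longrightarrow> \<Phi> q s \<in> cdom c \<and> cmap c (\<Phi> q s) \<in> U"
     "\<And>s. s \<in> {-\<epsilon><..<\<epsilon>} \<Longrightarrow> continuous_on W (\<lambda>q. \<Phi> q s)"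
    by blast+
  have \<Phi>: "flow s q = \<Phi> q s" if "q \<in> W" "\<bar>s\<bar> < \<epsilon>" for q s
    by (rule flow_eq[OF W(5)[OF that(1)] _ W(6)[OF that(1)]]) (use that W(4) in auto)
  show ?thesis
  proof
    show "flow s q \<in> cdom c \<and> cmap c (flow s q) \<in> U" if "q \<in> W" "\<bar>s\<bar> < \<epsilon>" for q s
      unfolding \<Phi>[OF that] by (rule W(7)[OF that(1)]) (use that(2) in auto)
    show "continuous_on W (flow s)" if "\<bar>s\<bar> < \<epsilon>" for s
    proof -
      have "s \<in> {-\<epsilon><..<\<epsilon>}" using that by auto
      from W(8)[OF this] show ?thesis
        by (rule continuous_on_eq) (simp add: \<Phi> that)
    qed
  qed (rule W)+
qed

end

section \<open>Foliations orthogonal to a geodesic field\<close>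

lemma curvature_eq_riemann:
  assumes "bilinear (\<Gamma> c x)"
  shows "curvature \<Gamma> c x u v w = riemann (\<Gamma> c) x u v w"
proof -
  have "\<Gamma> c x 0 w = 0" using assms unfolding bilinear_def by (meson linear_0)
  moreover have "cov \<Gamma> c (\<lambda>_. a) (\<lambda>_. b) = (\<lambda>y. \<Gamma> c y a b)" for a b
    by (simp add: fun_eq_iff cov_def)
  ultimately show ?thesis
    by (simp add: curvature_def curvature_op_def riemann_def cov_def lie_bracket_def)
qed

locale geodesic_foliation =
  fixes A F :: "('m::t2_space, 'v::euclidean_space \<times> real) chart set"
    and g :: "('m, 'v \<times> real) bform"
    and N :: "('m, 'v \<times> real) vfield"
    and \<Gamma> :: "('m, 'v \<times> real) conn"
    and \<kappa> :: real
  assumes atlas: "smooth_structure A"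
    and lorentz: "lorentz_metric A g"
    and lc: "levi_civita A g \<Gamma>"
    and curv: "constant_sectional_curvature A g \<Gamma> \<kappa>"
    and fol: "spacelike_foliation A g F"
    and normal: "unit_timelike_normal A g F N"
    and geod: "geodesic_field A \<Gamma> N"
begin

sublocale manifold_with_field A N
  by unfold_locales (use atlas normal in \<open>auto simp: unit_timelike_normal_def\<close>)

lemma F_chart: "c \<in> F \<Longrightarrow> c \<in> A"
  using fol by (auto simp: spacelike_foliation_def foliation_def)

lemma F_chart_at: obtains c where "c \<in> F" "p \<in> cdom c"
  using fol unfolding spacelike_foliation_def foliation_def by blast

lemma bilinear_metric: "c \<in> A \<Longrightarrow> x \<in> cimg c \<Longrightarrow> bilinear (g c x)"
  and metric_symmetric: "c \<in> A \<Longrightarrow> x \<in> cimg c \<Longrightarrow> g c x u v = g c x v u"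
  and metric_smooth: "c \<in> A \<Longrightarrow> smooth_on (cimg c) (\<lambda>x. g c x u v)"
  and metric_transition: "c \<in> A \<Longrightarrow> d \<in> A \<Longrightarrow> x \<in> overlap c d \<Longrightarrow>
     g d (transition c d x) (frechet_derivative (transition c d) (at x) u)
        (frechet_derivative (transition c d) (at x) v) = g c x u v"
  using lorentz unfolding lorentz_metric_def lorentz_form_def by blast+

lemma bilinear_conn: "c \<in> A \<Longrightarrow> x \<in> cimg c \<Longrightarrow> bilinear (\<Gamma> c x)"
  and conn_smooth: "c \<in> A \<Longrightarrow> smooth_on (cimg c) (\<lambda>x. \<Gamma> c x u v)"
  and conn_transition: "c \<in> A \<Longrightarrow> d \<in> A \<Longrightarrow> x \<in> overlap c d \<Longrightarrow>
     frechet_derivative (\<lambda>y. frechet_derivative (transition c d) (at y) v) (at x) u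
       + \<Gamma> d (transition c d x) (frechet_derivative (transition c d) (at x) u)
           (frechet_derivative (transition c d) (at x) v)
       = frechet_derivative (transition c d) (at x) (\<Gamma> c x u v)"
  using lc unfolding levi_civita_def connection_def Let_def by blast+

lemma foliated_chart_in: assumes c: "c \<in> F" shows "foliated_chart (cimg c) (g c) (N c) (\<Gamma> c) \<kappa>"
proof
  note cA = F_chart[OF c]
  show "open (cimg c)" by (rule chart_open_img[OF chart[OF cA]])
  show "smooth_on (cimg c) (N c)" by (rule N_smooth[OF cA])
  fix u v w
  show "smooth_on (cimg c) (\<lambda>x. \<Gamma> c x u v)" by (rule conn_smooth[OF cA])
  show "smooth_on (cimg c) (\<lambda>x. g c x u v)" by (rule metric_smooth[OF cA])
  fix x assume x: "x \<in> cimg c"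
  show "bilinear (\<Gamma> c x)" "bilinear (g c x)" "g c x u v = g c x v u"
    by (rule bilinear_conn[OF cA x] bilinear_metric[OF cA x] metric_symmetric[OF cA x])+
  have "torsion_free A \<Gamma>" "metric_compatible A g \<Gamma>" using lc by (auto simp: levi_civita_def)
  note tf = this(1)[unfolded torsion_free_def, THEN bspec, OF cA, THEN spec, THEN spec]
    and mc = this(2)[unfolded metric_compatible_def, THEN bspec, OF cA, THEN spec, THEN spec, THEN spec]
  show "\<Gamma> c x u v = \<Gamma> c x v u"
    using tf[of "\<lambda>_. u" "\<lambda>_. v"] x by (simp add: cov_def lie_bracket_def)
  show "frechet_derivative (\<lambda>y. g c y u v) (at x) w = g c x (\<Gamma> c x w u) v + g c x u (\<Gamma> c x w v)"
    using mc[of "\<lambda>_. w" "\<lambda>_. u" "\<lambda>_. v"] x by (simp add: cov_def)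
  show "g c x (N c x) (N c x) = -1" "g c x (N c x) (a, 0) = 0" for a
    using normal c cA x by (auto simp: unit_timelike_normal_def)
  show "g c x (a, 0) (a, 0) > 0" if "a \<noteq> 0" for a
    using fol c x that by (auto simp: spacelike_foliation_def)
  show "nabla (N c) (\<Gamma> c) x (N c x) = 0"
    using geod cA x by (auto simp: geodesic_field_def nabla_def cov_def)
  show "g c x (riemann (\<Gamma> c) x u v v) u = \<kappa> * area_form (g c x) u v" if "area_form (g c x) u v \<noteq> 0"
  proof -
    have "sectional_curvature g \<Gamma> c x u v = \<kappa>"
      using curv cA x that unfolding constant_sectional_curvature_def by blast
    then show ?thesis
      using that by (simp add: sectional_curvature_def curvature_eq_riemann[of \<Gamma> c x, OF bilinear_conn[OF cA x]] divide_eq_eq)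
  qed
qed

subsection \<open>Chart independence of umbilicity\<close>

text \<open>
The inhomogeneous terms in the transformation laws of \<open>DN\<close> and of \<open>\<Gamma>\<close> cancel.
\<close>

lemma nabla_transition:
  assumes c: "c \<in> A" and d: "d \<in> A" and x: "x \<in> overlap c d"
  shows "nabla (N d) (\<Gamma> d) (transition c d x) (frechet_derivative (transition c d) (at x) u)
     = frechet_derivative (transition c d) (at x) (nabla (N c) (\<Gamma> c) x u)"
proof -
  let ?\<tau> = "transition c d"
  let ?D = "\<lambda>y. frechet_derivative ?\<tau> (at y)"
  have o: "open (overlap c d)" by (rule overlap_open[OF c d])
  have lin: "linear (?D y)" if "y \<in> overlap c d" for y
    by (rule has_derivative_linear[OF transition_derivative[OF c d that]])
  have xc: "x \<in> cimg c" and \<tau>x: "?\<tau> x \<in> cimg d"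
  proof -
    obtain p where p: "p \<in> cdom c" "p \<in> cdom d" "x = cmap c p" using x unfolding overlap_def by blast
    then show "x \<in> cimg c" "?\<tau> x \<in> cimg d"
      using chart_img[OF chart[OF c] p(1)] chart_img[OF chart[OF d] p(2)] transition_cmap[OF c p(1), of d] by simp_all
  qed
  have "((\<lambda>y. N d (?\<tau> y)) has_derivative (\<lambda>h. frechet_derivative (N d) (at (?\<tau> x)) (?D x h))) (at x)"
    by (rule has_derivative_compose[OF transition_derivative[OF c d x] smooth_on_has_derivative[OF N_smooth[OF d] \<tau>x]])
  moreover have "((\<lambda>y. N d (?\<tau> y)) has_derivative
     (\<lambda>h. frechet_derivative (\<lambda>y. ?D y (N c x)) (at x) h + ?D x (frechet_derivative (N c) (at x) h))) (at x)"
    by (rule has_derivative_transform_within_open[OF has_derivative_apply_linear[OF o x, of ?D, OF lin _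
            smooth_on_has_derivative[OF N_smooth[OF c] xc]] o x])
      (assumption, rule smooth_on_differentiable[OF smooth_on_frechet_derivative[OF transition_smooth[OF c d]] x],
        rule N_transition[OF c d, symmetric])
  ultimately have "frechet_derivative (N d) (at (?\<tau> x)) (?D x u) =
     frechet_derivative (\<lambda>y. ?D y (N c x)) (at x) u + ?D x (frechet_derivative (N c) (at x) u)"
    by (rule has_derivative_unique[THEN fun_cong])
  then show ?thesis
    unfolding nabla_def N_transition[OF c d x] linear_add[OF lin[OF x]]
      conn_transition[OF c d x, of "N c x" u, symmetric] by (simp add: add_ac)
qed

lemma normal_projection_transition:
  assumes c: "c \<in> A" and d: "d \<in> A" and x: "x \<in> overlap c d"
  shows "normal_projection (g d) (N d) (transition c d x) (frechet_derivative (transition c d) (at x) u)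
     = frechet_derivative (transition c d) (at x) (normal_projection (g c) (N c) x u)"
proof -
  have lin: "linear (frechet_derivative (transition c d) (at x))"
    by (rule has_derivative_linear[OF transition_derivative[OF c d x]])
  show ?thesis
    by (simp add: normal_projection_def N_transition[OF c d x] metric_transition[OF c d x]
        linear_add[OF lin] linear_scale[OF lin])
qed

definition umbilic_in :: "('m, 'v \<times> real) chart \<Rightarrow> 'm \<Rightarrow> real \<Rightarrow> bool" where
  "umbilic_in c p \<mu> \<longleftrightarrow>
     (\<forall>w. nabla (N c) (\<Gamma> c) (cmap c p) w = \<mu> *\<^sub>R normal_projection (g c) (N c) (cmap c p) w)"

text \<open>
The factor must not change, since a totally umbilical leaf has one factor for all charts at a point.
Every vector in the second chart comes from the first one, since the
derivative of a transition map is invertible.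
\<close>

lemma umbilic_in_transition:
  assumes c: "c \<in> A" "p \<in> cdom c" and d: "d \<in> A" "p \<in> cdom d" and umb: "umbilic_in c p \<mu>"
  shows "umbilic_in d p \<mu>"
  unfolding umbilic_in_def
proof
  fix w
  let ?D = "frechet_derivative (transition c d) (at (cmap c p))"
  have o: "cmap c p \<in> overlap c d" using c d by (auto intro: overlapI)
  have lin: "linear ?D" by (rule has_derivative_linear[OF transition_derivative[OF c(1) d(1) o]])
  define v where "v = frechet_derivative (transition d c) (at (cmap d p)) w"
  have w: "w = ?D v" unfolding v_def by (rule transition_derivative_inverse[OF c(1) d(1) c(2) d(2), symmetric])
  have "nabla (N d) (\<Gamma> d) (cmap d p) w = ?D (nabla (N c) (\<Gamma> c) (cmap c p) v)"
    using nabla_transition[OF c(1) d(1) o, of v] unfolding transition_cmap[OF c] w[symmetric] .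
  also have "\<dots> = \<mu> *\<^sub>R ?D (normal_projection (g c) (N c) (cmap c p) v)"
  proof -
    have "nabla (N c) (\<Gamma> c) (cmap c p) v = \<mu> *\<^sub>R normal_projection (g c) (N c) (cmap c p) v"
      using umb unfolding umbilic_in_def by blast
    then show ?thesis by (simp add: linear_scale[OF lin])
  qed
  also have "\<dots> = \<mu> *\<^sub>R normal_projection (g d) (N d) (cmap d p) w"
    using normal_projection_transition[OF c(1) d(1) o, of v] unfolding transition_cmap[OF c] w[symmetric] by simp
  finally show "nabla (N d) (\<Gamma> d) (cmap d p) w = \<mu> *\<^sub>R normal_projection (g d) (N d) (cmap d p) w" .
qed

definition umbilic :: "'m \<Rightarrow> bool" where
  "umbilic p \<longleftrightarrow> (\<exists>\<mu>. \<forall>c\<in>F. p \<in> cdom c \<longrightarrow> umbilic_in c p \<mu>)"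

lemma umbilic_iff_chart:
  assumes c: "c \<in> F" "p \<in> cdom c"
  shows "umbilic p \<longleftrightarrow> foliated_chart.umbilic_at (g c) (N c) (\<Gamma> c) (cmap c p)"
proof -
  interpret foliated_chart "cimg c" "g c" "N c" "\<Gamma> c" \<kappa> by (rule foliated_chart_in[OF c(1)])
  have "umbilic_at (cmap c p) \<longleftrightarrow> (\<exists>\<mu>. umbilic_in c p \<mu>)"
    by (simp only: umbilic_at_def umbilic_in_def)
  also have "\<dots> \<longleftrightarrow> umbilic p"
    unfolding umbilic_def using umbilic_in_transition[OF F_chart[OF c(1)] c(2) F_chart] c by blast
  finally show ?thesis by simp
qed

text \<open>
The factor changes sign because the shape operator is \<open>- \<nabla>N\<close>.
\<close>

lemma totally_umbilical_iff: "totally_umbilical g \<Gamma> F N L \<longleftrightarrow> (\<forall>p\<in>L. umbilic p)"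
proof -
  have eq: "(\<forall>u v. second_fundamental_form g \<Gamma> N c (cmap c p) (u, 0) (v, 0)
          = \<mu> * g c (cmap c p) (u, 0) (v, 0)) \<longleftrightarrow> umbilic_in c p (- \<mu>)"
    if c: "c \<in> F" "p \<in> cdom c" for c p \<mu>
  proof -
    interpret foliated_chart "cimg c" "g c" "N c" "\<Gamma> c" \<kappa> by (rule foliated_chart_in[OF c(1)])
    have "cmap c p \<in> cimg c" by (rule chart_img[OF chart[OF F_chart[OF c(1)]] c(2)])
    from umbilic_iff_tangent[OF this, of "- \<mu>"] show ?thesis
      unfolding umbilic_in_def second_fundamental_form_def cov_def nabla_def
      by (simp only: minus_equation_iff mult_minus_left) (metis minus_minus)
  qed
  have "(\<exists>\<mu>. \<forall>c\<in>F. p \<in> cdom c \<longrightarrow> (\<forall>u v. second_fundamental_form g \<Gamma> N c (cmap c p) (u, 0) (v, 0)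
          = \<mu> * g c (cmap c p) (u, 0) (v, 0))) \<longleftrightarrow> umbilic p" for p
    unfolding umbilic_def using eq by (metis minus_minus)
  then show ?thesis unfolding totally_umbilical_def by blast
qed

subsection \<open>Integral curves of the normal field are timelike geodesics\<close>

lemma integral_curve_velocity:
  assumes \<gamma>: "integral_curve I \<gamma>" and t: "t \<in> I" and c: "c \<in> A" "\<gamma> t \<in> cdom c"
  shows "velocity c \<gamma> t = N c (cmap c (\<gamma> t))"
  unfolding velocity_def by (rule vector_derivative_at) (use assms in \<open>auto simp: integral_curve_def\<close>)

lemma integral_curve_timelike_geodesic:
  assumes \<gamma>: "integral_curve I \<gamma>" and "I \<noteq> {}"
  shows "timelike_geodesic A g \<Gamma> I \<gamma>"
proof -
  have I: "open I" "is_interval I" "continuous_on I \<gamma>" using \<gamma> by (auto simp: integral_curve_def)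
  have main: "(cmap c \<circ> \<gamma>) differentiable (at t) \<and> velocity c \<gamma> differentiable (at t) \<and>
        vector_derivative (velocity c \<gamma>) (at t) + \<Gamma> c (cmap c (\<gamma> t)) (velocity c \<gamma> t) (velocity c \<gamma> t) = 0 \<and>
        g c (cmap c (\<gamma> t)) (velocity c \<gamma> t) (velocity c \<gamma> t) < 0"
    if c: "c \<in> A" and t: "t \<in> I" and dom: "\<gamma> t \<in> cdom c" for c t
  proof -
    note ch = chart[OF c]
    define x where "x = cmap c (\<gamma> t)"
    have x: "x \<in> cimg c" unfolding x_def by (rule chart_img[OF ch dom])
    have der: "(cmap c \<circ> \<gamma> has_vector_derivative N c x) (at t)"
      using \<gamma> t c dom by (simp add: integral_curve_def x_def)
    obtain T where T: "open T" "t \<in> T" "T \<subseteq> I" "\<And>s. s \<in> T \<Longrightarrow> \<gamma> s \<in> cdom c"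
      using eventually_in_open[OF I(1,3) t chart_open_dom[OF ch] dom] by (elim exE conjE) blast
    have DN: "(N c has_derivative frechet_derivative (N c) (at x)) (at x)"
      by (rule smooth_on_has_derivative[OF N_smooth[OF c] x])
    have "((\<lambda>s. N c ((cmap c \<circ> \<gamma>) s)) has_derivative (\<lambda>h. frechet_derivative (N c) (at x) (h *\<^sub>R N c x))) (at t)"
      by (rule has_derivative_compose[OF der[unfolded has_vector_derivative_def]]) (use DN in \<open>simp add: x_def\<close>)
    then have "((\<lambda>s. N c ((cmap c \<circ> \<gamma>) s)) has_vector_derivative frechet_derivative (N c) (at x) (N c x)) (at t)"
      by (simp add: has_vector_derivative_def linear_scale[OF has_derivative_linear[OF DN]])
    then have vel: "(velocity c \<gamma> has_vector_derivative frechet_derivative (N c) (at x) (N c x)) (at t)"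
      by (rule has_vector_derivative_transform_within_open[OF _ T(1,2)])
        (use T(3,4) in \<open>auto simp: integral_curve_velocity[OF \<gamma> _ c]\<close>)
    have v: "velocity c \<gamma> t = N c x" unfolding x_def by (rule integral_curve_velocity[OF \<gamma> t c dom])
    have "frechet_derivative (N c) (at x) (N c x) + \<Gamma> c x (N c x) (N c x) = 0"
      using geod c x by (auto simp: geodesic_field_def cov_def)
    moreover have "g c x (N c x) (N c x) = -1" using normal c x by (auto simp: unit_timelike_normal_def)
    ultimately show ?thesis
      unfolding v x_def[symmetric] vector_derivative_at[OF vel]
      using differentiableI_vector[OF der] differentiableI_vector[OF vel] by simp
  qed
  then show ?thesis unfolding timelike_geodesic_def geodesic_def using I \<open>I \<noteq> {}\<close> by blast
qed

text \<open>
A maximal integral curve is a timelike geodesic, and by \<open>lifetime_maximal\<close> it is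
maximal even among geodesics, so completeness applies to it.
\<close>

lemma complete_field_of_geodesically_complete:
  assumes "timelike_geodesically_complete A g \<Gamma>" shows "complete_field A N"
proof
  fix p
  have ne: "lifetime p \<noteq> {}" using zero_in_lifetime by blast
  have tg: "timelike_geodesic A g \<Gamma> (lifetime p) (\<lambda>t. flow t p)"
    by (rule integral_curve_timelike_geodesic[OF flow_integral_curve ne])
  have "J = lifetime p" if J: "geodesic A \<Gamma> J \<delta>" "lifetime p \<subseteq> J" "\<forall>t\<in>lifetime p. \<delta> t = flow t p" for J \<delta>
    by (rule lifetime_maximal[of J \<delta>]) (use J in \<open>auto simp: geodesic_def\<close>)
  then have "maximal_geodesic A \<Gamma> (lifetime p) (\<lambda>t. flow t p)"
    using tg by (auto simp: maximal_geodesic_def timelike_geodesic_def)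
  with tg assms show "lifetime p = UNIV" unfolding timelike_geodesically_complete_def by blast
qed

end

section \<open>The flow and the leaves\<close>

lemma same_plaque_sym:
  "same_plaque F p q \<Longrightarrow> same_plaque F q p"
  unfolding same_plaque_def by (metis (no_types, lifting))

lemma same_plaque_rtranclp_sym: "(same_plaque F)\<^sup>*\<^sup>* p q \<Longrightarrow> (same_plaque F)\<^sup>*\<^sup>* q p"
  by (rule sympD[OF symp_rtranclp]) (auto intro: sympI same_plaque_sym)

context geodesic_foliation
begin

text \<open>
Near \<open>p\<close> the transversal component of \<open>N\<close> is a nonvanishing function \<open>\<phi>\<close> of the transversal coordinate
(\<open>snd_N_constant_along_slice\<close>). An antiderivative \<open>\<tau>\<close> of \<open>1/\<phi>\<close> has unit derivative in the
direction \<open>N\<close> and is injective, so near \<open>p\<close> its level sets are the plaques.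
\<close>

lemma unit_speed_function:
  assumes c: "c \<in> F" and p: "p \<in> cdom c"
  obtains U \<tau> where "open U" "cmap c p \<in> U" "U \<subseteq> cimg c" "inj_on \<tau> (snd ` U)"
    "\<And>x. x \<in> U \<Longrightarrow> (\<tau> has_real_derivative inverse (snd (N c x))) (at (snd x))"
proof -
  interpret foliated_chart "cimg c" "g c" "N c" "\<Gamma> c" \<kappa> by (rule foliated_chart_in[OF c])
  note ch = chart[OF F_chart[OF c]]
  define x0 where "x0 = cmap c p"
  obtain r where r: "r > 0" "cball x0 r \<subseteq> cimg c"
    using open_S chart_img[OF ch p] open_contains_cball unfolding x0_def by blast
  define y0 where "y0 = snd x0"
  define pt where "pt y = (fst x0, y)" for y :: real
  define \<phi> where "\<phi> y = snd (N c (pt y))" for y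
  have pt: "pt y \<in> cball x0 r" if "\<bar>y - y0\<bar> \<le> r" for y
    using that by (cases x0) (simp add: pt_def y0_def dist_Pair_Pair dist_real_def abs_minus_commute)
  have \<phi>_nz: "\<phi> y \<noteq> 0" if "\<bar>y - y0\<bar> \<le> r" for y
    unfolding \<phi>_def by (rule snd_N_nonzero) (use pt[OF that] r(2) in blast)
  have "continuous_on {y0 - r..y0 + r} (\<lambda>y. inverse (\<phi> y))"
  proof (rule continuous_on_inverse)
    have "continuous_on {y0 - r..y0 + r} pt" unfolding pt_def by (intro continuous_intros)
    moreover have "pt ` {y0 - r..y0 + r} \<subseteq> cimg c" using pt r(2) by (auto simp: abs_le_iff)
    ultimately have "continuous_on {y0 - r..y0 + r} (\<lambda>y. N c (pt y))"
      by (rule continuous_on_compose2[OF smooth_on_continuous[OF smooth_N]])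
    then show "continuous_on {y0 - r..y0 + r} \<phi>" unfolding \<phi>_def by (rule continuous_on_snd)
    show "\<forall>y\<in>{y0 - r..y0 + r}. \<phi> y \<noteq> 0" using \<phi>_nz by (auto simp: abs_le_iff)
  qed
  then obtain \<tau> where \<tau>: "\<And>y. y \<in> {y0 - r..y0 + r} \<Longrightarrow>
      (\<tau> has_vector_derivative inverse (\<phi> y)) (at y within {y0 - r..y0 + r})"
    by (rule antiderivative_continuous) blast
  have \<tau>': "(\<tau> has_real_derivative inverse (\<phi> y)) (at y)" if y: "y \<in> {y0 - r<..<y0 + r}" for y
  proof -
    have "(\<tau> has_vector_derivative inverse (\<phi> y)) (at y within {y0 - r<..<y0 + r})"
      by (rule has_vector_derivative_within_subset[OF \<tau>]) (use y in auto)
    then show ?thesis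
      unfolding at_within_open[OF y open_greaterThanLessThan] has_real_derivative_iff_has_vector_derivative .
  qed
  have inU: "\<bar>snd x - y0\<bar> < r" if "x \<in> ball x0 r" for x
    using dist_snd_le[of x x0] that by (simp add: y0_def dist_real_def dist_commute)
  \<comment> \<open>by the mean value theorem a repeated value would be a zero of \<open>1/\<phi>\<close>\<close>
  have no_repeat: "\<tau> y \<noteq> \<tau> y'" if "y0 - r < y" "y < y'" "y' < y0 + r" for y y'
  proof
    assume eq: "\<tau> y = \<tau> y'"
    have der: "(\<tau> has_real_derivative inverse (\<phi> z)) (at z)" if "y \<le> z" "z \<le> y'" for z
      by (rule \<tau>') (use that \<open>y0 - r < y\<close> \<open>y' < y0 + r\<close> in auto)
    from MVT2[OF \<open>y < y'\<close> der] obtain z where "y < z" "z < y'" "\<tau> y' - \<tau> y = (y' - y) * inverse (\<phi> z)" by blast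
    with eq \<open>y < y'\<close> have "\<phi> z = 0" by simp
    then show False using \<phi>_nz[of z] \<open>y < z\<close> \<open>z < y'\<close> that by simp
  qed
  show ?thesis
  proof (rule that[of "ball x0 r" \<tau>])
    show "inj_on \<tau> (snd ` ball x0 r)"
    proof (rule inj_onI)
      fix y y' assume "y \<in> snd ` ball x0 r" "y' \<in> snd ` ball x0 r" and eq: "\<tau> y = \<tau> y'"
      then have "\<bar>y - y0\<bar> < r" "\<bar>y' - y0\<bar> < r" using inU by blast+
      then have "y0 - r < y" "y < y0 + r" "y0 - r < y'" "y' < y0 + r" by auto
      then show "y = y'" using no_repeat[of y y'] no_repeat[of y' y] eq by (cases y y' rule: linorder_cases) auto
    qed
    show "ball x0 r \<subseteq> cimg c" using r(2) ball_subset_cball by blast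
    fix x assume x: "x \<in> ball x0 r"
    have y: "\<bar>snd x - y0\<bar> < r" by (rule inU[OF x])
    have "closed_segment x (pt (snd x)) \<subseteq> cball x0 r"
      by (rule closed_segment_subset) (use x y pt[of "snd x"] in auto)
    then have "snd (N c x) = snd (N c (pt (snd x)))"
      by (intro snd_N_constant_along_slice) (use r(2) in \<open>auto simp: pt_def\<close>)
    moreover have "snd x \<in> {y0 - r<..<y0 + r}" using y by auto
    ultimately show "(\<tau> has_real_derivative inverse (snd (N c x))) (at (snd x))"
      using \<tau>'[of "snd x"] by (simp add: \<phi>_def)
  qed (use r(1) in \<open>auto simp: x0_def\<close>)
qed

end

locale complete_geodesic_foliation = geodesic_foliation A F g N \<Gamma> \<kappa>
  for A F :: "('m::t2_space, 'v::euclidean_space \<times> real) chart set" and g N \<Gamma> \<kappa> +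
  assumes geodesically_complete: "timelike_geodesically_complete A g \<Gamma>"
begin

sublocale complete_field A N
  by (rule complete_field_of_geodesically_complete[OF geodesically_complete])

text \<open>
In a small box the flow translates \<open>\<tau>\<close>. As \<open>\<tau>\<close> separates plaques, it follows both that
plaques are carried to plaques and that every nearby point flows into a given plaque.
\<close>

lemma plaque_box:
  assumes c: "c \<in> F" and p: "p \<in> cdom c"
  obtains W \<epsilon> \<tau> where "open W" "p \<in> W" "W \<subseteq> cdom c" "\<epsilon> > (0::real)"
    "\<And>q s. q \<in> W \<Longrightarrow> \<bar>s\<bar> < \<epsilon> \<Longrightarrow> flow s q \<in> cdom c"
    "\<And>s. \<bar>s\<bar> < \<epsilon> \<Longrightarrow> continuous_on W (flow s)"
    "\<And>q s. q \<in> W \<Longrightarrow> \<bar>s\<bar> < \<epsilon> \<Longrightarrow> \<tau> (snd (cmap c (flow s q))) = \<tau> (snd (cmap c q)) + s"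
    "\<And>q q' s s'. q \<in> W \<Longrightarrow> q' \<in> W \<Longrightarrow> \<bar>s\<bar> < \<epsilon> \<Longrightarrow> \<bar>s'\<bar> < \<epsilon> \<Longrightarrow>
       \<tau> (snd (cmap c (flow s q))) = \<tau> (snd (cmap c (flow s' q'))) \<Longrightarrow>
       snd (cmap c (flow s q)) = snd (cmap c (flow s' q'))"
    "isCont (\<lambda>q. \<tau> (snd (cmap c q))) p"
proof -
  note cA = F_chart[OF c]
  interpret foliated_chart "cimg c" "g c" "N c" "\<Gamma> c" \<kappa> by (rule foliated_chart_in[OF c])
  obtain U \<tau> where U: "open U" "cmap c p \<in> U" "U \<subseteq> cimg c" and inj: "inj_on \<tau> (snd ` U)"
    and \<tau>: "\<And>x. x \<in> U \<Longrightarrow> (\<tau> has_real_derivative inverse (snd (N c x))) (at (snd x))"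
    by (rule unit_speed_function[OF c p]) blast
  obtain W \<epsilon> where W: "open W" "p \<in> W" "W \<subseteq> cdom c" "\<epsilon> > 0"
    and box: "\<And>q s. q \<in> W \<Longrightarrow> \<bar>s\<bar> < \<epsilon> \<Longrightarrow> flow s q \<in> cdom c \<and> cmap c (flow s q) \<in> U"
    and cont: "\<And>s. \<bar>s\<bar> < \<epsilon> \<Longrightarrow> continuous_on W (flow s)"
    by (rule flow_box_complete[OF cA p U(1,2)]) blast
  show ?thesis
  proof (rule that[of W \<epsilon> \<tau>])
    fix q s assume q: "q \<in> W" and s: "\<bar>s\<bar> < \<epsilon>"
    show "flow s q \<in> cdom c" using box[OF q s] by blast
    define h where "h t = \<tau> (snd (cmap c (flow t q))) - t" for t
    have "(h has_derivative (\<lambda>h. 0)) (at t within {-\<epsilon><..<\<epsilon>})" if t: "t \<in> {-\<epsilon><..<\<epsilon>}" for t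
    proof -
      have tb: "flow t q \<in> cdom c" "cmap c (flow t q) \<in> U" using box[OF q, of t] t by auto
      have vel: "((\<lambda>t. snd (cmap c (flow t q))) has_vector_derivative snd (N c (cmap c (flow t q)))) (at t)"
        using has_derivative_snd[OF flow_velocity[OF cA tb(1), unfolded has_vector_derivative_def]]
        by (simp add: has_vector_derivative_def)
      have "snd (N c (cmap c (flow t q))) \<noteq> 0" by (rule snd_N_nonzero) (use U(3) tb(2) in blast)
      then have "((\<lambda>t. \<tau> (snd (cmap c (flow t q)))) has_real_derivative 1) (at t)"
        using DERIV_chain2[OF \<tau>[OF tb(2)] vel[folded has_real_derivative_iff_has_vector_derivative]] by simp
      then have "(h has_real_derivative 1 - 1) (at t)" unfolding h_def by (rule DERIV_diff[OF _ DERIV_ident])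
      then have "(h has_derivative (\<lambda>h. 0)) (at t)"
        unfolding has_field_derivative_def by (rule has_derivative_eq_rhs) (simp add: fun_eq_iff)
      then show ?thesis by (rule has_derivative_at_withinI)
    qed
    then have "h s = h 0"
      using has_derivative_zero_unique[of "{-\<epsilon><..<\<epsilon>}" h 0 s] s W(4) by (auto simp: abs_less_iff)
    then show "\<tau> (snd (cmap c (flow s q))) = \<tau> (snd (cmap c q)) + s" by (simp add: h_def flow_zero)
  next
    fix q q' s s' assume q: "q \<in> W" "q' \<in> W" "\<bar>s\<bar> < \<epsilon>" "\<bar>s'\<bar> < \<epsilon>"
      and eq: "\<tau> (snd (cmap c (flow s q))) = \<tau> (snd (cmap c (flow s' q')))"
    show "snd (cmap c (flow s q)) = snd (cmap c (flow s' q'))"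
      by (rule inj_onD[OF inj eq]) (use box q in blast)+
  next
    have "isCont (cmap c) p"
      using chart_continuous[OF chart[OF cA]] chart_open_dom[OF chart[OF cA]] p
      by (simp add: continuous_on_eq_continuous_at)
    then have "isCont (\<lambda>q. snd (cmap c q)) p" by (rule continuous_snd)
    then show "isCont (\<lambda>q. \<tau> (snd (cmap c q))) p"
      by (rule isCont_o2) (rule DERIV_isCont[OF \<tau>[OF U(2)]])
  qed (use W cont in blast)+
qed

subsection \<open>Leaves are carried to leaves\<close>

lemma plaque_change:
  assumes "c \<in> F" "d \<in> F" "r \<in> cdom c" "r \<in> cdom d"
  shows "\<forall>\<^sub>F q in nhds r. snd (cmap c q) = snd (cmap c r) \<longrightarrow> snd (cmap d q) = snd (cmap d r)"
proof -
  have "\<forall>c\<in>F. \<forall>d\<in>F. \<forall>p\<in>cdom c \<inter> cdom d.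
        \<exists>W. open W \<and> p \<in> W \<and> W \<subseteq> cdom c \<inter> cdom d \<and>
          (\<forall>q\<in>W. \<forall>r\<in>W. snd (cmap c q) = snd (cmap c r) \<longrightarrow> snd (cmap d q) = snd (cmap d r))"
    using fol unfolding spacelike_foliation_def foliation_def by (elim conjE)
  from this[THEN bspec, OF assms(1), THEN bspec, OF assms(2), THEN bspec, OF IntI[OF assms(3,4)]]
  obtain W where W: "open W" "r \<in> W"
    "\<forall>q\<in>W. \<forall>r\<in>W. snd (cmap c q) = snd (cmap c r) \<longrightarrow> snd (cmap d q) = snd (cmap d r)"
    by (elim exE conjE) (rule that)
  show ?thesis
    by (rule eventually_mono[OF eventually_nhds_in_open[OF W(1,2)]]) (rule W(3)[THEN bspec, THEN bspec, OF _ W(2)])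
qed

text \<open>
Germwise at \<open>r\<close>, and for all charts at the two ends, so that the property can be composed along a trajectory
which crosses many charts.
\<close>

definition preserves_plaques :: "real \<Rightarrow> 'm \<Rightarrow> bool" where
  "preserves_plaques t r \<longleftrightarrow> isCont (flow t) r \<and>
     (\<forall>c\<in>F. \<forall>d\<in>F. r \<in> cdom c \<and> flow t r \<in> cdom d \<longrightarrow>
        (\<forall>\<^sub>F q in nhds r. snd (cmap c q) = snd (cmap c r) \<longrightarrow> snd (cmap d (flow t q)) = snd (cmap d (flow t r))))"

lemma flow_eventually:
  assumes "isCont (flow t) r" "eventually P (nhds (flow t r))"
  shows "\<forall>\<^sub>F q in nhds r. P (flow t q)"
  using assms(2) assms(1)[unfolded isCont_def tendsto_at_iff_tendsto_nhds]
  unfolding filterlim_iff by blast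

lemma preserves_plaques_local:
  obtains W \<epsilon> where "open W" "p \<in> W" "\<epsilon> > 0" "\<And>r t. r \<in> W \<Longrightarrow> \<bar>t\<bar> < \<epsilon> \<Longrightarrow> preserves_plaques t r"
proof -
  obtain e where e: "e \<in> F" "p \<in> cdom e" by (rule F_chart_at)
  obtain W \<epsilon> \<tau> where W: "open W" "p \<in> W" "W \<subseteq> cdom e" "\<epsilon> > (0::real)"
    and dom: "\<And>q s. q \<in> W \<Longrightarrow> \<bar>s\<bar> < \<epsilon> \<Longrightarrow> flow s q \<in> cdom e"
    and cont: "\<And>s. \<bar>s\<bar> < \<epsilon> \<Longrightarrow> continuous_on W (flow s)"
    and \<tau>: "\<And>q s. q \<in> W \<Longrightarrow> \<bar>s\<bar> < \<epsilon> \<Longrightarrow> \<tau> (snd (cmap e (flow s q))) = \<tau> (snd (cmap e q)) + s"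
    and inj: "\<And>q q' s s'. q \<in> W \<Longrightarrow> q' \<in> W \<Longrightarrow> \<bar>s\<bar> < \<epsilon> \<Longrightarrow> \<bar>s'\<bar> < \<epsilon> \<Longrightarrow>
       \<tau> (snd (cmap e (flow s q))) = \<tau> (snd (cmap e (flow s' q'))) \<Longrightarrow>
       snd (cmap e (flow s q)) = snd (cmap e (flow s' q'))"
    by (rule plaque_box[OF e]) (rule that)
  show ?thesis
  proof (rule that[of W \<epsilon>])
    fix r t assume r: "r \<in> W" and t: "\<bar>t\<bar> < \<epsilon>"
    have ct: "isCont (flow t) r" using cont[OF t] W(1) r by (simp add: continuous_on_eq_continuous_at)
    show "preserves_plaques t r"
      unfolding preserves_plaques_def
    proof (intro conjI ct ballI impI)
      fix c d assume cd: "c \<in> F" "d \<in> F" "r \<in> cdom c \<and> flow t r \<in> cdom d"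
      have "\<forall>\<^sub>F q in nhds r. q \<in> W" using W(1) r by (rule eventually_nhds_in_open)
      moreover have "\<forall>\<^sub>F q in nhds r. snd (cmap c q) = snd (cmap c r) \<longrightarrow> snd (cmap e q) = snd (cmap e r)"
        by (rule plaque_change) (use cd e W(3) r in auto)
      moreover have "\<forall>\<^sub>F q in nhds r. snd (cmap e (flow t q)) = snd (cmap e (flow t r)) \<longrightarrow>
          snd (cmap d (flow t q)) = snd (cmap d (flow t r))"
        by (rule flow_eventually[OF ct plaque_change]) (use cd e dom[OF r t] in auto)
      ultimately show "\<forall>\<^sub>F q in nhds r. snd (cmap c q) = snd (cmap c r) \<longrightarrow>
          snd (cmap d (flow t q)) = snd (cmap d (flow t r))"
      proof eventually_elim
        case (elim q)
        show ?case
        proof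
          assume "snd (cmap c q) = snd (cmap c r)"
          then have "snd (cmap e q) = snd (cmap e r)" using elim(2) by blast
          then have "\<tau> (snd (cmap e (flow t q))) = \<tau> (snd (cmap e (flow t r)))"
            by (simp add: \<tau>[OF elim(1) t] \<tau>[OF r t])
          from inj[OF elim(1) r t t this] elim(3)
          show "snd (cmap d (flow t q)) = snd (cmap d (flow t r))" by blast
        qed
      qed
    qed
  qed (rule W)+
qed

lemma preserves_plaques_compose:
  assumes s: "preserves_plaques s r" and t: "preserves_plaques t (flow s r)"
  shows "preserves_plaques (s + t) r"
proof -
  have fl: "flow (s + t) = (\<lambda>q. flow t (flow s q))" by (rule ext) (rule flow_add)
  have cs: "isCont (flow s) r" and ct: "isCont (flow t) (flow s r)"
    using s t by (auto simp: preserves_plaques_def)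
  show ?thesis
    unfolding preserves_plaques_def fl
  proof (intro conjI ballI impI)
    show "isCont (\<lambda>q. flow t (flow s q)) r" by (rule isCont_o2[OF cs ct])
    fix c d assume cd: "c \<in> F" "d \<in> F" "r \<in> cdom c \<and> flow t (flow s r) \<in> cdom d"
    obtain e where e: "e \<in> F" "flow s r \<in> cdom e" by (rule F_chart_at)
    have "\<forall>\<^sub>F q in nhds r. snd (cmap c q) = snd (cmap c r) \<longrightarrow> snd (cmap e (flow s q)) = snd (cmap e (flow s r))"
      using s cd e unfolding preserves_plaques_def by blast
    moreover have "\<forall>\<^sub>F q in nhds (flow s r). snd (cmap e q) = snd (cmap e (flow s r)) \<longrightarrow>
        snd (cmap d (flow t q)) = snd (cmap d (flow t (flow s r)))"
      using t cd e unfolding preserves_plaques_def by blast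
    note flow_eventually[OF cs this]
    ultimately show "\<forall>\<^sub>F q in nhds r. snd (cmap c q) = snd (cmap c r) \<longrightarrow>
        snd (cmap d (flow t (flow s q))) = snd (cmap d (flow t (flow s r)))"
      by eventually_elim blast
  qed
qed

text \<open>
Along a trajectory, short flows preserve plaques on a neighbourhood of each point, uniformly in
time. By composition the property does not change under small changes of \<open>t\<close>, and it holds at \<open>t = 0\<close>.
\<close>

lemma preserves_plaques: "preserves_plaques t r"
proof (rule connected_induction_simple[of UNIV 0 t "\<lambda>t. preserves_plaques t r"])
  show "preserves_plaques 0 r" by (rule preserves_plaques_local[of r]) simp
  fix a :: real
  obtain W \<epsilon> where W: "open W" "flow a r \<in> W" "\<epsilon> > 0"
    and loc: "\<And>q s. q \<in> W \<Longrightarrow> \<bar>s\<bar> < \<epsilon> \<Longrightarrow> preserves_plaques s q"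
    by (rule preserves_plaques_local[of "flow a r"]) blast
  obtain T where T: "open T" "a \<in> T" "\<And>s. s \<in> T \<Longrightarrow> flow s r \<in> W"
    using eventually_in_open[OF open_UNIV flow_continuous_time UNIV_I W(1,2)] by (elim exE conjE) blast
  let ?T = "T \<inter> ball a (\<epsilon>/2)"
  have step: "preserves_plaques y r" if "x \<in> ?T" "y \<in> ?T" "preserves_plaques x r" for x y
  proof -
    \<comment> \<open>both times lie within \<open>\<epsilon>/2\<close> of \<open>a\<close>\<close>
    have "\<bar>y - x\<bar> < \<epsilon>" using that dist_triangle_less_add[of x a "\<epsilon>/2" y "\<epsilon>/2"]
      by (simp add: dist_real_def abs_minus_commute)
    then have "preserves_plaques (y - x) (flow x r)" using loc T(3) that(1) by blast
    from preserves_plaques_compose[OF that(3) this] show ?thesis by simp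
  qed
  have T': "openin (top_of_set UNIV) ?T" "a \<in> ?T" using T(1,2) W(3) by auto
  show "\<exists>T. openin (top_of_set UNIV) T \<and> a \<in> T \<and>
      (\<forall>x\<in>T. \<forall>y\<in>T. preserves_plaques x r \<longrightarrow> preserves_plaques y r)"
    by (intro exI[of _ ?T] conjI ballI impI T') (rule step)
qed auto

text \<open>
Plaques are connected, and on a plaque the leaf that is reached after time \<open>t\<close> is locally constant.
\<close>

lemma flow_plaque_in_leaf:
  assumes "same_plaque F p q" shows "(same_plaque F)\<^sup>*\<^sup>* (flow t p) (flow t q)"
proof -
  obtain c where c: "c \<in> F" "p \<in> cdom c" "q \<in> cdom c" "snd (cmap c p) = snd (cmap c q)"
    using assms unfolding same_plaque_def by blast
  note ch = chart[OF F_chart[OF c(1)]]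
  obtain P Q where PQ: "connected P" "cimg c = P \<times> Q"
    using fol c(1) unfolding spacelike_foliation_def foliation_def by blast
  define y where "y = snd (cmap c p)"
  define S where "S = {r \<in> cdom c. snd (cmap c r) = y}"
  have "S = cinv c ` (P \<times> {y})"
  proof (intro set_eqI iffI)
    fix r assume r: "r \<in> S"
    then have "cmap c r \<in> P \<times> {y}"
      using chart_img[OF ch, of r] PQ(2) by (auto simp: S_def mem_Times_iff)
    moreover have "r = cinv c (cmap c r)" using r by (simp add: S_def chart_inv_left[OF ch])
    ultimately show "r \<in> cinv c ` (P \<times> {y})" by (rule rev_image_eqI)
  next
    fix r assume "r \<in> cinv c ` (P \<times> {y})"
    then obtain a where a: "a \<in> P" "r = cinv c (a, y)" by auto
    have "y \<in> Q" using chart_img[OF ch c(2)] PQ(2) by (auto simp: y_def mem_Times_iff)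
    then have "(a, y) \<in> cimg c" using a(1) PQ(2) by simp
    then show "r \<in> S" by (simp add: S_def a(2) chart_inv_dom[OF ch] chart_inv_right[OF ch])
  qed
  moreover have "connected (cinv c ` (P \<times> {y}))"
  proof (rule connected_continuous_image)
    have "y \<in> Q" using chart_img[OF ch c(2)] PQ(2) by (auto simp: y_def mem_Times_iff)
    then show "continuous_on (P \<times> {y}) (cinv c)"
      by (intro continuous_on_subset[OF chart_inv_continuous[OF ch]]) (use PQ(2) in auto)
    show "connected (P \<times> {y})" by (intro connected_Times PQ(1) connected_sing)
  qed
  ultimately have conn: "connected S" by simp
  let ?R = "\<lambda>a b. (same_plaque F)\<^sup>*\<^sup>* (flow t a) (flow t b)"
  show ?thesis
  proof (rule connected_equivalence_relation[OF conn, of p q ?R])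
    fix a assume a: "a \<in> S"
    obtain d where d: "d \<in> F" "flow t a \<in> cdom d" by (rule F_chart_at)
    have ct: "isCont (flow t) a"
      and plaque: "\<forall>\<^sub>F r in nhds a. snd (cmap c r) = snd (cmap c a) \<longrightarrow>
        snd (cmap d (flow t r)) = snd (cmap d (flow t a))"
      using preserves_plaques[of t a] c(1) d a unfolding preserves_plaques_def S_def by blast+
    have "\<forall>\<^sub>F r in nhds a. flow t r \<in> cdom d"
      by (rule flow_eventually[OF ct eventually_nhds_in_open[OF chart_open_dom[OF chart[OF F_chart[OF d(1)]]] d(2)]])
    with plaque have "\<forall>\<^sub>F r in nhds a. snd (cmap c r) = snd (cmap c a) \<longrightarrow> same_plaque F (flow t a) (flow t r)"
    proof eventually_elim
      case (elim r)
      show ?case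
      proof
        assume "snd (cmap c r) = snd (cmap c a)"
        with elim(1) have "snd (cmap d (flow t a)) = snd (cmap d (flow t r))" by simp
        with d elim(2) show "same_plaque F (flow t a) (flow t r)" unfolding same_plaque_def by blast
      qed
    qed
    then obtain V where V: "open V" "a \<in> V" "\<And>r. r \<in> V \<Longrightarrow> snd (cmap c r) = snd (cmap c a) \<Longrightarrow> same_plaque F (flow t a) (flow t r)"
      unfolding eventually_nhds by blast
    show "\<exists>T. openin (top_of_set S) T \<and> a \<in> T \<and> (\<forall>x\<in>T. ?R a x)"
    proof (intro exI[of _ "S \<inter> V"] conjI ballI)
      show "openin (top_of_set S) (S \<inter> V)" using V(1) by (rule openin_open_Int)
      show "a \<in> S \<inter> V" using a V(2) by simp
      fix x assume x: "x \<in> S \<inter> V"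
      then have "same_plaque F (flow t a) (flow t x)" using a by (intro V(3)) (auto simp: S_def)
      then show "?R a x" by (rule r_into_rtranclp)
    qed
  next
    show "p \<in> S" "q \<in> S" using c by (auto simp: S_def y_def)
  next
    show "?R y x" if "?R x y" for x y using that by (rule same_plaque_rtranclp_sym)
  next
    show "?R x z" if "?R x y" "?R y z" for x y z using that by (rule rtranclp_trans)
  qed
qed

lemma flow_leaf: "(same_plaque F)\<^sup>*\<^sup>* p q \<Longrightarrow> (same_plaque F)\<^sup>*\<^sup>* (flow t p) (flow t q)"
  by (induction rule: rtranclp_induct) (auto intro: rtranclp_trans flow_plaque_in_leaf)

text \<open>
The time to flow is the difference of the values of \<open>\<tau>\<close> at the two points.
\<close>

lemma nearby_points_flow_into_plaque:
  obtains W where "open W" "p \<in> W" "\<And>q. q \<in> W \<Longrightarrow> \<exists>s. same_plaque F p (flow s q)"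
proof -
  obtain c where c: "c \<in> F" "p \<in> cdom c" by (rule F_chart_at)
  obtain W \<epsilon> \<tau> where W: "open W" "p \<in> W" "W \<subseteq> cdom c" "\<epsilon> > (0::real)"
    and dom: "\<And>q s. q \<in> W \<Longrightarrow> \<bar>s\<bar> < \<epsilon> \<Longrightarrow> flow s q \<in> cdom c"
    and \<tau>: "\<And>q s. q \<in> W \<Longrightarrow> \<bar>s\<bar> < \<epsilon> \<Longrightarrow> \<tau> (snd (cmap c (flow s q))) = \<tau> (snd (cmap c q)) + s"
    and inj: "\<And>q q' s s'. q \<in> W \<Longrightarrow> q' \<in> W \<Longrightarrow> \<bar>s\<bar> < \<epsilon> \<Longrightarrow> \<bar>s'\<bar> < \<epsilon> \<Longrightarrow>
       \<tau> (snd (cmap c (flow s q))) = \<tau> (snd (cmap c (flow s' q'))) \<Longrightarrow>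
       snd (cmap c (flow s q)) = snd (cmap c (flow s' q'))"
    and cont: "isCont (\<lambda>q. \<tau> (snd (cmap c q))) p"
    by (rule plaque_box[OF c]) (rule that)
  have "\<forall>\<^sub>F q in nhds p. dist (\<tau> (snd (cmap c q))) (\<tau> (snd (cmap c p))) < \<epsilon>"
    by (rule tendstoD[OF _ W(4)])
      (rule cont[unfolded isCont_def tendsto_at_iff_tendsto_nhds[of "\<lambda>q. \<tau> (snd (cmap c q))"]])
  then obtain V where V: "open V" "p \<in> V" "\<And>q. q \<in> V \<Longrightarrow> \<bar>\<tau> (snd (cmap c q)) - \<tau> (snd (cmap c p))\<bar> < \<epsilon>"
    unfolding eventually_nhds dist_real_def by blast
  show ?thesis
  proof (rule that[of "V \<inter> W"])
    show "open (V \<inter> W)" "p \<in> V \<inter> W" using V W by auto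
    fix q assume q: "q \<in> V \<inter> W"
    define s where "s = \<tau> (snd (cmap c p)) - \<tau> (snd (cmap c q))"
    have s: "\<bar>s\<bar> < \<epsilon>" using V(3)[of q] q by (simp add: s_def abs_minus_commute)
    have qW: "q \<in> W" using q by simp
    have "\<tau> (snd (cmap c (flow s q))) = \<tau> (snd (cmap c (flow 0 p)))"
      using \<tau>[OF qW s] by (simp add: s_def flow_zero)
    from inj[OF qW W(2) s _ this] have "snd (cmap c (flow s q)) = snd (cmap c p)"
      using W(4) by (simp add: flow_zero)
    then show "\<exists>s. same_plaque F p (flow s q)"
      unfolding same_plaque_def using c dom[OF qW s] by (intro exI[of _ s] bexI[of _ c]) simp_all
  qed
qed

subsection \<open>Umbilicity spreads along the flow\<close>

text \<open>
The set of times at which the trajectory is umbilical is open by \<open>umbilic_propagates\<close> and closed by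
\<open>not_umbilic_open\<close>.
\<close>

lemma umbilic_flow: assumes "umbilic p" shows "umbilic (flow t p)"
proof -
  define X where "X = {t. umbilic (flow t p)}"
  have near: "\<exists>\<delta>>0. \<forall>s. \<bar>s - t\<bar> < \<delta> \<longrightarrow> (umbilic (flow t p) \<longrightarrow> umbilic (flow s p)) \<and>
      (\<not> umbilic (flow t p) \<longrightarrow> \<not> umbilic (flow s p))" for t
  proof -
    obtain c where c: "c \<in> F" "flow t p \<in> cdom c" by (rule F_chart_at)
    note cA = F_chart[OF c(1)]
    note ch = chart[OF cA]
    interpret foliated_chart "cimg c" "g c" "N c" "\<Gamma> c" \<kappa> by (rule foliated_chart_in[OF c(1)])
    define x where "x s = cmap c (flow s p)" for s
    obtain T where T: "open T" "t \<in> T" "\<And>s. s \<in> T \<Longrightarrow> flow s p \<in> cdom c"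
      using eventually_in_open[OF open_UNIV flow_continuous_time UNIV_I chart_open_dom[OF ch] c(2)] by (elim exE conjE) blast
    then obtain \<epsilon> where \<epsilon>: "\<epsilon> > 0" "ball t \<epsilon> \<subseteq> T" using open_contains_ball by blast
    have dom: "flow s p \<in> cdom c" if "\<bar>s - t\<bar> < \<epsilon>" for s
    proof -
      have "s \<in> ball t \<epsilon>" using that by (simp add: dist_real_def abs_minus_commute)
      then show ?thesis using T(3) \<epsilon>(2) by blast
    qed
    have iff: "umbilic (flow s p) \<longleftrightarrow> umbilic_at (x s)" if "\<bar>s - t\<bar> < \<epsilon>" for s
      unfolding x_def by (rule umbilic_iff_chart[OF c(1) dom[OF that]])
    have tt: "\<bar>t - t\<bar> < \<epsilon>" using \<epsilon>(1) by simp
    show ?thesis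
    proof (cases "umbilic (flow t p)")
      case True
      have "\<exists>\<delta>>0. \<forall>s. \<bar>s - t\<bar> < \<delta> \<longrightarrow> umbilic_at (x s)"
      proof (rule umbilic_propagates[OF \<epsilon>(1)])
        show "x s \<in> cimg c" if "\<bar>s - t\<bar> < \<epsilon>" for s unfolding x_def by (rule chart_img[OF ch dom[OF that]])
        show "(x has_vector_derivative N c (x s)) (at s)" if "\<bar>s - t\<bar> < \<epsilon>" for s
          unfolding x_def by (rule flow_velocity[OF cA dom[OF that]])
        show "umbilic_at (x t)" using True iff[OF tt] by blast
      qed
      then obtain \<delta> where "\<delta> > 0" "\<And>s. \<bar>s - t\<bar> < \<delta> \<Longrightarrow> umbilic_at (x s)" by blast
      then show ?thesis using True iff \<epsilon>(1) by (intro exI[of _ "min \<epsilon> \<delta>"]) simp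
    next
      case False
      let ?Y = "{q \<in> cdom c. cmap c q \<in> {x \<in> cimg c. \<not> umbilic_at x}}"
      have Y: "open ?Y" by (rule chart_cmap_preimage[OF ch not_umbilic_open])
      have tY: "flow t p \<in> ?Y" using c(2) False iff[OF tt] chart_img[OF ch c(2)] by (simp add: x_def)
      obtain T' where T': "open T'" "t \<in> T'" "\<And>s. s \<in> T' \<Longrightarrow> flow s p \<in> ?Y"
        using eventually_in_open[OF open_UNIV flow_continuous_time UNIV_I Y tY] by (elim exE conjE) blast
      obtain \<delta> where \<delta>: "\<delta> > 0" "ball t \<delta> \<subseteq> T'" using T'(1,2) open_contains_ball by blast
      have "\<not> umbilic (flow s p)" if "\<bar>s - t\<bar> < min \<epsilon> \<delta>" for s
      proof -
        have "s \<in> ball t \<delta>" using that by (simp add: dist_real_def abs_minus_commute)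
        then have "flow s p \<in> ?Y" using T'(3) \<delta>(2) by blast
        then show ?thesis using iff[of s] that by (simp add: x_def)
      qed
      then show ?thesis using False \<epsilon>(1) \<delta>(1) by (intro exI[of _ "min \<epsilon> \<delta>"]) simp
    qed
  qed
  have "open X" "open (- X)"
    unfolding open_dist X_def dist_real_def using near by blast+
  then have "X = {} \<or> X = UNIV" using clopen[of X] by (simp add: closed_def)
  moreover have "0 \<in> X" using assms by (simp add: X_def flow_zero)
  ultimately show ?thesis by (auto simp: X_def)
qed

text \<open>
A point of the leaf of \<open>flow t p\<close> is carried back into the leaf of \<open>p\<close>, is umbilical there, and returns along
its own trajectory.
\<close>

lemma leaf_umbilic_flow:
  assumes "\<forall>q\<in>leaf F p. umbilic q" shows "\<forall>q\<in>leaf F (flow t p). umbilic q"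
proof
  fix q assume "q \<in> leaf F (flow t p)"
  then have "(same_plaque F)\<^sup>*\<^sup>* (flow (-t) (flow t p)) (flow (-t) q)"
    unfolding leaf_def by (intro flow_leaf) simp
  then have "flow (-t) q \<in> leaf F p" by (simp add: leaf_def flow_inverse)
  then have "umbilic (flow (-t) q)" using assms by blast
  then have "umbilic (flow t (flow (-t) q))" by (rule umbilic_flow)
  then show "umbilic q" by (simp add: flow_inverse)
qed

lemma leaf_eq: assumes "(same_plaque F)\<^sup>*\<^sup>* p q" shows "leaf F p = leaf F q"
  unfolding leaf_def
  by (intro Collect_cong iffI)
    (erule rtranclp_trans[OF same_plaque_rtranclp_sym[OF assms]], erule rtranclp_trans[OF assms])

theorem all_leaves_umbilical:
  assumes conn: "connected (UNIV :: 'm set)" and L: "L \<in> leaves F" "totally_umbilical g \<Gamma> F N L"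
    and L': "L' \<in> leaves F"
  shows "totally_umbilical g \<Gamma> F N L'"
proof -
  define H where "H = {p. \<forall>q\<in>leaf F p. umbilic q}"
  have flow_H: "flow s q \<in> H \<longleftrightarrow> q \<in> H" for s q
    using leaf_umbilic_flow[of q s] leaf_umbilic_flow[of "flow s q" "-s"] by (auto simp: H_def flow_inverse)
  have nbhd: "\<exists>W. open W \<and> p \<in> W \<and> (\<forall>q\<in>W. q \<in> H \<longleftrightarrow> p \<in> H)" for p
  proof -
    obtain W where W: "open W" "p \<in> W" "\<And>q. q \<in> W \<Longrightarrow> \<exists>s. same_plaque F p (flow s q)"
      by (rule nearby_points_flow_into_plaque[of p]) blast
    have "q \<in> H \<longleftrightarrow> p \<in> H" if "q \<in> W" for q
    proof -
      obtain s where "same_plaque F p (flow s q)" using W(3)[OF \<open>q \<in> W\<close>] by blast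
      then have "leaf F p = leaf F (flow s q)" by (intro leaf_eq r_into_rtranclp)
      then have "p \<in> H \<longleftrightarrow> flow s q \<in> H" by (simp add: H_def)
      then show ?thesis using flow_H by blast
    qed
    then show ?thesis using W(1,2) by blast
  qed
  have "\<exists>W. open W \<and> p \<in> W \<and> W \<subseteq> X" if X: "X = H \<or> X = - H" and p: "p \<in> X" for X p
  proof -
    obtain W where W: "open W" "p \<in> W" "\<And>q. q \<in> W \<Longrightarrow> q \<in> H \<longleftrightarrow> p \<in> H" using nbhd[of p] by blast
    have "W \<subseteq> X" using X p W(3) by blast
    with W(1,2) show ?thesis by blast
  qed
  then have "open H" "open (- H)" by (subst open_subopen; simp)+
  then have "H = {} \<or> H = UNIV" using conn[unfolded connected_clopen] by (simp add: closed_def)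
  moreover obtain p where p: "L = leaf F p" using L(1) unfolding leaves_def by blast
  then have "p \<in> H" using L(2) by (simp add: H_def totally_umbilical_iff)
  ultimately have "H = UNIV" by blast
  moreover obtain p' where "L' = leaf F p'" using L' unfolding leaves_def by blast
  ultimately show ?thesis unfolding totally_umbilical_iff H_def by blast
qed

end

theorem theorem3p2:
  fixes A F :: "('m::{t2_space, second_countable_topology}, (real ^ 'n::finite) \<times> real) chart set"
    and g :: "('m, (real ^ 'n) \<times> real) bform"
    and T N :: "('m, (real ^ 'n) \<times> real) vfield"
    and \<Gamma> :: "('m, (real ^ 'n) \<times> real) conn"
    and K :: real
  assumes "spacetime A g T"
    and "connected (UNIV :: 'm set)"
    and "levi_civita A g \<Gamma>"
    and "timelike_geodesically_complete A g \<Gamma>"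
    and "constant_sectional_curvature A g \<Gamma> K"
    and "spacelike_foliation A g F"
    and "unit_timelike_normal A g F N"
    and "geodesic_field A \<Gamma> N"
    and "\<exists>L\<in>leaves F. totally_umbilical g \<Gamma> F N L"
  shows "\<forall>L\<in>leaves F. totally_umbilical g \<Gamma> F N L"
proof -
  interpret complete_geodesic_foliation A F g N \<Gamma> K
    using assms by unfold_locales (auto simp: spacetime_def)
  show ?thesis using all_leaves_umbilical assms(2,9) by blast
qed

end
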